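(* Let $G$ and $H$ be finite simple graphs on $m$ and $n$ vertices, respectively (with disjoint vertex sets), such that $I(G)$ and $I(H)$ are strand connected. Then $I(G*H)$ is strand connected.
   Context: The join $G*H$ is the graph with vertex set $V(G)\sqcup V(H)$ and edge set $E(G)\sqcup E(H)\cup\{\{x,y\}:x\in V(G),\,y\in V(H)\}$. For a graph $G$ and a fixed field $\mathbb{K}$, $I(G)=(uv:\{u,v\}\in E(G))$ is its edge ideal in the standard graded polynomial ring $R$ over $\mathbb{K}$ whose variables are the vertices of $G$. For a homogeneous ideal $I\subset R$, the $j$-strand of $I$ is the set $\{i:\beta_{i,i+j}^R(R/I)\neq 0\}$. A non-empty $j$-strand is connected if it equals the integer interval $[q_j(I),p_j(I)]$, where $q_j(I)$ and $p_j(I)$ are its minimum and maximum. $I$ is strand connected if every non-empty strand is connected. *)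

theory Defs
  imports "HOL-Library.Poly_Mapping" "Jordan_Normal_Form.Matrix_Kernel"
begin

section \<open>Graphs and joins\<close>

record 'v sgraph =
  verts :: "'v set"
  edges :: "'v set set"

definition finite_simple_graph :: "'v sgraph \<Rightarrow> bool" where
  "finite_simple_graph G \<longleftrightarrow>
     finite (verts G) \<and> (\<forall>e\<in>edges G. e \<subseteq> verts G \<and> card e = 2)"

text \<open>The graphs are taken over a common vertex type; the unions below are the disjoint unions
  of the textbook definition only if \<open>verts G\<close> and \<open>verts H\<close> are disjoint.\<close>

definition graph_join :: "'v sgraph \<Rightarrow> 'v sgraph \<Rightarrow> 'v sgraph" where
  "graph_join G H = \<lparr>verts = verts G \<union> verts H,
     edges = edges G \<union> edges H \<union> {{x, y} | x y. x \<in> verts G \<and> y \<in> verts H}\<rparr>"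

section \<open>Polynomial rings and edge ideals\<close>

text \<open>A monomial is a finitely supported exponent function and a polynomial a finitely supported
  coefficient function; the product of \<open>Poly_Mapping\<close> is convolution, i.e. the usual one.
  \<open>polys V\<close> is the ring of polynomials in the variables \<open>V\<close>, inside the polynomials in all
  variables of type \<open>'v\<close>.\<close>

type_synonym ('v, 'k) mpoly = "('v \<Rightarrow>\<^sub>0 nat) \<Rightarrow>\<^sub>0 'k"

definition polys :: "'v set \<Rightarrow> ('v, 'k::field) mpoly set" where
  "polys V = {p. \<forall>t\<in>Poly_Mapping.keys p. Poly_Mapping.keys t \<subseteq> V}"

definition var :: "'v \<Rightarrow> ('v, 'k::field) mpoly" where
  "var v = Poly_Mapping.single (Poly_Mapping.single v 1) 1"

definition mon_deg :: "('v \<Rightarrow>\<^sub>0 nat) \<Rightarrow> nat" where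
  "mon_deg t = (\<Sum>v\<in>Poly_Mapping.keys t. Poly_Mapping.lookup t v)"

definition ideal_gen :: "'v set \<Rightarrow> ('v, 'k::field) mpoly set \<Rightarrow> ('v, 'k) mpoly set" where
  "ideal_gen V B = {(\<Sum>b\<in>S. c b * b) | S c. finite S \<and> S \<subseteq> B \<and> (\<forall>b\<in>S. c b \<in> polys V)}"

definition edge_ideal :: "'v sgraph \<Rightarrow> ('v, 'k::field) mpoly set" where
  "edge_ideal G = ideal_gen (verts G) {var u * var v | u v. {u, v} \<in> edges G}"

section \<open>Minimal graded free resolutions and graded Betti numbers\<close>

definition free_mod :: "'v set \<Rightarrow> nat \<Rightarrow> ('v, 'k::field) mpoly vec set" where
  "free_mod V n = {x \<in> carrier_vec n. \<forall>i<n. x $ i \<in> polys V}"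

text \<open>\<open>minimal_resolution V I D A\<close>: with \<open>R = polys V\<close>, the data \<open>D\<close> and \<open>A\<close> form a minimal graded
  free resolution \<open>\<cdots> \<rightarrow> F\<^sub>2 \<rightarrow> F\<^sub>1 \<rightarrow> F\<^sub>0 = R \<rightarrow> R/I \<rightarrow> 0\<close> of \<open>R/I\<close>. Here \<open>F\<^sub>i\<close> is the direct sum of the
  twists \<open>R(-d)\<close> for \<open>d\<close> in the list \<open>D i\<close> (so \<open>D i\<close> lists the degrees of the basis of \<open>F\<^sub>i\<close>),
  and \<open>A i\<close> is the matrix of the map from \<open>F\<close> at \<open>i + 1\<close> to \<open>F\<close> at \<open>i\<close>. The conditions say, in order:
  the shape and entries of the matrices; the maps preserve degrees (an entry in row \<open>a\<close> and column \<open>b\<close>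
  is homogeneous of degree \<open>D (i+1) ! b - D i ! a\<close>, and zero if this is negative); the entries lie in
  the maximal graded ideal (minimality); exactness at \<open>F\<^sub>0\<close>; exactness at \<open>F\<close> in position \<open>i + 1\<close>.
  The requirement \<open>F\<^sub>0 = R\<close> is the usual one for a proper ideal. For \<open>I = R\<close> there is no
  such resolution, so Betti numbers below are meaningful only for proper homogeneous ideals.\<close>

definition minimal_resolution ::
  "'v set \<Rightarrow> ('v, 'k::field) mpoly set \<Rightarrow> (nat \<Rightarrow> nat list) \<Rightarrow> (nat \<Rightarrow> ('v, 'k) mpoly mat) \<Rightarrow> bool"
where
  "minimal_resolution V I D A \<longleftrightarrow>
     D 0 = [0] \<and>
     (\<forall>i. A i \<in> carrier_mat (length (D i)) (length (D (Suc i)))) \<and>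
     (\<forall>i. \<forall>a<length (D i). \<forall>b<length (D (Suc i)). A i $$ (a, b) \<in> polys V) \<and>
     (\<forall>i. \<forall>a<length (D i). \<forall>b<length (D (Suc i)).
        \<forall>t\<in>Poly_Mapping.keys (A i $$ (a, b)). D i ! a + mon_deg t = D (Suc i) ! b) \<and>
     (\<forall>i. \<forall>a<length (D i). \<forall>b<length (D (Suc i)).
        Poly_Mapping.lookup (A i $$ (a, b)) 0 = 0) \<and>
     (\<lambda>x. (A 0 *\<^sub>v x) $ 0) ` free_mod V (length (D 1)) = I \<and>
     (\<forall>i. (\<lambda>x. A (Suc i) *\<^sub>v x) ` free_mod V (length (D (Suc (Suc i)))) =
          mat_kernel (A i) \<inter> free_mod V (length (D (Suc i))))"

text \<open>\<open>betti V I i j\<close> is the graded Betti number of \<open>R/I\<close> (not of \<open>I\<close>) in homological degree \<open>i\<close>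
  and internal degree \<open>j\<close>: the number of copies of \<open>R(-j)\<close> in \<open>F\<^sub>i\<close>, which is the same for all
  minimal graded free resolutions.\<close>

definition betti :: "'v set \<Rightarrow> ('v, 'k::field) mpoly set \<Rightarrow> nat \<Rightarrow> nat \<Rightarrow> nat" where
  "betti V I i j = (THE n. \<exists>D A. minimal_resolution V I D A \<and> n = count_list (D i) j)"

section \<open>Strand connectivity\<close>

definition strand :: "'v set \<Rightarrow> ('v, 'k::field) mpoly set \<Rightarrow> nat \<Rightarrow> nat set" where
  "strand V I j = {i. betti V I i (i + j) \<noteq> 0}"

text \<open>\<open>Min\<close> and \<open>Max\<close> are unspecified on infinite sets, but a set that equals an interval
  \<open>{a..b}\<close> of naturals is finite.\<close>

definition connected_strand :: "'v set \<Rightarrow> ('v, 'k::field) mpoly set \<Rightarrow> nat \<Rightarrow> bool" where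
  "connected_strand V I j \<longleftrightarrow> strand V I j = {Min (strand V I j)..Max (strand V I j)}"

definition strand_connected :: "'v set \<Rightarrow> ('v, 'k::field) mpoly set \<Rightarrow> bool" where
  "strand_connected V I \<longleftrightarrow> (\<forall>j. strand V I j \<noteq> {} \<longrightarrow> connected_strand V I j)"

end

theory Submission
  imports Defs "HOL-Library.Function_Algebras"
begin

text \<open>
  Betti numbers are read off from Koszul homology: dimension shifting along a minimal resolution
  \<open>F\<close> of \<open>R/I\<close> identifies the Koszul homology of \<open>R/I\<close> in homological degree \<open>i\<close> with \<open>F\<^sub>i\<close> modulo the
  maximal ideal. This gives the uniqueness of graded Betti numbers; and since the Koszul
  homology of \<open>R/I\<close> for a squarefree monomial ideal \<open>I\<close> vanishes above degree \<open>card V\<close>, it also makes every syzygy module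
  finitely generated, so that minimal resolutions exist.

  In multidegree \<open>b\<close> the Koszul complex is the boundary of a simplex. It is contractible if some exponent
  of \<open>b\<close> is at least two, and for squarefree \<open>b\<close> it computes the reduced cohomology of an induced subcomplex of the
  independence complex (Hochster's formula). The independence complex of a join is the disjoint union
  of the two independence complexes. Hence for \<open>j \<ge> 2\<close> the \<open>j\<close>-strand of \<open>I(G*H)\<close> is
  \<open>(S + {0..n}) \<union> (T + {0..m})\<close>, where \<open>S\<close> and \<open>T\<close> are the \<open>j\<close>-strands of \<open>I(G)\<close> and \<open>I(H)\<close>; this is an
  interval because \<open>S \<subseteq> {0..m}\<close> and \<open>T \<subseteq> {0..n}\<close>. If both graphs have vertices, the \<open>1\<close>-strand is
  \<open>{1..m + n - 1}\<close>, since \<open>G*H\<close> has a disconnected independence complex on every vertex set meeting both sides.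
\<close>

text \<open>\<open>betti\<close> is a definite description over all minimal resolutions, so it says
  nothing until a resolution has been built and all resolutions have been shown to agree. The Koszul
  homology of \<open>R/I\<close> settles both questions because it depends on the ideal alone. No
  quotient module is ever formed. Cycles and boundaries over \<open>F / N\<close> are represented by
  lifts to \<open>F\<close>, where the connecting map of a dimension shift is not single-valued; it
  is therefore kept as a linear relation, and dimensions are compared by solving linear equations.
  Minimality enters in one form only: matrix entries have no constant term. This makes the
  connecting map onto even in exterior degree zero, and it turns the homology at the last stage into
  the constant parts of vectors in \<open>F\<close> at position \<open>i\<close>, whose dimension in
  degree \<open>d\<close> is the number of basis elements of degree \<open>d\<close>. The
  independence complexes of \<open>G\<close> and \<open>H\<close> share the empty face. Reduced
  cohomology therefore splits over the two sides only for \<open>j \<ge> 2\<close>, and for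
  \<open>j = 1\<close> a class separating the sides appears. This is why the strands 0 and 1 need no
  assumption on \<open>G\<close> and \<open>H\<close>.\<close>

lemma sum_fun_apply: "(\<Sum>i\<in>A. f i) x = (\<Sum>i\<in>A. f i x)" for f :: "'a \<Rightarrow> 'b \<Rightarrow> 'c::comm_monoid_add"
  by (induction A rule: infinite_finite_induct) auto

section \<open>Polynomials\<close>

abbreviation lkp :: "('a \<Rightarrow>\<^sub>0 'b::zero) \<Rightarrow> 'a \<Rightarrow> 'b" where "lkp \<equiv> Poly_Mapping.lookup"
abbreviation sng :: "'a \<Rightarrow> 'b \<Rightarrow> ('a \<Rightarrow>\<^sub>0 'b::zero)" where "sng \<equiv> Poly_Mapping.single"
abbreviation kys :: "('a \<Rightarrow>\<^sub>0 'b::zero) \<Rightarrow> 'a set" where "kys \<equiv> Poly_Mapping.keys"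

definition cst :: "'k \<Rightarrow> ('v, 'k::field) mpoly" where "cst c = sng 0 c"

lemma poly_mapping_sum_single:
  fixes p :: "'a \<Rightarrow>\<^sub>0 'b::comm_monoid_add"
  shows "p = (\<Sum>t\<in>kys p. sng t (lkp p t))"
proof (rule poly_mapping_eqI)
  fix k
  have "lkp (\<Sum>t\<in>kys p. sng t (lkp p t)) k = (\<Sum>t\<in>kys p. if t = k then lkp p t else 0)"
    by (simp add: lookup_sum lookup_single when_def)
  also have "\<dots> = lkp p k"
    by (simp add: in_keys_iff)
  finally show "lkp p k = lkp (\<Sum>t\<in>kys p. sng t (lkp p t)) k" by simp
qed

text \<open>Subtraction of exponents is truncated, so \<open>t - s\<close> is the quotient monomial
  only if \<open>s\<close> divides \<open>t\<close>; the case distinction is this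
  divisibility.\<close>

lemma lookup_single_times:
  fixes p :: "('v, 'k::field) mpoly"
  shows "lkp (sng s c * p) t = (if \<forall>v. lkp s v \<le> lkp t v then c * lkp p (t - s) else 0)"
proof -
  have dec: "s + u = t \<longleftrightarrow> (\<forall>v. lkp s v \<le> lkp t v) \<and> u = t - s" for u
  proof
    assume "s + u = t"
    then show "(\<forall>v. lkp s v \<le> lkp t v) \<and> u = t - s"
      by (auto simp: lookup_add)
  next
    assume a: "(\<forall>v. lkp s v \<le> lkp t v) \<and> u = t - s"
    then show "s + u = t"
      by (intro poly_mapping_eqI) (auto simp: lookup_add lookup_minus)
  qed
  have "sng s c * p = (\<Sum>u\<in>kys p. sng (s + u) (c * lkp p u))"
    by (subst poly_mapping_sum_single[of p]) (simp add: sum_distrib_left mult_single)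
  then have "lkp (sng s c * p) t = (\<Sum>u\<in>kys p. if s + u = t then c * lkp p u else 0)"
    by (simp add: lookup_sum lookup_single when_def)
  also have "\<dots> = (if \<forall>v. lkp s v \<le> lkp t v then (\<Sum>u\<in>kys p. if u = t - s then c * lkp p u else 0) else 0)"
    unfolding dec by (cases "\<forall>v. lkp s v \<le> lkp t v") (simp_all only: simp_thms if_False if_True sum.neutral_const)
  also have "\<dots> = (if \<forall>v. lkp s v \<le> lkp t v then c * lkp p (t - s) else 0)"
    by (simp add: in_keys_iff)
  finally show ?thesis .
qed

lemma lookup_cst_times [simp]: "lkp (cst c * p) t = c * lkp p t"
  by (simp add: cst_def lookup_single_times)

lemma lookup_var_times:
  "lkp (var v * p) t = (if lkp t v = 0 then 0 else lkp p (t - sng v 1))"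
proof -
  have "(\<forall>u. lkp (sng v (1::nat)) u \<le> lkp t u) \<longleftrightarrow> lkp t v \<noteq> 0"
    by (auto simp: lookup_single when_def Suc_le_eq)
  then show ?thesis by (simp add: var_def lookup_single_times)
qed

lemma lookup_neg1_power_times: "lkp ((-1) ^ n * p) t = (-1) ^ n * lkp p t"
  for p :: "('v, 'k::field) mpoly"
  by (induction n) auto

lemma lookup_cst: "lkp (cst c) t = (if t = 0 then c else 0)"
  by (simp add: cst_def lookup_single when_def)

lemma keys_add_nat: "kys (s + t) = kys s \<union> kys t" for s t :: "'v \<Rightarrow>\<^sub>0 nat"
  by (auto simp: in_keys_iff lookup_add)

lemma mon_deg_superset:
  assumes "finite W" "kys t \<subseteq> W" shows "mon_deg t = (\<Sum>v\<in>W. lkp t v)"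
  unfolding mon_deg_def using assms by (intro sum.mono_neutral_left) (auto simp: in_keys_iff)

lemma mon_deg_add [simp]: "mon_deg (s + t) = mon_deg s + mon_deg t"
proof -
  have "mon_deg u = (\<Sum>v\<in>kys s \<union> kys t. lkp u v)" if "u = s \<or> u = t \<or> u = s + t" for u
    using that by (intro mon_deg_superset) (auto simp: keys_add_nat)
  then show ?thesis by (simp add: lookup_add sum.distrib)
qed

lemma mon_deg_single [simp]: "mon_deg (sng v n) = n"
  by (simp add: mon_deg_def)

lemma mon_deg_0 [simp]: "mon_deg 0 = 0"
  by (simp add: mon_deg_def)

lemma mon_deg_eq_0_iff: "mon_deg t = 0 \<longleftrightarrow> t = 0"
  by (auto simp: mon_deg_def in_keys_iff intro: poly_mapping_eqI)

text \<open>An upper bound instead of a fixed degree lets one finite set serve all the twists in a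
  list of basis degrees.\<close>

definition mons :: "'v set \<Rightarrow> nat \<Rightarrow> ('v \<Rightarrow>\<^sub>0 nat) set" where
  "mons V d = {t. kys t \<subseteq> V \<and> mon_deg t \<le> d}"

lemma finite_mons:
  assumes "finite V" shows "finite (mons V d)"
proof -
  let ?S = "{f. \<forall>v. (v \<in> V \<longrightarrow> f v \<in> {..d}) \<and> (v \<notin> V \<longrightarrow> f v = (0::nat))}"
  have "lkp ` mons V d \<subseteq> ?S"
  proof (intro image_subsetI CollectI allI conjI impI)
    fix t v assume t: "t \<in> mons V d"
    show "lkp t v \<in> {..d}" if "v \<in> V"
    proof -
      have "lkp t v \<le> (\<Sum>v\<in>V. lkp t v)"
        using assms that by (intro member_le_sum) auto
      also have "\<dots> = mon_deg t" using t assms by (simp add: mons_def mon_deg_superset)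
      finally show ?thesis using t by (simp add: mons_def)
    qed
    show "lkp t v = 0" if "v \<notin> V"
      using t that by (auto simp: mons_def in_keys_iff)
  qed
  moreover have "finite ?S" using assms by (intro finite_set_of_finite_funs) auto
  ultimately have "finite (lkp ` mons V d)" by (rule finite_subset)
  then show ?thesis by (rule finite_imageD) (auto intro: inj_onI)
qed

definition polypart :: "(('v \<Rightarrow>\<^sub>0 nat) \<Rightarrow> bool) \<Rightarrow> ('v, 'k::field) mpoly \<Rightarrow> ('v, 'k) mpoly" where
  "polypart P p = (\<Sum>t\<in>{t\<in>kys p. P t}. sng t (lkp p t))"

lemma lookup_polypart [simp]: "lkp (polypart P p) t = (if P t then lkp p t else 0)"
proof -
  have "lkp (polypart P p) t = (\<Sum>s\<in>{s\<in>kys p. P s}. if s = t then lkp p s else 0)"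
    by (simp add: polypart_def lookup_sum lookup_single when_def)
  also have "\<dots> = (if P t then lkp p t else 0)"
    by (auto simp: in_keys_iff)
  finally show ?thesis .
qed

lemma in_polys_iff: "p \<in> polys V \<longleftrightarrow> (\<forall>t. lkp p t \<noteq> 0 \<longrightarrow> kys t \<subseteq> V)"
  by (auto simp: polys_def in_keys_iff)

lemma polys_0 [simp]: "0 \<in> polys V" and polys_1 [simp]: "1 \<in> polys V"
  by (auto simp: polys_def)

lemma polys_cst [simp]: "cst c \<in> polys V"
  by (auto simp: in_polys_iff lookup_cst split: if_splits)

lemma polys_var [simp]: "v \<in> V \<Longrightarrow> var v \<in> polys V"
  by (auto simp: in_polys_iff var_def lookup_single when_def split: if_splits)

lemma polys_add [simp]: "p \<in> polys V \<Longrightarrow> q \<in> polys V \<Longrightarrow> p + q \<in> polys V"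
  unfolding in_polys_iff lookup_add by (metis add.right_neutral)

lemma polys_mult [simp]:
  assumes "p \<in> polys V" "q \<in> polys V" shows "p * q \<in> polys V"
  using assms keys_mult[of p q] unfolding polys_def by (fastforce simp: keys_add_nat)

lemma polys_sum: "(\<And>i. i \<in> A \<Longrightarrow> f i \<in> polys V) \<Longrightarrow> (\<Sum>i\<in>A. f i) \<in> polys V"
  by (induction A rule: infinite_finite_induct) auto

lemma polys_polypart [simp]: "p \<in> polys V \<Longrightarrow> polypart P p \<in> polys V"
  by (auto simp: in_polys_iff)

lemma keys_multE:
  fixes p q :: "('v, 'k::field) mpoly"
  assumes "lkp (p * q) t \<noteq> 0"
  obtains r s where "t = r + s" "lkp p r \<noteq> 0" "lkp q s \<noteq> 0"
proof -
  have "t \<in> kys (p * q)" using assms by (simp add: in_keys_iff)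
  with keys_mult[of p q] obtain r s where "t = r + s" "r \<in> kys p" "s \<in> kys q" by blast
  then show ?thesis using that by (simp add: in_keys_iff)
qed

text \<open>Degrees add, so a product of monomials is trivial only if both factors are.\<close>

lemma lookup_mult_0: "lkp (p * q) 0 = lkp p 0 * lkp q 0" for p q :: "('v, 'k::field) mpoly"
proof -
  define p' where "p' = polypart (\<lambda>t. t \<noteq> 0) p"
  have p: "p = cst (lkp p 0) + p'"
    by (rule poly_mapping_eqI) (auto simp: p'_def lookup_add lookup_cst)
  have "lkp (p' * q) 0 = 0"
  proof (rule ccontr)
    assume "lkp (p' * q) 0 \<noteq> 0"
    then obtain r s where "0 = r + s" "lkp p' r \<noteq> 0" by (rule keys_multE)
    then have "mon_deg (r + s) = 0" "r \<noteq> 0" by (auto simp: p'_def split: if_splits)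
    then show False by (auto simp: mon_deg_eq_0_iff)
  qed
  then show ?thesis
    by (subst p) (simp add: distrib_right lookup_add)
qed

section \<open>Signs and the contracting homotopy of a simplex\<close>

text \<open>The simplices are unordered sets of vertices; the function \<open>f\<close> chooses an order.\<close>

definition ep :: "('v \<Rightarrow> nat) \<Rightarrow> 'v \<Rightarrow> 'v set \<Rightarrow> 'r::comm_ring_1" where
  "ep f v F = (-1) ^ card {u\<in>F. f u < f v}"

lemma ep_square [simp]: "ep f v F * ep f v F = (1::'r::comm_ring_1)"
  by (simp add: ep_def flip: power_add mult_2)

lemma ep_square_left [simp]: "ep f v F * (ep f v F * x) = (x::'r::comm_ring_1)"
  by (simp flip: mult.assoc)

lemma ep_insert:
  assumes "finite F" "v \<notin> F"
  shows "ep f u (insert v F) = (if f v < f u then - ep f u F else (ep f u F :: 'r::comm_ring_1))"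
proof (cases "f v < f u")
  case True
  then have "{x\<in>insert v F. f x < f u} = insert v {x\<in>F. f x < f u}" by auto
  then show ?thesis using True assms by (simp add: ep_def)
next
  case False
  then have "{x\<in>insert v F. f x < f u} = {x\<in>F. f x < f u}" by auto
  then show ?thesis using False by (simp add: ep_def)
qed

lemma ep_antisym:
  assumes "finite F" "v \<notin> F" "u \<notin> F" "f u \<noteq> f v"
  shows "ep f v F * ep f u (insert v F) = - (ep f u F * ep f v (insert u F) :: 'r::comm_ring_1)"
  using assms by (auto simp: ep_insert)

lemma ep_commute:
  assumes "finite F" "v \<notin> F" "w \<notin> F" "f w \<noteq> f v"
  shows "ep f w F * ep f v F = - (ep f v (insert w F) * ep f w (insert v F) :: 'r::comm_ring_1)"
  using assms by (auto simp: ep_insert mult.commute)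

text \<open>The boundary of the augmented chain complex of the simplex on \<open>W\<close>, written
  on coefficient functions: the coefficient at \<open>F\<close> collects contributions from all
  faces with one vertex more. The empty face counts as a face.\<close>

definition simplex_bd :: "('v \<Rightarrow> nat) \<Rightarrow> 'v set \<Rightarrow> ('v set \<Rightarrow> 'k) \<Rightarrow> 'v set \<Rightarrow> 'k::comm_ring_1" where
  "simplex_bd f W g F = (\<Sum>v\<in>W - F. ep f v F * g (insert v F))"

text \<open>The cone with apex \<open>w\<close>, again on coefficients: a face containing
  \<open>w\<close> receives its coefficient from the face opposite to \<open>w\<close>.\<close>

definition simplex_homotopy :: "('v \<Rightarrow> nat) \<Rightarrow> 'v \<Rightarrow> ('v set \<Rightarrow> 'k) \<Rightarrow> 'v set \<Rightarrow> 'k::comm_ring_1" where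
  "simplex_homotopy f w g F = (if w \<in> F then ep f w (F - {w}) * g (F - {w}) else 0)"

text \<open>The usual cone identity: boundary after cone plus cone after boundary is the identity.
  If \<open>w\<close> is not in \<open>F\<close>, only the face with \<open>w\<close> added
  contributes. Otherwise all terms cancel in pairs by \<open>ep_commute\<close>, except for the one
  that puts \<open>w\<close> back.\<close>

lemma simplex_bd_simplex_homotopy:
  fixes g :: "'v set \<Rightarrow> 'k::comm_ring_1"
  assumes W: "finite W" "inj_on f W" "w \<in> W" "F \<subseteq> W"
  shows "simplex_bd f W (simplex_homotopy f w g) F = g F - simplex_homotopy f w (simplex_bd f W g) F"
proof (cases "w \<in> F")
  case False
  have "simplex_bd f W (simplex_homotopy f w g) F = (\<Sum>v\<in>W - F. if v = w then g F else 0)"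
    unfolding simplex_bd_def using False by (intro sum.cong) (auto simp: simplex_homotopy_def)
  also have "\<dots> = g F" using W False by simp
  finally show ?thesis using False by (simp add: simplex_homotopy_def)
next
  case True
  define F' where "F' = F - {w}"
  have F: "F = insert w F'" "w \<notin> F'" "finite F'" "F' \<subseteq> W"
    using True W by (auto simp: F'_def intro: finite_subset)
  have "simplex_bd f W g F' = (\<Sum>v\<in>insert w (W - F). ep f v F' * g (insert v F'))"
    unfolding simplex_bd_def using F W by (intro sum.cong) auto
  also have "\<dots> = ep f w F' * g F + (\<Sum>v\<in>W - F. ep f v F' * g (insert v F'))"
    using True W by (subst sum.insert) (simp_all flip: F(1))
  finally have "simplex_homotopy f w (simplex_bd f W g) F = ep f w F' * (ep f w F' * g F + (\<Sum>v\<in>W - F. ep f v F' * g (insert v F')))"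
    using True by (simp add: simplex_homotopy_def F'_def)
  also have "\<dots> = g F + (\<Sum>v\<in>W - F. ep f w F' * ep f v F' * g (insert v F'))"
    by (simp add: distrib_left sum_distrib_left mult.assoc)
  also have "(\<Sum>v\<in>W - F. ep f w F' * ep f v F' * g (insert v F')) = - simplex_bd f W (simplex_homotopy f w g) F"
    unfolding simplex_bd_def sum_negf[symmetric]
  proof (intro sum.cong refl)
    fix v assume v: "v \<in> W - F"
    then have ne: "v \<noteq> w" "v \<notin> F'" "f w \<noteq> f v" using F W by (auto dest: inj_onD)
    have "insert v F - {w} = insert v F'" using F ne by auto
    then have "simplex_homotopy f w g (insert v F) = ep f w (insert v F') * g (insert v F')"
      using F by (simp add: simplex_homotopy_def)
    moreover have "ep f w F' * ep f v F' = - (ep f v F * ep f w (insert v F') :: 'k)"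
      using ep_commute[of F' v w f] F ne by simp
    ultimately show "ep f w F' * ep f v F' * g (insert v F') = - (ep f v F * simplex_homotopy f w g (insert v F))"
      by (simp only: mult_minus_left mult.assoc)
  qed
  finally show ?thesis by simp
qed

section \<open>The Koszul complex\<close>

text \<open>The squarefree monomial of \<open>F\<close>. In multidegree \<open>b\<close>, the
  exterior basis element of \<open>F\<close> has coefficient monomial
  \<open>b - ind F\<close>.\<close>

definition ind :: "'v set \<Rightarrow> 'v \<Rightarrow>\<^sub>0 nat" where
  "ind F = (\<Sum>v\<in>F. sng v 1)"

lemma lookup_ind: "finite F \<Longrightarrow> lkp (ind F) v = (if v \<in> F then 1 else 0)"
  by (simp add: ind_def lookup_sum lookup_single when_def)

lemma keys_ind: "finite F \<Longrightarrow> kys (ind F) = F"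
  by (auto simp: in_keys_iff lookup_ind split: if_splits)

lemma mon_deg_ind: "finite F \<Longrightarrow> mon_deg (ind F) = card F"
  by (subst mon_deg_superset[of F]) (auto simp: keys_ind lookup_ind)

lemma ind_insert: "finite F \<Longrightarrow> v \<notin> F \<Longrightarrow> ind (insert v F) = sng v 1 + ind F"
  by (simp add: ind_def)

lemma ind_empty [simp]: "ind {} = 0"
  by (simp add: ind_def)

lemma diff_ind_add:
  assumes "finite F" "F \<subseteq> kys b" shows "b - ind F + ind F = b"
  using assms by (intro poly_mapping_eqI) (auto simp: lookup_add lookup_minus lookup_ind in_keys_iff)

lemma mon_deg_diff_ind:
  assumes "finite F" "F \<subseteq> kys b" shows "mon_deg (b - ind F) + card F = mon_deg b"
  using mon_deg_add[of "b - ind F" "ind F"] assms by (simp add: diff_ind_add mon_deg_ind)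

lemma keys_diff_subset: "kys (b - c) \<subseteq> kys b" for b c :: "'v \<Rightarrow>\<^sub>0 nat"
  by (auto simp: in_keys_iff lookup_minus)

type_synonym ('v, 'k) chain = "'v set \<Rightarrow> nat \<Rightarrow> ('v, 'k) mpoly"

definition cst_scale :: "'k \<Rightarrow> ('v, 'k::field) chain \<Rightarrow> ('v, 'k) chain" where
  "cst_scale c z = (\<lambda>F a. cst c * z F a)"

lemma cst_scale_apply: "cst_scale c z F a = cst c * z F a"
  by (simp add: cst_scale_def)

locale koszul =
  fixes V :: "'v set" and f :: "'v \<Rightarrow> nat"
  assumes finV: "finite V" and injf: "inj_on f V"
begin

text \<open>An element of \<open>chain E q d\<close> is an element of total degree \<open>d\<close> of \<open>\<Lambda>\<^sup>q \<otimes> F\<close>, where \<open>F\<close> is the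
  graded free module with basis degrees \<open>E\<close>, and \<open>bd\<close> is the Koszul differential. The function
  \<open>coord z a b\<close> is the part of \<open>z\<close> in coordinate \<open>a\<close> and multidegree \<open>b\<close>; on it \<open>bd\<close> is the
  boundary of the full simplex on the support of \<open>b\<close>.\<close>

definition chain :: "nat list \<Rightarrow> nat \<Rightarrow> nat \<Rightarrow> ('v, 'k::field) chain set" where
  "chain E q d = {z. \<forall>F a t. lkp (z F a) t \<noteq> 0 \<longrightarrow>
     F \<subseteq> V \<and> card F = q \<and> a < length E \<and> kys t \<subseteq> V \<and> mon_deg t + q + E ! a = d}"

definition bd :: "('v, 'k::field) chain \<Rightarrow> ('v, 'k) chain" where
  "bd z F a = (\<Sum>v\<in>V - F. ep f v F * var v * z (insert v F) a)"

definition coord :: "('v, 'k::field) chain \<Rightarrow> nat \<Rightarrow> ('v \<Rightarrow>\<^sub>0 nat) \<Rightarrow> 'v set \<Rightarrow> 'k" where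
  "coord z a b F = (if F \<subseteq> kys b then lkp (z F a) (b - ind F) else 0)"

text \<open>The inverse of \<open>coord\<close>: a chain assembled from prescribed values in each
  coordinate and multidegree. A monomial \<open>t\<close> at the face \<open>F\<close> lies in
  multidegree \<open>t + ind F\<close>.\<close>

definition mkc :: "nat list \<Rightarrow> nat \<Rightarrow> nat \<Rightarrow> (nat \<Rightarrow> ('v \<Rightarrow>\<^sub>0 nat) \<Rightarrow> 'v set \<Rightarrow> 'k) \<Rightarrow> ('v, 'k::field) chain" where
  "mkc E q d gg F a = (if F \<subseteq> V \<and> card F = q \<and> a < length E then
     \<Sum>t\<in>{t\<in>mons V d. mon_deg t + q + E ! a = d}. sng t (gg a (t + ind F) F) else 0)"

lemma chainI:
  assumes "\<And>F a t. lkp (z F a) t \<noteq> 0 \<Longrightarrow>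
     F \<subseteq> V \<and> card F = q \<and> a < length E \<and> kys t \<subseteq> V \<and> mon_deg t + q + E ! a = d"
  shows "z \<in> chain E q d"
  using assms by (simp add: chain_def)

lemma chainD:
  assumes "z \<in> chain E q d" "lkp (z F a) t \<noteq> 0"
  shows "F \<subseteq> V" "card F = q" "a < length E" "kys t \<subseteq> V" "mon_deg t + q + E ! a = d"
  using assms by (auto simp: chain_def)

lemma chain_eq_0:
  assumes "z \<in> chain E q d" "\<not> (F \<subseteq> V \<and> card F = q \<and> a < length E)"
  shows "z F a = 0"
proof (rule poly_mapping_eqI)
  fix t show "lkp (z F a) t = lkp 0 t"
    using chainD[OF assms(1), of F a t] assms(2) by (simp only: lookup_zero) argo
qed

lemma chain_0 [simp]: "0 \<in> chain E q d"
  by (simp add: chain_def)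

lemma chain_add: "z \<in> chain E q d \<Longrightarrow> z' \<in> chain E q d \<Longrightarrow> z + z' \<in> chain E q d"
proof (rule chainI)
  fix F a t assume z: "z \<in> chain E q d" "z' \<in> chain E q d" and nz: "lkp ((z + z') F a) t \<noteq> 0"
  have "lkp (z F a) t \<noteq> 0 \<or> lkp (z' F a) t \<noteq> 0" using nz by (auto simp: lookup_add)
  then show "F \<subseteq> V \<and> card F = q \<and> a < length E \<and> kys t \<subseteq> V \<and> mon_deg t + q + E ! a = d"
  proof
    assume "lkp (z F a) t \<noteq> 0" from chainD[OF z(1) this] show ?thesis by simp
  next
    assume "lkp (z' F a) t \<noteq> 0" from chainD[OF z(2) this] show ?thesis by simp
  qed
qed

lemma chain_cst_scale: "z \<in> chain E q d \<Longrightarrow> cst_scale c z \<in> chain E q d"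
  by (rule chainI) (auto simp: cst_scale_def dest: chainD)

lemma chain_uminus: "z \<in> chain E q d \<Longrightarrow> - z \<in> chain E q d"
  by (rule chainI) (auto dest: chainD)

lemma chain_diff: "z \<in> chain E q d \<Longrightarrow> z' \<in> chain E q d \<Longrightarrow> z - z' \<in> chain E q d"
  unfolding diff_conv_add_uminus[of z z'] by (intro chain_add chain_uminus)

lemma bd_0 [simp]: "bd 0 = 0"
  by (auto simp: bd_def fun_eq_iff)

lemma bd_add: "bd (z + z') = bd z + bd z'"
  by (auto simp: bd_def fun_eq_iff distrib_left sum.distrib)

lemma bd_diff: "bd (z - z') = bd z - bd z'"
  by (auto simp: bd_def fun_eq_iff right_diff_distrib sum_subtractf)

lemma bd_cst_scale: "bd (cst_scale c z) = cst_scale c (bd z)"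
  by (auto simp: bd_def cst_scale_def fun_eq_iff sum_distrib_left mult_ac)

lemma lookup_ep_var_times:
  "lkp (ep f v F * var v * p) t = ep f v F * (if lkp t v = 0 then 0 else lkp p (t - sng v 1))"
  unfolding ep_def mult.assoc lookup_neg1_power_times lookup_var_times ..

lemma lookup_bd:
  "lkp (bd z F a) t = (\<Sum>v\<in>V - F. ep f v F * (if lkp t v = 0 then 0 else lkp (z (insert v F) a) (t - sng v 1)))"
  unfolding bd_def lookup_sum lookup_ep_var_times ..

lemma bd_chain:
  assumes z: "z \<in> chain E (Suc q) d" shows "bd z \<in> chain E q d"
proof (rule chainI)
  fix F a t assume "lkp (bd z F a) t \<noteq> 0"
  then obtain v where v: "v \<in> V - F" "lkp t v \<noteq> 0" "lkp (z (insert v F) a) (t - sng v 1) \<noteq> 0"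
    unfolding lookup_bd by (rule sum.not_neutral_contains_not_neutral) (auto split: if_splits)
  note D = chainD[OF z v(3)]
  have "t = (t - sng v 1) + sng v 1"
    using v by (intro poly_mapping_eqI) (auto simp: lookup_add lookup_minus lookup_single when_def)
  then have "mon_deg t = mon_deg (t - sng v 1) + 1" "kys t = kys (t - sng v 1) \<union> {v}"
    using mon_deg_add[of "t - sng v 1" "sng v 1"] keys_add_nat[of "t - sng v 1" "sng v 1"] by simp_all
  moreover have "finite F" using D finV by (auto intro: finite_subset)
  ultimately show "F \<subseteq> V \<and> card F = q \<and> a < length E \<and> kys t \<subseteq> V \<and> mon_deg t + q + E ! a = d"
    using D v by auto
qed

lemma bd_chain_0:
  assumes "z \<in> chain E 0 d" shows "bd z = 0"
proof (intro ext, simp add: bd_def, rule sum.neutral, rule ballI)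
  fix F a v assume "v \<in> V - F"
  have "z (insert v F) a = 0"
  proof (rule chain_eq_0[OF assms])
    have "card (insert v F) \<noteq> 0" if "insert v F \<subseteq> V"
      using that finV by (subst card_0_eq) (auto intro: finite_subset)
    then show "\<not> (insert v F \<subseteq> V \<and> card (insert v F) = 0 \<and> a < length E)" by blast
  qed
  then show "ep f v F * var v * z (insert v F) a = 0" by simp
qed

text \<open>Two vertices are added in either order with opposite signs. Splitting the ordered pairs
  by the numbering \<open>f\<close> matches each term with its negative.\<close>

lemma bd_bd:
  assumes "z \<in> chain E q d" shows "bd (bd z) = 0"
proof (rule ext, rule ext)
  fix F a
  define T where "T v u = ep f v F * ep f u (insert v F) * (var v * var u * z (insert u (insert v F)) a)" for v u
  have "bd (bd z) F a = (\<Sum>v\<in>V - F. \<Sum>u\<in>V - insert v F. T v u)"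
    by (simp add: bd_def T_def sum_distrib_left mult_ac)
  also have "\<dots> = (\<Sum>(v, u)\<in>Sigma (V - F) (\<lambda>v. V - insert v F). T v u)"
    using finV by (subst sum.Sigma) auto
  also have "Sigma (V - F) (\<lambda>v. V - insert v F) =
      {(v, u). v \<in> V - F \<and> u \<in> V - F \<and> f v < f u} \<union> {(v, u). v \<in> V - F \<and> u \<in> V - F \<and> f u < f v}"
    using injf by (auto simp: inj_on_def) (metis linorder_neqE_nat)
  also have "(\<Sum>(v, u)\<in>\<dots>. T v u) = (\<Sum>(v, u)\<in>{(v, u). v \<in> V - F \<and> u \<in> V - F \<and> f v < f u}. T v u)
      + (\<Sum>(v, u)\<in>{(v, u). v \<in> V - F \<and> u \<in> V - F \<and> f u < f v}. T v u)"
    using finV by (intro sum.union_disjoint) (auto intro: finite_subset[of _ "V \<times> V"])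
  also have "(\<Sum>(v, u)\<in>{(v, u). v \<in> V - F \<and> u \<in> V - F \<and> f u < f v}. T v u) =
      (\<Sum>(v, u)\<in>{(v, u). v \<in> V - F \<and> u \<in> V - F \<and> f v < f u}. T u v)"
    by (rule sum.reindex_bij_witness[of _ "\<lambda>(x, y). (y, x)" "\<lambda>(x, y). (y, x)"]) auto
  also have "\<dots> = (\<Sum>(v, u)\<in>{(v, u). v \<in> V - F \<and> u \<in> V - F \<and> f v < f u}. - T v u)"
  proof (rule sum.cong[OF refl])
    fix p assume "p \<in> {(v, u). v \<in> V - F \<and> u \<in> V - F \<and> f v < f u}"
    then obtain v u where p: "p = (v, u)" and vu: "v \<in> V" "v \<notin> F" "u \<in> V" "u \<notin> F" "f v < f u" by auto
    have "T u v = - T v u"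
    proof (cases "F \<subseteq> V")
      case True
      then have "finite F" using finV by (rule finite_subset)
      then have "ep f v F * ep f u (insert v F) = - (ep f u F * ep f v (insert u F) :: ('v, 'a) mpoly)"
        using vu by (intro ep_antisym) auto
      then show ?thesis unfolding T_def by (simp add: mult_ac insert_commute)
    next
      case False
      then have "z (insert u (insert v F)) a = 0" "z (insert v (insert u F)) a = 0"
        using chain_eq_0[OF assms] by auto
      then show ?thesis by (simp add: T_def)
    qed
    then show "(case p of (v, u) \<Rightarrow> T u v) = (case p of (v, u) \<Rightarrow> - T v u)" by (simp add: p)
  qed
  finally show "bd (bd z) F a = 0 F a"
    by (simp add: sum_negf split_def)

qed

text \<open>Multiplication by \<open>var v\<close> exactly offsets the loss of \<open>v\<close> from
  the face, so the Koszul differential preserves multidegrees; variables outside the support of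
  \<open>b\<close> contribute nothing.\<close>

lemma coord_bd:
  assumes b: "kys b \<subseteq> V" "F \<subseteq> kys b"
  shows "coord (bd z) a b F = simplex_bd f (kys b) (coord z a b) F"
proof -
  have fin: "finite F" using b finV by (auto intro: finite_subset)
  have "coord (bd z) a b F = (\<Sum>v\<in>V - F. ep f v F * (if v \<in> kys b then coord z a b (insert v F) else 0))"
    unfolding coord_def lookup_bd if_P[OF b(2)]
  proof (intro sum.cong refl arg_cong2[of _ _ _ _ "(*)"])
    fix v assume v: "v \<in> V - F"
    have "lkp (b - ind F) v = lkp b v" "b - ind F - sng v 1 = b - ind (insert v F)"
      using v fin by (auto simp: lookup_minus lookup_ind ind_insert add.commute diff_diff_add)
    then show "(if lkp (b - ind F) v = 0 then 0 else lkp (z (insert v F) a) (b - ind F - sng v 1)) =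
        (if v \<in> kys b then if insert v F \<subseteq> kys b then lkp (z (insert v F) a) (b - ind (insert v F)) else 0 else 0)"
      using b(2) by (simp add: in_keys_iff)
  qed
  also have "\<dots> = (\<Sum>v\<in>kys b - F. ep f v F * coord z a b (insert v F))"
    using b finV by (intro sum.mono_neutral_cong_right) auto
  finally show ?thesis by (simp add: simplex_bd_def)
qed

lemma coord_add: "coord (z + z') a b F = coord z a b F + coord z' a b F"
  by (simp add: coord_def lookup_add)

lemma coord_diff: "coord (z - z') a b F = coord z a b F - coord z' a b F"
  by (simp add: coord_def lookup_minus)

lemma lookup_mkc:
  "lkp (mkc E q d gg F a) t = (if F \<subseteq> V \<and> card F = q \<and> a < length E \<and> kys t \<subseteq> V \<and> mon_deg t + q + E ! a = d
    then gg a (t + ind F) F else 0)"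
proof (cases "F \<subseteq> V \<and> card F = q \<and> a < length E")
  case True
  let ?S = "{t\<in>mons V d. mon_deg t + q + E ! a = d}"
  have "lkp (mkc E q d gg F a) t = (\<Sum>s\<in>?S. if s = t then gg a (s + ind F) F else 0)"
    using True by (simp add: mkc_def lookup_sum lookup_single when_def)
  also have "\<dots> = (if t \<in> ?S then gg a (t + ind F) F else 0)"
    using finite_mons[OF finV, of d] by simp
  also have "t \<in> ?S \<longleftrightarrow> kys t \<subseteq> V \<and> mon_deg t + q + E ! a = d" by (auto simp: mons_def)
  finally show ?thesis using True by simp
next
  case False
  then show ?thesis by (auto simp: mkc_def)
qed

lemma mkc_chain: "mkc E q d gg \<in> chain E q d"
  by (rule chainI) (auto simp: lookup_mkc split: if_splits)

lemma coord_mkc: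
  assumes "kys b \<subseteq> V" "mon_deg b + E ! a = d" "F \<subseteq> kys b" "card F = q" "a < length E"
  shows "coord (mkc E q d gg) a b F = gg a b F"
proof -
  have fin: "finite F" using assms finV by (auto intro: finite_subset)
  have "mon_deg (b - ind F) + q + E ! a = d" using mon_deg_diff_ind[of F b] fin assms by simp
  moreover have "F \<subseteq> V" "kys (b - ind F) \<subseteq> V" using assms keys_diff_subset[of b "ind F"] by auto
  ultimately show ?thesis using assms fin by (simp add: coord_def lookup_mkc diff_ind_add)
qed

lemma lookup_eq_coord:
  assumes "finite F" shows "lkp (z F a) t = coord z a (t + ind F) F"
  using assms by (simp add: coord_def keys_add_nat keys_ind)

lemma chain_eqI:
  assumes z: "z \<in> chain E q d" "z' \<in> chain E q d"
    and eq: "\<And>a b F. a < length E \<Longrightarrow> kys b \<subseteq> V \<Longrightarrow> mon_deg b + E ! a = d \<Longrightarrow> F \<subseteq> kys b \<Longrightarrow> card F = q \<Longrightarrow>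
      coord z a b F = coord z' a b F"
  shows "z = z'"
proof (intro ext poly_mapping_eqI)
  fix F a t
  show "lkp (z F a) t = lkp (z' F a) t"
  proof (cases "F \<subseteq> V \<and> card F = q \<and> a < length E \<and> kys t \<subseteq> V \<and> mon_deg t + q + E ! a = d")
    case True
    then have fin: "finite F" using finV by (auto intro: finite_subset)
    show ?thesis unfolding lookup_eq_coord[OF fin] using True fin
      by (intro eq) (auto simp: keys_add_nat keys_ind mon_deg_ind)
  next
    case False
    then have "lkp (z F a) t = 0" "lkp (z' F a) t = 0"
      using chainD[OF z(1), of F a t] chainD[OF z(2), of F a t] by argo+
    then show ?thesis by simp
  qed
qed

text \<open>In multidegree \<open>b\<close> this is the cone identity for the simplex on the support
  of \<open>b\<close>. Only \<open>b = 0\<close> has no apex, and there the sole face is the empty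
  one; \<open>z0\<close> excludes this case.\<close>

lemma koszul_exact:
  assumes z: "z \<in> chain E q d" "bd z = 0" and z0: "q = 0 \<Longrightarrow> \<forall>a. lkp (z {} a) 0 = 0"
  shows "\<exists>y\<in>chain E (Suc q) d. bd y = z"
proof
  \<comment> \<open>Any variable dividing \<open>b\<close> can be the apex. For \<open>b = 0\<close>
    the choice is irrelevant, since the boundary is then an empty sum.\<close>
  define w where "w b = (SOME w. w \<in> kys b)" for b :: "'v \<Rightarrow>\<^sub>0 nat"
  define gg where "gg a b = simplex_homotopy f (w b) (coord z a b)" for a b
  show "mkc E (Suc q) d gg \<in> chain E (Suc q) d" by (rule mkc_chain)
  show "bd (mkc E (Suc q) d gg) = z"
  proof (rule chain_eqI)
    show "bd (mkc E (Suc q) d gg) \<in> chain E q d" by (intro bd_chain mkc_chain)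
    show "z \<in> chain E q d" by fact
    fix a b F assume *: "a < length E" "kys b \<subseteq> V" "mon_deg b + E ! a = d" "F \<subseteq> kys b" "card F = q"
    have "coord (bd (mkc E (Suc q) d gg)) a b F = (\<Sum>v\<in>kys b - F. ep f v F * coord (mkc E (Suc q) d gg) a b (insert v F))"
      using * by (subst coord_bd) (auto simp: simplex_bd_def)
    also have "\<dots> = (\<Sum>v\<in>kys b - F. ep f v F * gg a b (insert v F))"
    proof (intro sum.cong refl)
      fix v assume v: "v \<in> kys b - F"
      have "finite F" using * finV by (auto intro: finite_subset)
      then have "card (insert v F) = Suc q" "insert v F \<subseteq> kys b" using * v by auto
      then show "ep f v F * coord (mkc E (Suc q) d gg) a b (insert v F) = ep f v F * gg a b (insert v F)"
        using coord_mkc[OF *(2,3) _ _ *(1), of "insert v F" "Suc q" gg] by simp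
    qed
    also have "\<dots> = simplex_bd f (kys b) (gg a b) F" by (simp add: simplex_bd_def)
    also have "\<dots> = coord z a b F"
    proof (cases "kys b = {}")
      case True
      have "b = 0" by (rule poly_mapping_eqI) (use True in \<open>auto simp: set_eq_iff in_keys_iff\<close>)
      moreover have "F = {}" "q = 0" using * True by auto
      ultimately show ?thesis using z0 by (simp add: simplex_bd_def coord_def)
    next
      case False
      then have w: "w b \<in> kys b" by (simp add: w_def some_in_eq)
      have "simplex_homotopy f (w b) (simplex_bd f (kys b) (coord z a b)) F = 0"
      proof (cases "w b \<in> F")
        case True
        have "simplex_bd f (kys b) (coord z a b) (F - {w b}) = coord (bd z) a b (F - {w b})"
          using * by (subst coord_bd) auto
        then show ?thesis by (simp add: simplex_homotopy_def z coord_def)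
      qed (simp add: simplex_homotopy_def)
      then show ?thesis
        unfolding gg_def simplex_bd_simplex_homotopy[OF finite_keys inj_on_subset[OF injf *(2)] w *(4), of "coord z a b"] by (simp only: diff_zero)
    qed
    finally show "coord (bd (mkc E (Suc q) d gg)) a b F = coord z a b F" .
  qed
qed

end

section \<open>Dimension shifting along a minimal resolution\<close>

definition act :: "(nat \<Rightarrow> nat \<Rightarrow> ('v, 'k::field) mpoly) \<Rightarrow> nat \<Rightarrow> (nat \<Rightarrow> ('v, 'k) mpoly) \<Rightarrow> nat \<Rightarrow> ('v, 'k) mpoly" where
  "act A n x a = (\<Sum>b<n. A a b * x b)"

definition actc :: "(nat \<Rightarrow> nat \<Rightarrow> ('v, 'k::field) mpoly) \<Rightarrow> nat \<Rightarrow> ('v, 'k) chain \<Rightarrow> ('v, 'k) chain" where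
  "actc A n z F = act A n (z F)"

lemma act_0 [simp]: "act A n 0 = 0"
  by (auto simp: act_def fun_eq_iff)

lemma act_add: "act A n (x + y) = act A n x + act A n y"
  by (auto simp: act_def fun_eq_iff distrib_left sum.distrib)

lemma actc_0 [simp]: "actc A n 0 = 0"
  by (auto simp: actc_def act_def fun_eq_iff)

lemma actc_add: "actc A n (x + y) = actc A n x + actc A n y"
  by (auto simp: actc_def act_def fun_eq_iff distrib_left sum.distrib)

lemma actc_diff: "actc A n (x - y) = actc A n x - actc A n y"
  by (auto simp: actc_def act_def fun_eq_iff right_diff_distrib sum_subtractf)

lemma actc_cst_scale: "actc A n (cst_scale c x) = cst_scale c (actc A n x)"
  by (auto simp: actc_def act_def cst_scale_def fun_eq_iff sum_distrib_left mult_ac)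

text \<open>An isomorphism of the subquotients \<open>Z / B\<close> and \<open>Z' / B'\<close>, given as a linear relation.\<close>

definition lrel :: "(('v, 'k::field) chain \<Rightarrow> ('v, 'k) chain \<Rightarrow> bool) \<Rightarrow>
    ('v, 'k) chain set \<Rightarrow> ('v, 'k) chain set \<Rightarrow> ('v, 'k) chain set \<Rightarrow> ('v, 'k) chain set \<Rightarrow> bool" where
  "lrel R Z B Z' B' \<longleftrightarrow> R 0 0 \<and> (\<forall>z w z' w'. R z w \<longrightarrow> R z' w' \<longrightarrow> R (z + z') (w + w')) \<and>
     (\<forall>c z w. R z w \<longrightarrow> R (cst_scale c z) (cst_scale c w)) \<and>
     (\<forall>z w. R z w \<longrightarrow> z \<in> Z \<and> w \<in> Z' \<and> (z \<in> B \<longleftrightarrow> w \<in> B')) \<and>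
     (\<forall>z\<in>Z. \<exists>w. R z w) \<and> (\<forall>w\<in>Z'. \<exists>z. R z w)"

definition lequiv :: "('v, 'k::field) chain set \<Rightarrow> ('v, 'k) chain set \<Rightarrow> ('v, 'k) chain set \<Rightarrow> ('v, 'k) chain set \<Rightarrow> bool" where
  "lequiv Z B Z' B' \<longleftrightarrow> (\<exists>R. lrel R Z B Z' B')"

lemma lrelI:
  assumes "R 0 0" "\<And>z w z' w'. R z w \<Longrightarrow> R z' w' \<Longrightarrow> R (z + z') (w + w')"
    "\<And>c z w. R z w \<Longrightarrow> R (cst_scale c z) (cst_scale c w)"
    "\<And>z w. R z w \<Longrightarrow> z \<in> Z \<and> w \<in> Z' \<and> (z \<in> B \<longleftrightarrow> w \<in> B')"
    "\<And>z. z \<in> Z \<Longrightarrow> \<exists>w. R z w" "\<And>w. w \<in> Z' \<Longrightarrow> \<exists>z. R z w"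
  shows "lrel R Z B Z' B'"
  unfolding lrel_def by (intro conjI allI impI ballI; rule assms conjunct1[OF assms(4)]
      conjunct1[OF conjunct2[OF assms(4)]] conjunct2[OF conjunct2[OF assms(4)]]; assumption)

lemma lrelD:
  assumes "lrel R Z B Z' B'"
  shows "R 0 0" "R z w \<Longrightarrow> R z' w' \<Longrightarrow> R (z + z') (w + w')" "R z w \<Longrightarrow> R (cst_scale c z) (cst_scale c w)"
    "R z w \<Longrightarrow> z \<in> Z" "R z w \<Longrightarrow> w \<in> Z'" "R z w \<Longrightarrow> z \<in> B \<longleftrightarrow> w \<in> B'"
    "z \<in> Z \<Longrightarrow> \<exists>w. R z w" "w \<in> Z' \<Longrightarrow> \<exists>z. R z w"
  using assms unfolding lrel_def by simp_all

lemma lequivI: "lrel R Z B Z' B' \<Longrightarrow> lequiv Z B Z' B'"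
  unfolding lequiv_def by (rule exI)

lemma lequiv_sym:
  assumes "lequiv Z B Z' B'" shows "lequiv Z' B' Z B"
proof -
  obtain R where R: "lrel R Z B Z' B'" using assms by (auto simp: lequiv_def)
  have "lrel (\<lambda>z w. R w z) Z' B' Z B"
    by (rule lrelI) (simp_all add: lrelD[OF R])
  then show ?thesis by (rule lequivI)
qed

lemma lequiv_trans:
  assumes 1: "lequiv Z B Z' B'" and 2: "lequiv Z' B' Z'' B''" shows "lequiv Z B Z'' B''"
proof -
  obtain R where R: "lrel R Z B Z' B'" using 1 by (auto simp: lequiv_def)
  obtain S where S: "lrel S Z' B' Z'' B''" using 2 by (auto simp: lequiv_def)
  have "lrel (R OO S) Z B Z'' B''"
  proof (rule lrelI)
    show "(R OO S) 0 0" by (rule relcomppI[where r = R and s = S and b = 0]) (rule lrelD(1)[OF R], rule lrelD(1)[OF S])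
    show "(R OO S) (z + z') (w + w')" if zw: "(R OO S) z w" "(R OO S) z' w'" for z w z' w'
    proof -
      obtain y where y: "R z y" "S y w" using zw(1) by (rule relcomppE)
      obtain y' where y': "R z' y'" "S y' w'" using zw(2) by (rule relcomppE)
      show ?thesis
        by (rule relcomppI[where r = R and s = S and b = "y + y'"])
          (rule lrelD(2)[OF R y(1) y'(1)], rule lrelD(2)[OF S y(2) y'(2)])
    qed
    show "(R OO S) (cst_scale c z) (cst_scale c w)" if zw: "(R OO S) z w" for c z w
    proof -
      obtain y where y: "R z y" "S y w" using zw by (rule relcomppE)
      show ?thesis
        by (rule relcomppI[where r = R and s = S and b = "cst_scale c y"])
          (rule lrelD(3)[OF R y(1)], rule lrelD(3)[OF S y(2)])
    qed
    show "z \<in> Z \<and> w \<in> Z'' \<and> (z \<in> B \<longleftrightarrow> w \<in> B'')" if "(R OO S) z w" for z w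
      using that by (elim relcomppE) (simp add: lrelD(4,6)[OF R] lrelD(5,6)[OF S])
    show "\<exists>w. (R OO S) z w" if z: "z \<in> Z" for z
    proof -
      obtain y where "R z y" using lrelD(7)[OF R z] ..
      moreover obtain w where "S y w" using lrelD(7)[OF S lrelD(5)[OF R \<open>R z y\<close>]] ..
      ultimately show ?thesis by (intro exI relcomppI)
    qed
    show "\<exists>z. (R OO S) z w" if w: "w \<in> Z''" for w
    proof -
      obtain y where "S y w" using lrelD(8)[OF S w] ..
      moreover obtain z where "R z y" using lrelD(8)[OF R lrelD(4)[OF S \<open>S y w\<close>]] ..
      ultimately show ?thesis by (intro exI relcomppI)
    qed
  qed
  then show ?thesis by (rule lequivI)
qed

lemma lequiv_refl:
  assumes "0 \<in> Z" "\<And>z w. z \<in> Z \<Longrightarrow> w \<in> Z \<Longrightarrow> z + w \<in> Z" "\<And>c z. z \<in> Z \<Longrightarrow> cst_scale c z \<in> Z"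
  shows "lequiv Z B Z B"
  by (rule lequivI[of "\<lambda>z w. z = w \<and> z \<in> Z"], rule lrelI) (use assms in auto)

section \<open>Koszul homology of quotients of graded free modules\<close>

context koszul
begin

definition free_vecs :: "nat \<Rightarrow> (nat \<Rightarrow> ('v, 'k::field) mpoly) set" where
  "free_vecs n = {x. \<forall>a. x a \<in> polys V \<and> (n \<le> a \<longrightarrow> x a = 0)}"

text \<open>The condition \<open>t \<noteq> 0\<close> is minimality. Entries outside the index range
  are forced to be zero, so that a matrix can be treated as a function on all indices.\<close>

definition graded_mat :: "nat list \<Rightarrow> nat list \<Rightarrow> (nat \<Rightarrow> nat \<Rightarrow> ('v, 'k::field) mpoly) \<Rightarrow> bool" where
  "graded_mat E E' A \<longleftrightarrow> (\<forall>a b t. lkp (A a b) t \<noteq> 0 \<longrightarrow>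
     a < length E \<and> b < length E' \<and> kys t \<subseteq> V \<and> E ! a + mon_deg t = E' ! b \<and> t \<noteq> 0)"

definition im_mat :: "nat list \<Rightarrow> (nat \<Rightarrow> nat \<Rightarrow> ('v, 'k::field) mpoly) \<Rightarrow> (nat \<Rightarrow> ('v, 'k) mpoly) set" where
  "im_mat E' A = act A (length E') ` free_vecs (length E')"

definition ker_mat :: "nat list \<Rightarrow> (nat \<Rightarrow> nat \<Rightarrow> ('v, 'k::field) mpoly) \<Rightarrow> (nat \<Rightarrow> ('v, 'k) mpoly) set" where
  "ker_mat E' A = {x \<in> free_vecs (length E'). act A (length E') x = 0}"

text \<open>Cycles and boundaries in degree \<open>d\<close> of the Koszul complex \<open>\<Lambda>\<^sup>q \<otimes> F / N\<close>, lifted to \<open>\<Lambda>\<^sup>q \<otimes> F\<close>.\<close>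

definition cycles :: "nat list \<Rightarrow> (nat \<Rightarrow> ('v, 'k::field) mpoly) set \<Rightarrow> nat \<Rightarrow> nat \<Rightarrow> ('v, 'k) chain set" where
  "cycles E N q d = {z \<in> chain E q d. \<forall>F. bd z F \<in> N}"

definition boundaries :: "nat list \<Rightarrow> (nat \<Rightarrow> ('v, 'k::field) mpoly) set \<Rightarrow> nat \<Rightarrow> nat \<Rightarrow> ('v, 'k) chain set" where
  "boundaries E N q d = {n + bd y | n y. n \<in> chain E q d \<and> (\<forall>F. n F \<in> N) \<and> y \<in> chain E (Suc q) d}"

lemma free_vecs_0 [simp]: "0 \<in> free_vecs n"
  by (simp add: free_vecs_def)

lemma free_vecs_add: "x \<in> free_vecs n \<Longrightarrow> y \<in> free_vecs n \<Longrightarrow> x + y \<in> free_vecs n"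
  by (simp add: free_vecs_def)

lemma chain_free_vecs:
  assumes "z \<in> chain E q d" shows "z F \<in> free_vecs (length E)"
  unfolding free_vecs_def in_polys_iff using chainD(4)[OF assms] chain_eq_0[OF assms] by (auto simp: not_less)

lemma bd_free_vecs:
  assumes "z \<in> chain E q d" shows "bd z F \<in> free_vecs (length E)"
  using assms bd_chain_0 bd_chain chain_free_vecs by (cases q) (fastforce simp: zero_fun_def free_vecs_def)+

lemma graded_matD:
  assumes "graded_mat E E' A" "lkp (A a b) t \<noteq> 0"
  shows "a < length E" "b < length E'" "kys t \<subseteq> V" "E ! a + mon_deg t = E' ! b" "t \<noteq> 0"
  using assms by (auto simp: graded_mat_def)

lemma actc_chain:
  assumes A: "graded_mat E E' A" and z: "z \<in> chain E' q d"
  shows "actc A (length E') z \<in> chain E q d"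
proof (rule chainI)
  fix F a t assume "lkp (actc A (length E') z F a) t \<noteq> 0"
  then obtain b where "b < length E'" "lkp (A a b * z F b) t \<noteq> 0"
    unfolding actc_def act_def lookup_sum by (auto elim: sum.not_neutral_contains_not_neutral)
  then obtain r s where rs: "t = r + s" "lkp (A a b) r \<noteq> 0" "lkp (z F b) s \<noteq> 0"
    by (elim keys_multE)
  show "F \<subseteq> V \<and> card F = q \<and> a < length E \<and> kys t \<subseteq> V \<and> mon_deg t + q + E ! a = d"
    using graded_matD[OF A rs(2)] chainD[OF z rs(3)] rs(1) by (auto simp: keys_add_nat)
qed

lemma actc_bd: "actc A n (bd z) = bd (actc A n z)"
proof (intro ext)
  fix F a
  have "actc A n (bd z) F a = (\<Sum>b<n. \<Sum>v\<in>V - F. ep f v F * var v * (A a b * z (insert v F) b))"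
    by (simp add: actc_def act_def bd_def sum_distrib_left mult_ac)
  also have "\<dots> = (\<Sum>v\<in>V - F. \<Sum>b<n. ep f v F * var v * (A a b * z (insert v F) b))"
    by (rule sum.swap)
  also have "\<dots> = bd (actc A n z) F a"
    by (simp add: actc_def act_def bd_def sum_distrib_left)
  finally show "actc A n (bd z) F a = bd (actc A n z) F a" .
qed

text \<open>Preimages under \<open>A\<close> are taken separately for each face, in no particular
  degree, and then cut down to the monomials that a chain may carry. As \<open>A\<close> is graded,
  the discarded monomials map only to degrees in which \<open>z\<close> has no coefficients.\<close>

lemma lift_chain:
  assumes A: "graded_mat E E' A" and z: "z \<in> chain E q d" and im_mat: "\<And>F. z F \<in> im_mat E' A"
  shows "\<exists>w\<in>chain E' q d. actc A (length E') w = z"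
proof -
  have "\<exists>x. x \<in> free_vecs (length E') \<and> z F = act A (length E') x" for F
    using im_mat[of F] by (auto simp: im_mat_def)
  then obtain x where x': "\<And>F. x F \<in> free_vecs (length E') \<and> z F = act A (length E') (x F)"
    using choice[of "\<lambda>F x. x \<in> free_vecs (length E') \<and> z F = act A (length E') x"] by auto
  note x = conjunct1[OF x'] conjunct2[OF x']
  define P where "P F b t \<longleftrightarrow> F \<subseteq> V \<and> card F = q \<and> mon_deg t + q + E' ! b = d"
    for F :: "'v set" and b and t :: "'v \<Rightarrow>\<^sub>0 nat"
  define w where "w F b = polypart (P F b) (x F b)" for F b
  define w' where "w' F b = polypart (\<lambda>t. \<not> P F b t) (x F b)" for F b
  have w: "w \<in> chain E' q d"
  proof (rule chainI)
    fix F b t assume nz: "lkp (w F b) t \<noteq> 0"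
    then have "P F b t" "lkp (x F b) t \<noteq> 0" by (auto simp: w_def split: if_splits)
    then show "F \<subseteq> V \<and> card F = q \<and> b < length E' \<and> kys t \<subseteq> V \<and> mon_deg t + q + E' ! b = d"
      using x(1)[of F] by (auto simp: P_def free_vecs_def in_polys_iff not_less[symmetric])
  qed
  have "x = w + w'"
    by (intro ext poly_mapping_eqI) (auto simp: w_def w'_def lookup_add)
  then have zF: "z F = act A (length E') (w F) + act A (length E') (w' F)" for F
    using x(2)[of F] by (simp add: act_add)
  have "actc A (length E') w F a = z F a" for F a
  proof (rule poly_mapping_eqI)
    fix t
    show "lkp (actc A (length E') w F a) t = lkp (z F a) t"
    proof (cases "F \<subseteq> V \<and> card F = q \<and> a < length E \<and> mon_deg t + q + E ! a = d")
      case True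
      have "lkp (act A (length E') (w' F) a) t = 0"
      proof (rule ccontr)
        assume "lkp (act A (length E') (w' F) a) t \<noteq> 0"
        then obtain b where "b < length E'" "lkp (A a b * w' F b) t \<noteq> 0"
          unfolding act_def lookup_sum by (auto elim: sum.not_neutral_contains_not_neutral)
        then obtain r s where rs: "t = r + s" "lkp (A a b) r \<noteq> 0" "lkp (w' F b) s \<noteq> 0"
          by (elim keys_multE)
        then have "\<not> P F b s" by (auto simp: w'_def split: if_splits)
        then show False
          using True graded_matD[OF A rs(2)] rs(1) by (auto simp: P_def)
      qed
      then show ?thesis by (simp add: zF actc_def lookup_add)
    next
      case False
      have "lkp (actc A (length E') w F a) t = 0" "lkp (z F a) t = 0"
        using chainD[OF z, of F a t] chainD[OF actc_chain[OF A w], of F a t] False by argo+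
      then show ?thesis by simp
    qed
  qed
  then show ?thesis using w by (intro bexI[of _ w]) (auto simp: fun_eq_iff)
qed

lemma act_const_0:
  assumes "graded_mat E E' A" shows "lkp (act A n x a) 0 = 0"
proof -
  have "lkp (A a b) 0 = 0" for b using graded_matD(5)[OF assms, of a b 0] by blast
  then show ?thesis by (simp add: act_def lookup_sum lookup_mult_0)
qed

text \<open>The image \<open>N\<close> of \<open>A\<close> is \<open>F'\<close> modulo the kernel,
  and \<open>N \<rightarrow> F \<rightarrow> F / N\<close> induces a long exact sequence. The Koszul
  homology of the free module \<open>F\<close> vanishes in positive exterior degree, and in degree
  zero the map from the homology of \<open>N\<close> is zero since \<open>A\<close> has no constant
  terms. Hence the connecting map is an isomorphism for every \<open>q\<close>, including 0.\<close>

lemma dimension_shift: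
  assumes A: "graded_mat E E' A"
  shows "lequiv (cycles E (im_mat E' A) (Suc q) d) (boundaries E (im_mat E' A) (Suc q) d)
    (cycles E' (ker_mat E' A) q d) (boundaries E' (ker_mat E' A) q d)"
proof -
  let ?n = "length E'"
  \<comment> \<open>The zigzag of the connecting map on lifts: apply the differential to
    \<open>z\<close>, then take a preimage under \<open>A\<close>.\<close>
  define R where "R z w \<longleftrightarrow> z \<in> chain E (Suc q) d \<and> w \<in> chain E' q d \<and> bd z = actc A ?n w" for z w
  have "lrel R (cycles E (im_mat E' A) (Suc q) d) (boundaries E (im_mat E' A) (Suc q) d)
      (cycles E' (ker_mat E' A) q d) (boundaries E' (ker_mat E' A) q d)"
  proof (rule lrelI)
    show "R 0 0" by (simp add: R_def)
    show "R (z + z') (w + w')" if "R z w" "R z' w'" for z w z' w'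
      using that by (simp add: R_def chain_add bd_add actc_add)
    show "R (cst_scale c z) (cst_scale c w)" if "R z w" for c z w
      using that by (simp add: R_def chain_cst_scale bd_cst_scale actc_cst_scale)
    show "z \<in> cycles E (im_mat E' A) (Suc q) d \<and> w \<in> cycles E' (ker_mat E' A) q d \<and>
        (z \<in> boundaries E (im_mat E' A) (Suc q) d \<longleftrightarrow> w \<in> boundaries E' (ker_mat E' A) q d)" if "R z w" for z w
    proof (intro conjI iffI)
      have z: "z \<in> chain E (Suc q) d" and w: "w \<in> chain E' q d" and eq: "bd z = actc A ?n w"
        using that by (auto simp: R_def)
      show "z \<in> cycles E (im_mat E' A) (Suc q) d"
        using z eq chain_free_vecs[OF w] by (auto simp: cycles_def actc_def im_mat_def)
      have "actc A ?n (bd w) = 0" by (simp add: actc_bd flip: eq) (rule bd_bd[OF z])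
      then show "w \<in> cycles E' (ker_mat E' A) q d"
        using w bd_free_vecs[OF w] by (auto simp: cycles_def ker_mat_def actc_def fun_eq_iff)
      show "w \<in> boundaries E' (ker_mat E' A) q d" if "z \<in> boundaries E (im_mat E' A) (Suc q) d"
      proof -
        from that obtain n y where n: "z = n + bd y" "n \<in> chain E (Suc q) d" "\<And>F. n F \<in> im_mat E' A"
            and y: "y \<in> chain E (Suc (Suc q)) d"
          by (auto simp: boundaries_def)
        obtain u where u: "u \<in> chain E' (Suc q) d" "actc A ?n u = n"
          using lift_chain[OF A n(2,3)] by blast
        have "bd z = bd n" using n(1) bd_bd[OF y] by (simp add: bd_add)
        then have "actc A ?n (w - bd u) = 0"
          by (simp add: actc_diff actc_bd u eq)
        moreover have c: "w - bd u \<in> chain E' q d" by (intro chain_diff w bd_chain u)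
        ultimately have "\<And>F. (w - bd u) F \<in> ker_mat E' A"
          using chain_free_vecs[OF c] by (auto simp: ker_mat_def actc_def fun_eq_iff)
        moreover have "w = (w - bd u) + bd u" by simp
        ultimately show ?thesis unfolding boundaries_def using c u by blast
      qed
      show "z \<in> boundaries E (im_mat E' A) (Suc q) d" if "w \<in> boundaries E' (ker_mat E' A) q d"
      proof -
        from that obtain n u where n: "w = n + bd u" "n \<in> chain E' q d" "\<And>F. n F \<in> ker_mat E' A"
            and u: "u \<in> chain E' (Suc q) d"
          by (auto simp: boundaries_def)
        have "actc A ?n n = 0" using n(3) by (auto simp: ker_mat_def actc_def fun_eq_iff)
        \<comment> \<open>Since \<open>w\<close> is \<open>n + bd u\<close> with \<open>n\<close> in
          the kernel, \<open>bd z\<close> is also the boundary of \<open>actc A ?n u\<close>; the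
          difference is a cycle in positive exterior degree, hence a boundary.\<close>
        then have "bd (z - actc A ?n u) = 0"
          by (simp add: bd_diff eq n(1) actc_add actc_bd)
        moreover have "actc A ?n u \<in> chain E (Suc q) d" by (intro actc_chain A u)
        ultimately obtain y where y: "y \<in> chain E (Suc (Suc q)) d" "bd y = z - actc A ?n u"
          using koszul_exact[of "z - actc A ?n u" E "Suc q" d] z by (auto intro: chain_diff)
        then have "z = actc A ?n u + bd y" by simp
        moreover have "\<And>F. actc A ?n u F \<in> im_mat E' A"
          using chain_free_vecs[OF u] by (auto simp: actc_def im_mat_def)
        ultimately show ?thesis
          unfolding boundaries_def using y \<open>actc A ?n u \<in> chain E (Suc q) d\<close> by blast
      qed
    qed
    show "\<exists>w. R z w" if z: "z \<in> cycles E (im_mat E' A) (Suc q) d" for z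
    proof -
      have "z \<in> chain E (Suc q) d" "\<And>F. bd z F \<in> im_mat E' A" using z by (auto simp: cycles_def)
      then show ?thesis using lift_chain[OF A, of "bd z" q d] by (force simp: R_def bd_chain)
    qed
    show "\<exists>z. R z w" if w: "w \<in> cycles E' (ker_mat E' A) q d" for w
    proof -
      have c: "w \<in> chain E' q d" "\<And>F. bd w F \<in> ker_mat E' A" using w by (auto simp: cycles_def)
      have "bd (actc A ?n w) = 0"
        unfolding actc_bd[symmetric] using c(2) by (auto simp: ker_mat_def actc_def fun_eq_iff)
      \<comment> \<open>For \<open>q = 0\<close> exactness asks for vanishing constant terms, which
        \<open>act_const_0\<close> gets from minimality.\<close>
      then have "\<exists>y\<in>chain E (Suc q) d. bd y = actc A ?n w"
        by (intro koszul_exact actc_chain A c) (auto simp: actc_def act_const_0[OF A])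
      then show ?thesis using c by (auto simp: R_def)
    qed
  qed
  then show ?thesis by (rule lequivI)
qed

lemma cycles_0: "0 \<in> N \<Longrightarrow> cycles E N 0 d = chain E 0 d"
  using bd_chain_0 by (fastforce simp: cycles_def)

text \<open>An element without constant terms lies in the maximal ideal times \<open>F\<close>, so
  it is already a Koszul boundary; elements of \<open>N\<close> add nothing to these.\<close>

lemma boundaries_0:
  fixes N :: "(nat \<Rightarrow> ('v, 'k::field) mpoly) set"
  assumes "0 \<in> N" "\<And>x a. x \<in> N \<Longrightarrow> lkp (x a) 0 = 0"
  shows "boundaries E N 0 d = {z \<in> chain E 0 d. \<forall>a. lkp (z {} a) 0 = 0}"
proof (intro equalityI subsetI)
  fix z assume "z \<in> boundaries E N 0 d"
  then obtain n y where n: "z = n + bd y" "n \<in> chain E 0 d" "\<And>F. n F \<in> N" "y \<in> chain E (Suc 0) d"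
    by (auto simp: boundaries_def)
  have "lkp (bd y {} a) 0 = 0" for a by (simp add: lookup_bd)
  then show "z \<in> {z \<in> chain E 0 d. \<forall>a. lkp (z {} a) 0 = 0}"
    using n assms by (auto simp: lookup_add intro: chain_add bd_chain)
next
  fix z :: "('v, 'k) chain" assume "z \<in> {z \<in> chain E 0 d. \<forall>a. lkp (z {} a) 0 = 0}"
  then have z: "z \<in> chain E 0 d" "\<forall>a. lkp (z {} a) 0 = 0" by auto
  then obtain y where "y \<in> chain E (Suc 0) d" "bd y = z" using koszul_exact[OF z(1) bd_chain_0[OF z(1)]] by auto
  moreover have "\<And>F. (z - z) F \<in> N" using assms(1) by (simp add: zero_fun_def)
  ultimately show "z \<in> boundaries E N 0 d" unfolding boundaries_def
    by (intro CollectI exI[of _ "z - z"] exI[of _ y]) simp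
qed

definition is_res :: "(nat \<Rightarrow> nat list) \<Rightarrow> (nat \<Rightarrow> nat \<Rightarrow> nat \<Rightarrow> ('v, 'k::field) mpoly) \<Rightarrow> bool" where
  "is_res D A \<longleftrightarrow> D 0 = [0] \<and> (\<forall>i. graded_mat (D i) (D (Suc i)) (A i) \<and>
     im_mat (D (Suc (Suc i))) (A (Suc i)) = ker_mat (D (Suc i)) (A i))"

lemma im_mat_zero: "0 \<in> im_mat E' A"
  unfolding im_mat_def by (rule image_eqI[of _ _ 0]) simp_all

lemma im_mat_const_0: "graded_mat E E' A \<Longrightarrow> x \<in> im_mat E' A \<Longrightarrow> lkp (x a) 0 = 0"
  using act_const_0 by (auto simp: im_mat_def)

lemma im_mat_add:
  assumes "x \<in> im_mat E' A" "y \<in> im_mat E' A" shows "x + y \<in> im_mat E' A"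
proof -
  obtain x' y' where "x' \<in> free_vecs (length E')" "y' \<in> free_vecs (length E')"
    and xy: "x = act A (length E') x'" "y = act A (length E') y'"
    using assms by (auto simp: im_mat_def)
  then have "x' + y' \<in> free_vecs (length E')" by (simp add: free_vecs_add)
  then show ?thesis unfolding im_mat_def xy act_add[symmetric] by (rule imageI)
qed

lemma free_vecs_mult: "p \<in> polys V \<Longrightarrow> x \<in> free_vecs n \<Longrightarrow> (\<lambda>a. p * x a) \<in> free_vecs n"
  by (simp add: free_vecs_def)

lemma act_mult: "act A n (\<lambda>a. p * x a) = (\<lambda>a. p * act A n x a)"
  by (auto simp: act_def fun_eq_iff sum_distrib_left mult_ac)

lemma im_mat_mult:
  assumes "p \<in> polys V" "x \<in> im_mat E' A" shows "(\<lambda>a. p * x a) \<in> im_mat E' A"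
proof -
  obtain x' where "x' \<in> free_vecs (length E')" and x: "x = act A (length E') x'"
    using assms by (auto simp: im_mat_def)
  then have "(\<lambda>a. p * x' a) \<in> free_vecs (length E')" using assms(1) by (simp add: free_vecs_mult)
  then show ?thesis unfolding im_mat_def x act_mult[symmetric] by (rule imageI)
qed

text \<open>Exactness identifies the kernel at one stage with the image at the next, so the shifts
  compose; after \<open>i\<close> of them exterior degree zero is reached.\<close>

theorem res_homology:
  assumes res: "is_res D A"
  shows "lequiv (cycles [0] (im_mat (D 1) (A 0)) i d) (boundaries [0] (im_mat (D 1) (A 0)) i d)
    (chain (D i) 0 d) {z \<in> chain (D i) 0 d. \<forall>a. lkp (z {} a) 0 = 0}"
proof -
  let ?N = "\<lambda>i. im_mat (D (Suc i)) (A i)"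
  have g: "graded_mat (D i) (D (Suc i)) (A i)" for i using res by (simp add: is_res_def)
  have ker_mat: "ker_mat (D (Suc i)) (A i) = ?N (Suc i)" for i using res by (simp add: is_res_def)
  have "lequiv (cycles (D 0) (?N 0) i d) (boundaries (D 0) (?N 0) i d)
      (cycles (D k) (?N k) (i - k) d) (boundaries (D k) (?N k) (i - k) d)" if "k \<le> i" for k
    using that
  proof (induction k)
    case 0
    show ?case
    proof (simp, rule lequiv_refl)
      show "0 \<in> cycles (D 0) (?N 0) i d"
        using im_mat_zero by (simp add: cycles_def)
      show "z + w \<in> cycles (D 0) (?N 0) i d" if "z \<in> cycles (D 0) (?N 0) i d" "w \<in> cycles (D 0) (?N 0) i d" for z w
        using that by (simp add: cycles_def chain_add bd_add im_mat_add)
      show "cst_scale c z \<in> cycles (D 0) (?N 0) i d" if "z \<in> cycles (D 0) (?N 0) i d" for c z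
        using that by (simp add: cycles_def chain_cst_scale bd_cst_scale) (simp add: cst_scale_def im_mat_mult)
    qed
  next
    case (Suc k)
    then have "i - k = Suc (i - Suc k)" by simp
    then show ?case using Suc lequiv_trans dimension_shift[OF g[of k], of "i - Suc k" d] ker_mat[of k] by auto
  qed
  from this[of i] have "lequiv (cycles (D 0) (?N 0) i d) (boundaries (D 0) (?N 0) i d)
      (cycles (D i) (?N i) 0 d) (boundaries (D i) (?N i) 0 d)" by simp
  moreover have "cycles (D i) (?N i) 0 d = chain (D i) 0 d" by (intro cycles_0 im_mat_zero)
  moreover have "boundaries (D i) (?N i) 0 d = {z \<in> chain (D i) 0 d. \<forall>a. lkp (z {} a) 0 = 0}"
    by (intro boundaries_0 im_mat_zero im_mat_const_0[OF g])
  ultimately show ?thesis using res by (simp add: is_res_def)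
qed

end

section \<open>Betti numbers and Koszul homology\<close>

text \<open>Gaussian elimination on the equations: either the equation \<open>a0\<close> is void, or
  a pivot \<open>b0\<close> removes one equation together with one unknown.\<close>

lemma underdetermined_system:
  fixes M :: "'a \<Rightarrow> 'b \<Rightarrow> 'k::field"
  assumes "finite T" "finite S" "card T < card S"
  shows "\<exists>c. (\<exists>b\<in>S. c b \<noteq> 0) \<and> (\<forall>a\<in>T. (\<Sum>b\<in>S. c b * M b a) = 0)"
  using assms
proof (induction T arbitrary: S M rule: finite_induct)
  case empty
  then have "S \<noteq> {}" by auto
  then show ?case by (intro exI[of _ "\<lambda>_. 1"]) auto
next
  case (insert a0 T)
  show ?case
  proof (cases "\<forall>b\<in>S. M b a0 = 0")
    case True
    obtain c where "\<exists>b\<in>S. c b \<noteq> 0" "\<forall>a\<in>T. (\<Sum>b\<in>S. c b * M b a) = 0"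
      using insert.IH[of S M] insert.prems insert.hyps by auto
    then show ?thesis using True by (intro exI[of _ c]) auto
  next
    case False
    then obtain b0 where b0: "b0 \<in> S" "M b0 a0 \<noteq> 0" by auto
    define M' where "M' b a = M b a - M b a0 / M b0 a0 * M b0 a" for b a
    have "card T < card (S - {b0})" using insert b0 by simp
    then obtain c where c: "\<exists>b\<in>S - {b0}. c b \<noteq> 0" "\<forall>a\<in>T. (\<Sum>b\<in>S - {b0}. c b * M' b a) = 0"
      using insert.IH[of "S - {b0}" M'] insert.prems by auto
    define m where "m = (\<Sum>b\<in>S - {b0}. c b * M b a0)"
    \<comment> \<open>The value at the pivot solves the equation \<open>a0\<close>; substituting it
      turns the remaining equations into those of \<open>M'\<close>.\<close>
    define c' where "c' = c(b0 := - m / M b0 a0)"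
    have sum: "(\<Sum>b\<in>S. c' b * M b a) = (\<Sum>b\<in>S - {b0}. c b * M' b a)" for a
    proof -
      have "(\<Sum>b\<in>S. c' b * M b a) = c' b0 * M b0 a + (\<Sum>b\<in>S - {b0}. c' b * M b a)"
        using b0 insert.prems by (intro sum.remove) auto
      also have "(\<Sum>b\<in>S - {b0}. c' b * M b a) = (\<Sum>b\<in>S - {b0}. c b * M b a)"
        by (intro sum.cong) (auto simp: c'_def)
      also have "c' b0 * M b0 a = - (\<Sum>b\<in>S - {b0}. c b * (M b a0 / M b0 a0 * M b0 a))"
        by (simp add: c'_def m_def sum_distrib_right sum_divide_distrib mult.assoc)
      finally show ?thesis by (simp add: M'_def right_diff_distrib sum_subtractf)
    qed
    have "M' b a0 = 0" for b using b0 by (simp add: M'_def)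
    then have "\<forall>a\<in>insert a0 T. (\<Sum>b\<in>S. c' b * M b a) = 0"
      using c(2) unfolding sum by simp
    moreover have "\<exists>b\<in>S. c' b \<noteq> 0" using c(1) by (auto simp: c'_def)
    ultimately show ?thesis by blast
  qed
qed

lemma count_list_card: "count_list xs y = card {i. i < length xs \<and> xs ! i = y}"
  by (simp add: count_list_eq_length_filter length_filter_conv_card eq_commute)

lemma lrel_sum:
  assumes "lrel R Z B Z' B'" "finite S" "\<And>b. b \<in> S \<Longrightarrow> R (x b) (y b)"
  shows "R (\<Sum>b\<in>S. cst_scale (c b) (x b)) (\<Sum>b\<in>S. cst_scale (c b) (y b))"
  using assms(2,3)
proof (induction S rule: finite_induct)
  case empty
  show ?case unfolding sum.empty by (rule lrelD(1)[OF assms(1)])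
next
  case (insert b S)
  show ?case unfolding sum.insert[OF insert.hyps(1,2)]
    by (intro lrelD(2)[OF assms(1)] lrelD(3)[OF assms(1)] insert.IH insert.prems) auto
qed

lemma lequiv_subset_iff:
  assumes "lequiv Z B Z' B'" shows "Z \<subseteq> B \<longleftrightarrow> Z' \<subseteq> B'"
proof -
  have sub: "Z' \<subseteq> B'" if "lequiv Z B Z' B'" "Z \<subseteq> B" for Z B Z' B' :: "('a, 'b) chain set"
  proof
    fix w assume w: "w \<in> Z'"
    obtain R where R: "lrel R Z B Z' B'" using \<open>lequiv Z B Z' B'\<close> by (auto simp: lequiv_def)
    obtain z where "R z w" using lrelD(8)[OF R w] ..
    then show "w \<in> B'" using lrelD(4,6)[OF R] that(2) by blast
  qed
  show ?thesis using sub[OF assms] sub[OF lequiv_sym[OF assms]] by blast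
qed

context koszul
begin

abbreviation const_free :: "nat list \<Rightarrow> nat \<Rightarrow> ('v, 'k::field) chain set" where
  "const_free E d \<equiv> {z \<in> chain E 0 d. \<forall>a. lkp (z {} a) 0 = 0}"

definition unit_chain :: "nat \<Rightarrow> ('v, 'k::field) chain" where
  "unit_chain b F a = (if F = {} \<and> a = b then 1 else 0)"

lemma unit_chain_in_chain: "b < length E \<Longrightarrow> unit_chain b \<in> chain E 0 (E ! b)"
  by (rule chainI) (auto simp: unit_chain_def lookup_one split: if_splits)

text \<open>A comparison of dimensions without quotient spaces. If \<open>E\<close> had more basis
  elements of degree \<open>d\<close>, some nontrivial combination of them would be related to an
  element without constant terms, so the combination itself would have none; but its constants are
  its coefficients.\<close>

lemma count_le:
  assumes "lequiv (chain E 0 d) (const_free E d) (chain E' 0 d) (const_free E' d :: ('v, 'k::field) chain set)"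
  shows "count_list E d \<le> count_list E' d"
proof (rule ccontr)
  define S where "S = {i. i < length E \<and> E ! i = d}"
  define T where "T = {i. i < length E' \<and> E' ! i = d}"
  have fin: "finite S" "finite T" by (auto simp: S_def T_def)
  assume "\<not> count_list E d \<le> count_list E' d"
  then have card: "card T < card S" by (simp add: count_list_card S_def T_def)
  obtain R where R: "lrel R (chain E 0 d) (const_free E d) (chain E' 0 d) (const_free E' d :: ('v, 'k) chain set)"
    using assms by (auto simp: lequiv_def)
  have "\<exists>w. R (unit_chain b) w" if "b \<in> S" for b
    using that unit_chain_in_chain[of b E] by (intro lrelD(7)[OF R]) (auto simp: S_def)
  then obtain y where y: "\<And>b. b \<in> S \<Longrightarrow> R (unit_chain b) (y b)" by metis
  obtain c where c: "\<exists>b\<in>S. c b \<noteq> 0" "\<forall>a\<in>T. (\<Sum>b\<in>S. c b * lkp (y b {} a) 0) = 0"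
    using underdetermined_system[OF fin(2,1) card, of "\<lambda>b a. lkp (y b {} a) 0"] by blast
  let ?x = "\<Sum>b\<in>S. cst_scale (c b) (unit_chain b)" and ?w = "\<Sum>b\<in>S. cst_scale (c b) (y b)"
  have rel: "R ?x ?w" using R fin(1) y by (rule lrel_sum)
  have w: "?w \<in> chain E' 0 d" using lrelD(5)[OF R rel] .
  have "lkp (?w {} a) 0 = 0" for a
  proof (cases "a \<in> T")
    case True
    then show ?thesis using c(2) by (simp add: sum_fun_apply lookup_sum cst_scale_apply)
  next
    \<comment> \<open>Outside \<open>T\<close> the coordinate \<open>a\<close> has a basis degree
      other than \<open>d\<close>, so a constant there would have the wrong total degree.\<close>
    case False
    then show ?thesis using chainD(3,5)[OF w, of "{}" a 0] by (auto simp: T_def)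
  qed
  then have "?w \<in> const_free E' d" using w by blast
  then have "?x \<in> const_free E d" using lrelD(6)[OF R rel] by blast
  then have x0: "lkp (?x {} a) 0 = 0" for a by blast
  have "c a = 0" if "a \<in> S" for a
  proof -
    have "lkp (?x {} a) 0 = (\<Sum>b\<in>S. if b = a then c b else 0)"
      unfolding sum_fun_apply lookup_sum cst_scale_apply lookup_cst_times
      by (intro sum.cong) (auto simp: unit_chain_def)
    then show ?thesis using x0[of a] that fin by simp
  qed
  then show False using c(1) by blast
qed

lemma count_nonzero_iff: "count_list E d \<noteq> 0 \<longleftrightarrow> \<not> chain E 0 d \<subseteq> (const_free E d :: ('v, 'k::field) chain set)"
proof
  assume "count_list E d \<noteq> 0"
  then have "d \<in> set E" by (simp add: count_list_0_iff)
  then obtain b where b: "b < length E" "E ! b = d" by (auto simp: in_set_conv_nth)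
  then have "unit_chain b \<in> chain E 0 d" using unit_chain_in_chain by blast
  moreover have "lkp (unit_chain b {} b :: ('v, 'k) mpoly) 0 \<noteq> 0" by (simp add: unit_chain_def)
  ultimately show "\<not> chain E 0 d \<subseteq> (const_free E d :: ('v, 'k) chain set)" by blast
next
  assume "\<not> chain E 0 d \<subseteq> (const_free E d :: ('v, 'k) chain set)"
  then obtain z :: "('v, 'k) chain" and a where z: "z \<in> chain E 0 d" "lkp (z {} a) 0 \<noteq> 0" by blast
  have "a < length E" "E ! a = d" using chainD(3,5)[OF z] by simp_all
  then show "count_list E d \<noteq> 0" by (auto simp: count_list_0_iff)
qed

lemma res_count_unique:
  assumes "is_res D A" "is_res D' A'" "im_mat (D 1) (A 0) = im_mat (D' 1) (A' 0)"
  shows "count_list (D i) d = count_list (D' i) d"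
proof -
  note L = res_homology[OF assms(1), of i d] res_homology[OF assms(2), of i d]
  show ?thesis
    using count_le[OF lequiv_trans[OF lequiv_sym[OF L(1)] L(2)[folded assms(3)]]]
      count_le[OF lequiv_trans[OF lequiv_sym[OF L(2)] L(1)[unfolded assms(3)]]] by simp
qed

lemma res_count_nonzero:
  assumes "is_res D A"
  shows "count_list (D i) d \<noteq> 0 \<longleftrightarrow> \<not> cycles [0] (im_mat (D 1) (A 0)) i d \<subseteq> boundaries [0] (im_mat (D 1) (A 0)) i d"
  unfolding lequiv_subset_iff[OF res_homology[OF assms]] by (rule count_nonzero_iff)

text \<open>The ideal as a submodule of the free module of rank one, which is the form taken by
  \<open>im_mat\<close> at the first step of a resolution.\<close>

definition ivec :: "('v, 'k::field) mpoly set \<Rightarrow> (nat \<Rightarrow> ('v, 'k) mpoly) set" where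
  "ivec I = {x. x 0 \<in> I \<and> (\<forall>a>0. x a = 0)}"

section \<open>Translation between vectors and matrices and their function form\<close>

lemma mult_mat_vec_act:
  assumes "M \<in> carrier_mat n n'" "\<And>a b. a < n \<Longrightarrow> b < n' \<Longrightarrow> M $$ (a, b) = A a b"
  shows "M *\<^sub>v vec n' x = vec n (act A n' x)"
  using assms by (intro eq_vecI) (auto simp: scalar_prod_def act_def lessThan_atLeast0 intro!: sum.cong)

lemma free_mod_eq: "free_mod V n = vec n ` free_vecs n"
proof (intro equalityI subsetI)
  fix v assume v: "v \<in> free_mod V n"
  have "v = vec n (\<lambda>a. if a < n then v $ a else 0)"
    using v by (intro eq_vecI) (auto simp: free_mod_def)
  moreover have "(\<lambda>a. if a < n then v $ a else 0) \<in> free_vecs n" using v by (auto simp: free_mod_def free_vecs_def)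
  ultimately show "v \<in> vec n ` free_vecs n" by (rule image_eqI)
qed (auto simp: free_mod_def free_vecs_def)

lemma inj_on_vec: "inj_on (vec n) (free_vecs n)"
proof (rule inj_onI, rule ext)
  fix x y :: "nat \<Rightarrow> ('v, 'k::field) mpoly" and a assume *: "x \<in> free_vecs n" "y \<in> free_vecs n" "vec n x = vec n y"
  show "x a = y a"
  proof (cases "a < n")
    case True
    then show ?thesis using arg_cong[OF *(3), of "\<lambda>v. v $ a"] by simp
  next
    case False
    then show ?thesis using * by (simp add: free_vecs_def)
  qed
qed

lemma im_mat_free_vecs:
  assumes "graded_mat E E' A" shows "im_mat E' A \<subseteq> free_vecs (length E)"
proof
  fix y assume "y \<in> im_mat E' A"
  then obtain x where x: "x \<in> free_vecs (length E')" "y = act A (length E') x" by (auto simp: im_mat_def)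
  have "A a b \<in> polys V" for a b using graded_matD(3)[OF assms] by (auto simp: in_polys_iff)
  moreover have "A a b = 0" if "length E \<le> a" for a b
    using graded_matD(1)[OF assms, of a b] that by (intro poly_mapping_eqI) (auto simp: not_less[symmetric])
  ultimately show "y \<in> free_vecs (length E)" using x by (auto simp: free_vecs_def act_def intro!: polys_sum)
qed

lemma matrix_image_kernel:
  fixes A :: "nat \<Rightarrow> nat \<Rightarrow> ('v, 'k::field) mpoly"
  assumes A: "graded_mat E E' A" and M: "M \<in> carrier_mat (length E) (length E')"
    "\<And>a b. a < length E \<Longrightarrow> b < length E' \<Longrightarrow> M $$ (a, b) = A a b"
  shows "(\<lambda>x. M *\<^sub>v x) ` free_mod V (length E') = vec (length E) ` im_mat E' A"
    and "mat_kernel M \<inter> free_mod V (length E') = vec (length E') ` ker_mat E' A"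
proof -
  have mv: "M *\<^sub>v vec (length E') x = vec (length E) (act A (length E') x)" for x
    using M by (rule mult_mat_vec_act)
  show "(\<lambda>x. M *\<^sub>v x) ` free_mod V (length E') = vec (length E) ` im_mat E' A"
    unfolding free_mod_eq im_mat_def image_image mv ..
  have "M *\<^sub>v vec (length E') x = 0\<^sub>v (length E) \<longleftrightarrow> act A (length E') x = 0" if "x \<in> free_vecs (length E')" for x
  proof -
    have "act A (length E') x \<in> free_vecs (length E)" using im_mat_free_vecs[OF A] that by (auto simp: im_mat_def)
    moreover have "0\<^sub>v (length E) = vec (length E) (0 :: nat \<Rightarrow> ('v, 'k) mpoly)" by (rule eq_vecI) simp_all
    ultimately show ?thesis unfolding mv using inj_onD[OF inj_on_vec, of "length E" "act A (length E') x" 0] by auto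
  qed
  then show "mat_kernel M \<inter> free_mod V (length E') = vec (length E') ` ker_mat E' A"
    using M(1) unfolding free_mod_eq ker_mat_def mat_kernel_def by auto
qed

lemma im_mat_eq_ivec_iff:
  assumes A: "graded_mat [0] E' A" and M: "M \<in> carrier_mat (length [0::nat]) (length E')"
    "\<And>a b. a < length [0::nat] \<Longrightarrow> b < length E' \<Longrightarrow> M $$ (a, b) = A a b"
  shows "(\<lambda>x. (M *\<^sub>v x) $ 0) ` free_mod V (length E') = I \<longleftrightarrow> im_mat E' A = ivec I"
proof -
  have mik: "(\<lambda>x. M *\<^sub>v x) ` free_mod V (length E') = vec (length [0::nat]) ` im_mat E' A"
    using A M by (rule matrix_image_kernel(1))
  have "(\<lambda>x. (M *\<^sub>v x) $ 0) ` free_mod V (length E') = (\<lambda>v. v $ 0) ` ((\<lambda>x. M *\<^sub>v x) ` free_mod V (length E'))"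
    by (simp only: image_image)
  also have "\<dots> = (\<lambda>v. v $ 0) ` vec (length [0::nat]) ` im_mat E' A" unfolding mik ..
  also have "\<dots> = (\<lambda>x. x 0) ` im_mat E' A" by (simp add: image_image)
  finally have eq: "(\<lambda>x. (M *\<^sub>v x) $ 0) ` free_mod V (length E') = (\<lambda>x. x 0) ` im_mat E' A" .
  have sub: "x a = 0" if "x \<in> im_mat E' A" "a > 0" for x a
    using im_mat_free_vecs[OF A] that by (auto simp: free_vecs_def Suc_le_eq)
  show ?thesis unfolding eq
  proof
    assume I: "(\<lambda>x. x 0) ` im_mat E' A = I"
    show "im_mat E' A = ivec I"
    proof (intro equalityI subsetI)
      fix x assume "x \<in> im_mat E' A" then show "x \<in> ivec I" using I sub by (auto simp: ivec_def)
    next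
      fix x assume x: "x \<in> ivec I"
      then obtain y where y: "y \<in> im_mat E' A" "x 0 = y 0" using I by (auto simp: ivec_def)
      have "x a = y a" for a using x y sub[OF y(1), of a] by (cases "a = 0") (auto simp: ivec_def)
      then have "x = y" by (rule ext)
      then show "x \<in> im_mat E' A" using y by simp
    qed
  next
    assume I: "im_mat E' A = ivec I"
    have "p \<in> (\<lambda>x. x 0) ` ivec I" if "p \<in> I" for p
      using that by (intro image_eqI[of _ _ "\<lambda>a. if a = 0 then p else 0"]) (auto simp: ivec_def)
    then show "(\<lambda>x. x 0) ` im_mat E' A = I" unfolding I by (auto simp: ivec_def)
  qed
qed

text \<open>Functions in \<open>free_vecs n\<close> vanish from \<open>n\<close> on, so truncating
  them to vectors is injective; hence equality of images and kernels may be tested before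
  truncation. \<open>A\<close> is the extension of \<open>M\<close> by zero.\<close>

lemma minimal_resolution_iff:
  assumes M: "\<And>i. M i \<in> carrier_mat (length (D i)) (length (D (Suc i)))"
    "\<And>i a b. a < length (D i) \<Longrightarrow> b < length (D (Suc i)) \<Longrightarrow> M i $$ (a, b) = A i a b"
    and A: "\<And>i a b. \<not> (a < length (D i) \<and> b < length (D (Suc i))) \<Longrightarrow> A i a b = 0"
  shows "minimal_resolution V I D M \<longleftrightarrow> is_res D A \<and> im_mat (D 1) (A 0) = ivec I"
proof -
  have g: "(\<forall>a<length (D i). \<forall>b<length (D (Suc i)). M i $$ (a, b) \<in> polys V) \<and>
     (\<forall>a<length (D i). \<forall>b<length (D (Suc i)).
        \<forall>t\<in>kys (M i $$ (a, b)). D i ! a + mon_deg t = D (Suc i) ! b) \<and>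
     (\<forall>a<length (D i). \<forall>b<length (D (Suc i)). lkp (M i $$ (a, b)) 0 = 0) \<longleftrightarrow> graded_mat (D i) (D (Suc i)) (A i)"
    (is "?L i \<longleftrightarrow> _") for i
  proof
    assume L: "?L i"
    show "graded_mat (D i) (D (Suc i)) (A i)"
      unfolding graded_mat_def
    proof (intro allI impI)
      fix a b t assume nz: "lkp (A i a b) t \<noteq> 0"
      have ab: "a < length (D i)" "b < length (D (Suc i))"
        using A[of a i b] nz by (cases "a < length (D i) \<and> b < length (D (Suc i))"; simp)+
      then have "M i $$ (a, b) \<in> polys V" "\<forall>t\<in>kys (M i $$ (a, b)). D i ! a + mon_deg t = D (Suc i) ! b"
        "lkp (M i $$ (a, b)) 0 = 0" using L by blast+
      then have "A i a b \<in> polys V" "\<forall>t\<in>kys (A i a b). D i ! a + mon_deg t = D (Suc i) ! b"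
        "lkp (A i a b) 0 = 0" unfolding M(2)[OF ab] .
      then show "a < length (D i) \<and> b < length (D (Suc i)) \<and> kys t \<subseteq> V \<and>
          D i ! a + mon_deg t = D (Suc i) ! b \<and> t \<noteq> 0"
        using ab nz by (auto simp: in_polys_iff in_keys_iff)
    qed
  next
    assume G: "graded_mat (D i) (D (Suc i)) (A i)"
    show "?L i"
    proof (intro conjI allI impI ballI)
      fix a b assume ab: "a < length (D i)" "b < length (D (Suc i))"
      show "M i $$ (a, b) \<in> polys V"
        unfolding M(2)[OF ab] using graded_matD(3)[OF G, of a b] by (auto simp: in_polys_iff)
      show "lkp (M i $$ (a, b)) 0 = 0"
        unfolding M(2)[OF ab] using graded_matD(5)[OF G, of a b 0] by blast
      show "D i ! a + mon_deg t = D (Suc i) ! b" if "t \<in> kys (M i $$ (a, b))" for t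
        using that graded_matD(4)[OF G, of a b t] unfolding M(2)[OF ab] by (simp add: in_keys_iff)
    qed
  qed
  have "minimal_resolution V I D M \<longleftrightarrow> D 0 = [0] \<and> (\<forall>i. ?L i) \<and>
     (\<lambda>x. (M 0 *\<^sub>v x) $ 0) ` free_mod V (length (D 1)) = I \<and>
     (\<forall>i. (\<lambda>x. M (Suc i) *\<^sub>v x) ` free_mod V (length (D (Suc (Suc i)))) =
          mat_kernel (M i) \<inter> free_mod V (length (D (Suc i))))"
    unfolding minimal_resolution_def using M(1) by (simp add: all_conj_distrib)
  also have "\<dots> \<longleftrightarrow> D 0 = [0] \<and> (\<forall>i. graded_mat (D i) (D (Suc i)) (A i)) \<and> im_mat (D 1) (A 0) = ivec I \<and>
     (\<forall>i. im_mat (D (Suc (Suc i))) (A (Suc i)) = ker_mat (D (Suc i)) (A i))"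
    unfolding g
  proof (intro conj_cong refl)
    assume D0: "D 0 = [0]" and G: "\<forall>i. graded_mat (D i) (D (Suc i)) (A i)"
    have "graded_mat [0] (D 1) (A 0)" using G D0 by (metis One_nat_def)
    then show "((\<lambda>x. (M 0 *\<^sub>v x) $ 0) ` free_mod V (length (D 1)) = I) = (im_mat (D 1) (A 0) = ivec I)"
      using M(1)[of 0] M(2)[of _ 0] D0 by (intro im_mat_eq_ivec_iff) auto
    have "((\<lambda>x. M (Suc i) *\<^sub>v x) ` free_mod V (length (D (Suc (Suc i)))) =
          mat_kernel (M i) \<inter> free_mod V (length (D (Suc i)))) =
        (im_mat (D (Suc (Suc i))) (A (Suc i)) = ker_mat (D (Suc i)) (A i))" for i
    proof -
      have "im_mat (D (Suc (Suc i))) (A (Suc i)) \<subseteq> free_vecs (length (D (Suc i)))" using im_mat_free_vecs G by blast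
      moreover have "ker_mat (D (Suc i)) (A i) \<subseteq> free_vecs (length (D (Suc i)))" by (auto simp: ker_mat_def)
      moreover have "(\<lambda>x. M (Suc i) *\<^sub>v x) ` free_mod V (length (D (Suc (Suc i)))) =
          vec (length (D (Suc i))) ` im_mat (D (Suc (Suc i))) (A (Suc i))"
        using spec[OF G, of "Suc i"] M(1,2) by (rule matrix_image_kernel(1))
      moreover have "mat_kernel (M i) \<inter> free_mod V (length (D (Suc i))) = vec (length (D (Suc i))) ` ker_mat (D (Suc i)) (A i)"
        using spec[OF G, of i] M(1,2) by (rule matrix_image_kernel(2))
      ultimately show ?thesis by (simp only: inj_on_image_eq_iff[OF inj_on_vec])
    qed
    then show "(\<forall>i. (\<lambda>x. M (Suc i) *\<^sub>v x) ` free_mod V (length (D (Suc (Suc i)))) =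
          mat_kernel (M i) \<inter> free_mod V (length (D (Suc i)))) =
        (\<forall>i. im_mat (D (Suc (Suc i))) (A (Suc i)) = ker_mat (D (Suc i)) (A i))" by simp
  qed
  finally show ?thesis by (auto simp: is_res_def)
qed

text \<open>The given resolution makes the definite description in \<open>betti\<close> satisfiable,
  and \<open>res_count_unique\<close> makes its value unique.\<close>

lemma betti_nonzero_iff:
  assumes res: "is_res D A" "im_mat (D 1) (A 0) = ivec I"
  shows "betti V I i d \<noteq> 0 \<longleftrightarrow> \<not> cycles [0] (ivec I) i d \<subseteq> boundaries [0] (ivec I) i d"
proof -
  define M where "M i = mat (length (D i)) (length (D (Suc i))) (\<lambda>(a, b). A i a b)" for i
  have "A i a b = 0" if "\<not> (a < length (D i) \<and> b < length (D (Suc i)))" for i a b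
    using res(1) that unfolding is_res_def graded_mat_def by (intro poly_mapping_eqI) (metis lookup_zero)
  then have min: "minimal_resolution V I D M"
    using res by (subst minimal_resolution_iff[of M D A]) (auto simp: M_def)
  have "n = count_list (D i) d" if ex: "\<exists>D A. minimal_resolution V I D A \<and> n = count_list (D i) d" for n
  proof -
    obtain D' M' where D': "minimal_resolution V I D' M'" "n = count_list (D' i) d" using ex by blast
    define A' where "A' i a b = (if a < length (D' i) \<and> b < length (D' (Suc i)) then M' i $$ (a, b) else 0)" for i a b
    have "is_res D' A' \<and> im_mat (D' 1) (A' 0) = ivec I"
      using D'(1) by (subst minimal_resolution_iff[of M' D' A', symmetric]) (auto simp: A'_def minimal_resolution_def)
    then show ?thesis using res_count_unique[of D' A' D A i d] res D'(2) by simp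
  qed
  then have "betti V I i d = count_list (D i) d"
    unfolding betti_def using min by (intro the_equality) blast+
  then show ?thesis using res_count_nonzero[OF res(1), of i d] res(2) by simp
qed

end

section \<open>Existence of minimal resolutions\<close>

text \<open>As \<open>q\<close> is homogeneous of degree \<open>e - k\<close>, a degree of
  \<open>p * q\<close> determines a degree of \<open>p\<close>. All degrees are stated as sums to
  avoid truncated subtraction.\<close>

lemma polypart_mult_homogeneous:
  fixes p q :: "('v, 'k::field) mpoly"
  assumes q: "\<And>t. lkp q t \<noteq> 0 \<Longrightarrow> mon_deg t + k = e"
  shows "polypart (\<lambda>t. mon_deg t + k = d) (p * q) = polypart (\<lambda>t. mon_deg t + e = d) p * q"
proof (rule poly_mapping_eqI)
  fix t
  define p1 where "p1 = polypart (\<lambda>t. mon_deg t + e = d) p"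
  define p2 where "p2 = polypart (\<lambda>t. mon_deg t + e \<noteq> d) p"
  have "p = p1 + p2" by (rule poly_mapping_eqI) (simp add: p1_def p2_def lookup_add)
  then have pq: "p * q = p1 * q + p2 * q" by (simp add: distrib_right)
  show "lkp (polypart (\<lambda>t. mon_deg t + k = d) (p * q)) t = lkp (polypart (\<lambda>t. mon_deg t + e = d) p * q) t"
  proof (cases "mon_deg t + k = d")
    case True
    have "lkp (p2 * q) t = 0"
    proof (rule ccontr)
      assume "lkp (p2 * q) t \<noteq> 0"
      then obtain r s where rs: "t = r + s" "lkp p2 r \<noteq> 0" "lkp q s \<noteq> 0" by (rule keys_multE)
      then show False using True q[OF rs(3)] by (auto simp: p2_def split: if_splits)
    qed
    then show ?thesis using True by (simp add: pq lookup_add flip: p1_def)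
  next
    case False
    have "lkp (p1 * q) t = 0"
    proof (rule ccontr)
      assume "lkp (p1 * q) t \<noteq> 0"
      then obtain r s where rs: "t = r + s" "lkp p1 r \<noteq> 0" "lkp q s \<noteq> 0" by (rule keys_multE)
      then show False using False q[OF rs(3)] by (auto simp: p1_def split: if_splits)
    qed
    then show ?thesis using False by (simp flip: p1_def)
  qed
qed

lemma polypart_sum: "polypart P (\<Sum>i\<in>S. g i) = (\<Sum>i\<in>S. polypart P (g i))"
  by (rule poly_mapping_eqI) (simp add: lookup_sum)

lemma polypart_0 [simp]: "polypart P 0 = 0"
  by (rule poly_mapping_eqI) simp

definition poly_scale :: "('v, 'k::field) mpoly \<Rightarrow> (nat \<Rightarrow> ('v, 'k) mpoly) \<Rightarrow> nat \<Rightarrow> ('v, 'k) mpoly" where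
  "poly_scale p x = (\<lambda>a. p * x a)"

text \<open>Subspaces over the field: only constants act, so that the graded pieces of a module
  qualify.\<close>

definition lsub :: "(nat \<Rightarrow> ('v, 'k::field) mpoly) set \<Rightarrow> bool" where
  "lsub P \<longleftrightarrow> 0 \<in> P \<and> (\<forall>x\<in>P. \<forall>y\<in>P. x + y \<in> P) \<and> (\<forall>c. \<forall>x\<in>P. poly_scale (cst c) x \<in> P)"

lemma lsubD:
  assumes "lsub P"
  shows "0 \<in> P" "x \<in> P \<Longrightarrow> y \<in> P \<Longrightarrow> x + y \<in> P" "x \<in> P \<Longrightarrow> poly_scale (cst c) x \<in> P"
  using assms by (auto simp: lsub_def)

text \<open>The finitely many coefficient functionals in \<open>C\<close> embed \<open>U\<close> in
  a finite-dimensional space. If a functional is nonzero at some \<open>x0\<close>, then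
  \<open>x0\<close> together with a spanning set of its kernel spans \<open>U\<close>. Quantifying
  over all subspaces \<open>P\<close> that contain \<open>S\<close> expresses spanning without
  linear combinations.\<close>

lemma finite_spanning_set:
  fixes U :: "(nat \<Rightarrow> ('v, 'k::field) mpoly) set"
  assumes "finite C" "lsub U" "\<And>x. x \<in> U \<Longrightarrow> (\<And>a t. (a, t) \<in> C \<Longrightarrow> lkp (x a) t = 0) \<Longrightarrow> x = 0"
  shows "\<exists>S. finite S \<and> S \<subseteq> U \<and> (\<forall>P. lsub P \<longrightarrow> S \<subseteq> P \<longrightarrow> U \<subseteq> P)"
  using assms
proof (induction C arbitrary: U rule: finite_induct)
  case empty
  then have "U \<subseteq> {0}" by blast
  then show ?case by (intro exI[of _ "{}"]) (auto simp: lsub_def)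
next
  case (insert c C)
  obtain a0 t0 where c: "c = (a0, t0)" by (cases c)
  show ?case
  proof (cases "\<forall>x\<in>U. lkp (x a0) t0 = 0")
    case True
    show ?thesis
    proof (rule insert.IH[OF insert.prems(1)])
      fix x assume x: "x \<in> U" "\<And>a t. (a, t) \<in> C \<Longrightarrow> lkp (x a) t = 0"
      show "x = 0" using x True by (intro insert.prems(2)) (auto simp: c)
    qed
  next
    case False
    then obtain x0 where x0: "x0 \<in> U" "lkp (x0 a0) t0 \<noteq> 0" by blast
    define U' where "U' = {x\<in>U. lkp (x a0) t0 = 0}"
    have "\<exists>S. finite S \<and> S \<subseteq> U' \<and> (\<forall>P. lsub P \<longrightarrow> S \<subseteq> P \<longrightarrow> U' \<subseteq> P)"
    proof (rule insert.IH)
      show "lsub U'" using insert.prems(1) by (simp add: lsub_def U'_def lookup_add poly_scale_def)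
      fix x assume x: "x \<in> U'" "\<And>a t. (a, t) \<in> C \<Longrightarrow> lkp (x a) t = 0"
      then show "x = 0" by (intro insert.prems(2)) (auto simp: c U'_def)
    qed
    then obtain S where S: "finite S" "S \<subseteq> U'" "\<And>P. lsub P \<Longrightarrow> S \<subseteq> P \<Longrightarrow> U' \<subseteq> P" by blast
    have "U \<subseteq> P" if P: "lsub P" "insert x0 S \<subseteq> P" for P
    proof
      fix x assume x: "x \<in> U"
      let ?k = "lkp (x a0) t0 / lkp (x0 a0) t0"
      have "x + poly_scale (cst (- ?k)) x0 \<in> U" using insert.prems(1) x x0(1) by (intro lsubD)
      then have "x + poly_scale (cst (- ?k)) x0 \<in> U'" using x0 by (simp add: U'_def lookup_add poly_scale_def)
      then have "x + poly_scale (cst (- ?k)) x0 \<in> P" using S(3)[of P] P by blast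
      moreover have "poly_scale (cst ?k) x0 \<in> P" using P by (intro lsubD) auto
      ultimately have "(x + poly_scale (cst (- ?k)) x0) + poly_scale (cst ?k) x0 \<in> P" by (rule lsubD(2)[OF P(1)])
      moreover have "(x + poly_scale (cst (- ?k)) x0) + poly_scale (cst ?k) x0 = x"
        by (intro ext poly_mapping_eqI) (simp add: poly_scale_def lookup_add)
      ultimately show "x \<in> P" by simp
    qed
    then show ?thesis using S x0 by (intro exI[of _ "insert x0 S"]) (auto simp: U'_def)
  qed
qed

section \<open>Graded submodules and their generators\<close>

context koszul
begin

definition hom_vecs :: "nat list \<Rightarrow> nat \<Rightarrow> (nat \<Rightarrow> ('v, 'k::field) mpoly) set" where
  "hom_vecs E d = {x \<in> free_vecs (length E). \<forall>a t. lkp (x a) t \<noteq> 0 \<longrightarrow> mon_deg t + E ! a = d}"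

definition hom_part :: "nat list \<Rightarrow> nat \<Rightarrow> (nat \<Rightarrow> ('v, 'k::field) mpoly) \<Rightarrow> nat \<Rightarrow> ('v, 'k) mpoly" where
  "hom_part E d x a = polypart (\<lambda>t. mon_deg t + E ! a = d) (x a)"

definition gsub :: "nat list \<Rightarrow> (nat \<Rightarrow> ('v, 'k::field) mpoly) set \<Rightarrow> bool" where
  "gsub E N \<longleftrightarrow> N \<subseteq> free_vecs (length E) \<and> 0 \<in> N \<and> (\<forall>x\<in>N. \<forall>y\<in>N. x + y \<in> N) \<and>
     (\<forall>p\<in>polys V. \<forall>x\<in>N. poly_scale p x \<in> N) \<and> (\<forall>d. \<forall>x\<in>N. hom_part E d x \<in> N)"

lemma gsubD:
  assumes "gsub E N"
  shows "N \<subseteq> free_vecs (length E)" "0 \<in> N" "x \<in> N \<Longrightarrow> y \<in> N \<Longrightarrow> x + y \<in> N"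
    "p \<in> polys V \<Longrightarrow> x \<in> N \<Longrightarrow> poly_scale p x \<in> N" "x \<in> N \<Longrightarrow> hom_part E d x \<in> N"
  using assms by (auto simp: gsub_def)

lemma hom_part_hom_vecs: "x \<in> free_vecs (length E) \<Longrightarrow> hom_part E d x \<in> hom_vecs E d"
  by (auto simp: hom_vecs_def hom_part_def free_vecs_def split: if_splits)

lemma sum_hom_part:
  assumes "x \<in> free_vecs (length E)"
  shows "\<exists>K. x = (\<Sum>d\<le>K. hom_part E d x)"
proof -
  define S where "S = (\<Union>a<length E. (\<lambda>t. mon_deg t + E ! a) ` kys (x a))"
  \<comment> \<open>The largest degree that occurs; the inserted 0 covers the zero vector.\<close>
  define K where "K = Max (insert 0 S)"
  have fin: "finite (insert 0 S)" by (auto simp: S_def)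
  have "x = (\<Sum>d\<le>K. hom_part E d x)"
  proof (intro ext poly_mapping_eqI)
    fix a t
    have "lkp ((\<Sum>d\<le>K. hom_part E d x) a) t = (\<Sum>d\<le>K. if mon_deg t + E ! a = d then lkp (x a) t else 0)"
      by (simp add: sum_fun_apply lookup_sum hom_part_def)
    also have "\<dots> = (if mon_deg t + E ! a \<le> K then lkp (x a) t else 0)" by simp
    also have "\<dots> = lkp (x a) t"
    proof (cases "lkp (x a) t = 0")
      case False
      then have "a < length E" using assms by (auto simp: free_vecs_def not_less[symmetric])
      then have "mon_deg t + E ! a \<in> S" unfolding S_def using False by (intro UN_I[of a] image_eqI[OF refl]) (auto simp: in_keys_iff)
      then have "mon_deg t + E ! a \<in> insert 0 S" by (rule insertI2)
      then have "mon_deg t + E ! a \<le> K" unfolding K_def by (rule Max_ge[OF fin])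
      then show ?thesis by simp
    qed simp
    finally show "lkp (x a) t = lkp ((\<Sum>d\<le>K. hom_part E d x) a) t" by simp
  qed
  then show ?thesis ..
qed

text \<open>A generator is a pair of a degree and a vector. The degree does not enter the span, but
  it becomes the twist of the basis element that maps to the vector.\<close>

definition poly_span :: "(nat \<times> (nat \<Rightarrow> ('v, 'k::field) mpoly)) set \<Rightarrow> (nat \<Rightarrow> ('v, 'k) mpoly) set" where
  "poly_span S = {\<lambda>a. \<Sum>s\<in>S. p s * snd s a | p. \<forall>s. p s \<in> polys V}"

lemma poly_spanI: "(\<And>s. p s \<in> polys V) \<Longrightarrow> (\<And>a. x a = (\<Sum>s\<in>S. p s * snd s a)) \<Longrightarrow> x \<in> poly_span S"
  unfolding poly_span_def by (intro CollectI exI[of _ p]) auto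

lemma poly_span_ex: "x \<in> poly_span S \<Longrightarrow> \<exists>p. (\<forall>s. p s \<in> polys V) \<and> (\<forall>a. x a = (\<Sum>s\<in>S. p s * snd s a))"
  by (auto simp: poly_span_def)

lemma poly_span_0: "0 \<in> poly_span S"
  by (rule poly_spanI[of "\<lambda>_. 0"]) auto

lemma poly_span_add:
  assumes "x \<in> poly_span S" "y \<in> poly_span S" shows "x + y \<in> poly_span S"
proof -
  obtain p where p: "\<And>s. p s \<in> polys V" "\<And>a. x a = (\<Sum>s\<in>S. p s * snd s a)" using poly_span_ex[OF assms(1)] by blast
  obtain q where q: "\<And>s. q s \<in> polys V" "\<And>a. y a = (\<Sum>s\<in>S. q s * snd s a)" using poly_span_ex[OF assms(2)] by blast
  show ?thesis by (rule poly_spanI[of "\<lambda>s. p s + q s"]) (simp_all add: p q distrib_right sum.distrib)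
qed

lemma poly_span_poly_scale:
  assumes "x \<in> poly_span S" "r \<in> polys V" shows "poly_scale r x \<in> poly_span S"
proof -
  obtain p where p: "\<And>s. p s \<in> polys V" "\<And>a. x a = (\<Sum>s\<in>S. p s * snd s a)" using poly_span_ex[OF assms(1)] by blast
  show ?thesis
    by (rule poly_spanI[of "\<lambda>s. r * p s"]) (simp_all add: p assms(2) poly_scale_def sum_distrib_left mult.assoc)
qed

lemma poly_span_mem:
  assumes "finite S" "s \<in> S" shows "snd s \<in> poly_span S"
proof (rule poly_spanI[of "\<lambda>u. if u = s then 1 else 0"])
  fix a
  have "(\<Sum>u\<in>S. (if u = s then 1 else 0) * snd u a) = (\<Sum>u\<in>S. if u = s then snd s a else 0)"
    by (intro sum.cong) auto
  then show "snd s a = (\<Sum>u\<in>S. (if u = s then 1 else 0) * snd u a)" using assms by simp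
qed auto

lemma poly_span_sum: "(\<And>i. i \<in> T \<Longrightarrow> g i \<in> poly_span S) \<Longrightarrow> (\<Sum>i\<in>T. g i) \<in> poly_span S"
  by (induction T rule: infinite_finite_induct) (auto intro: poly_span_0 poly_span_add)

lemma poly_span_lsub: "lsub (poly_span S)"
  by (auto simp: lsub_def intro: poly_span_0 poly_span_add poly_span_poly_scale)

lemma poly_span_subset:
  assumes "gsub E N" "\<And>s. s \<in> S \<Longrightarrow> snd s \<in> N" shows "poly_span S \<subseteq> N"
proof
  fix x assume "x \<in> poly_span S"
  then obtain p where p: "\<And>s. p s \<in> polys V" "\<And>a. x a = (\<Sum>s\<in>S. p s * snd s a)" using poly_span_ex by blast
  have "(\<Sum>s\<in>T. poly_scale (p s) (snd s)) \<in> N" if "T \<subseteq> S" for T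
    using that by (induction T rule: infinite_finite_induct) (use gsubD[OF assms(1)] assms(2) p(1) in auto)
  from this[of S] have "(\<Sum>s\<in>S. poly_scale (p s) (snd s)) \<in> N" by simp
  moreover have "x = (\<Sum>s\<in>S. poly_scale (p s) (snd s))" by (rule ext) (simp add: p sum_fun_apply poly_scale_def)
  ultimately show "x \<in> N" by simp
qed

definition generates :: "nat list \<Rightarrow> (nat \<Rightarrow> ('v, 'k::field) mpoly) set \<Rightarrow> (nat \<times> (nat \<Rightarrow> ('v, 'k) mpoly)) set \<Rightarrow> bool" where
  "generates E N S \<longleftrightarrow> finite S \<and> (\<forall>s\<in>S. snd s \<in> N \<inter> hom_vecs E (fst s)) \<and> N \<subseteq> poly_span S"

lemma lsub_homogeneous: "gsub E N \<Longrightarrow> lsub (N \<inter> hom_vecs E d)"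
  unfolding lsub_def
proof (intro conjI ballI allI)
  assume N: "gsub E N"
  show "0 \<in> N \<inter> hom_vecs E d" using gsubD(2)[OF N] by (simp add: hom_vecs_def)
  fix x assume x: "x \<in> N \<inter> hom_vecs E d"
  show "x + y \<in> N \<inter> hom_vecs E d" if y: "y \<in> N \<inter> hom_vecs E d" for y
  proof -
    have "mon_deg t + E ! a = d" if "lkp ((x + y) a) t \<noteq> 0" for a t
    proof -
      have "lkp (x a) t \<noteq> 0 \<or> lkp (y a) t \<noteq> 0" using that by (auto simp: lookup_add)
      then show ?thesis using x y by (auto simp: hom_vecs_def)
    qed
    then show ?thesis using x y gsubD(3)[OF N] by (auto simp: hom_vecs_def intro: free_vecs_add)
  qed
  show "poly_scale (cst c) x \<in> N \<inter> hom_vecs E d" for c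
    using x gsubD(4)[OF N, of "cst c" x] by (auto simp: hom_vecs_def poly_scale_def intro: free_vecs_mult)
qed

text \<open>A graded Nakayama argument. Above degree \<open>m\<close> every homogeneous element is a
  combination of elements one degree lower, so spanning sets of the finite-dimensional pieces up to
  degree \<open>m\<close> generate \<open>N\<close>.\<close>

lemma finitely_generated:
  assumes N: "gsub E N"
    and dec: "\<And>d x. d > m \<Longrightarrow> x \<in> N \<inter> hom_vecs E d \<Longrightarrow>
      \<exists>n. (\<forall>v\<in>V. n v \<in> N \<inter> hom_vecs E (d - 1)) \<and> x = (\<Sum>v\<in>V. poly_scale (var v) (n v))"
  shows "\<exists>S. generates E N S"
proof -
  have "\<exists>S. finite S \<and> S \<subseteq> N \<inter> hom_vecs E d \<and> (\<forall>P. lsub P \<longrightarrow> S \<subseteq> P \<longrightarrow> N \<inter> hom_vecs E d \<subseteq> P)" for d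
  proof (rule finite_spanning_set)
    show "finite ({..<length E} \<times> mons V d)" using finite_mons[OF finV] by simp
    show "lsub (N \<inter> hom_vecs E d)" using N by (rule lsub_homogeneous)
    fix x assume x: "x \<in> N \<inter> hom_vecs E d" and z: "\<And>a t. (a, t) \<in> {..<length E} \<times> mons V d \<Longrightarrow> lkp (x a) t = 0"
    show "x = 0"
    proof (intro ext poly_mapping_eqI, rule ccontr)
      fix a t assume "lkp (x a) t \<noteq> lkp (0 a) t"
      then have nz: "lkp (x a) t \<noteq> 0" by simp
      then have "a < length E" "kys t \<subseteq> V" "mon_deg t + E ! a = d"
        using x by (auto simp: hom_vecs_def free_vecs_def in_polys_iff not_less[symmetric])
      then show False using z[of a t] nz by (simp add: mons_def)
    qed
  qed
  then obtain S where S: "\<And>d. finite (S d)" "\<And>d. S d \<subseteq> N \<inter> hom_vecs E d"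
      "\<And>d P. lsub P \<Longrightarrow> S d \<subseteq> P \<Longrightarrow> N \<inter> hom_vecs E d \<subseteq> P"
    by metis
  define T where "T = (\<Union>d\<le>m. Pair d ` S d)"
  have fin: "finite T" using S(1) by (simp add: T_def)
  have hom: "N \<inter> hom_vecs E d \<subseteq> poly_span T" for d
  proof (induction d rule: less_induct)
    case (less d)
    show ?case
    proof (cases "d \<le> m")
      case True
      have "snd (d, x) \<in> poly_span T" if "x \<in> S d" for x
        using that True by (intro poly_span_mem fin) (auto simp: T_def)
      then show ?thesis by (intro S(3) poly_span_lsub) auto
    next
      case False
      show ?thesis
      proof
        fix x assume "x \<in> N \<inter> hom_vecs E d"
        then obtain n where n: "\<And>v. v \<in> V \<Longrightarrow> n v \<in> N \<inter> hom_vecs E (d - 1)" "x = (\<Sum>v\<in>V. poly_scale (var v) (n v))"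
          using dec[of d x] False by auto
        have "n v \<in> poly_span T" if "v \<in> V" for v using less[of "d - 1"] n(1)[OF that] False by auto
        then show "x \<in> poly_span T" unfolding n(2) by (intro poly_span_sum poly_span_poly_scale) auto
      qed
    qed
  qed
  have "N \<subseteq> poly_span T"
  proof
    fix x assume x: "x \<in> N"
    then have xf: "x \<in> free_vecs (length E)" using gsubD(1)[OF N] by blast
    obtain K where K: "x = (\<Sum>d\<le>K. hom_part E d x)" using sum_hom_part[OF xf] ..
    have "hom_part E d x \<in> poly_span T" for d using hom[of d] gsubD(5)[OF N x, of d] hom_part_hom_vecs[OF xf, of d] by blast
    then have "(\<Sum>d\<le>K. hom_part E d x) \<in> poly_span T" by (intro poly_span_sum)
    then show "x \<in> poly_span T" using K by simp
  qed
  moreover have "\<forall>s\<in>T. snd s \<in> N \<inter> hom_vecs E (fst s)" using S(2) by (fastforce simp: T_def)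
  ultimately have "generates E N T" using fin by (simp add: generates_def)
  then show ?thesis ..
qed

text \<open>By homogeneity, a relation among the generators with a unit coefficient makes one of them redundant.\<close>

lemma generates_remove:
  assumes S: "generates E N S" and s0: "s0 \<in> S" and p: "\<And>s. p s \<in> polys V"
    and rel: "\<And>a. (\<Sum>s\<in>S. p s * snd s a) = 0" and c: "lkp (p s0) 0 \<noteq> 0"
  shows "generates E N (S - {s0})"
proof -
  have fin: "finite S" using S by (simp add: generates_def)
  \<comment> \<open>Only the component of the relation in the degree of \<open>s0\<close> is kept;
    in it the coefficient of \<open>s0\<close> is a nonzero scalar and can be inverted.\<close>
  define p' where "p' s = polypart (\<lambda>t. mon_deg t + fst s = fst s0) (p s)" for s
  have p'0: "p' s0 = cst (lkp (p s0) 0)"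
    by (rule poly_mapping_eqI) (auto simp: p'_def lookup_cst mon_deg_eq_0_iff)
  have sum0: "(\<Sum>s\<in>S. p' s * snd s a) = 0" for a
  proof -
    have "(\<Sum>s\<in>S. p' s * snd s a) = (\<Sum>s\<in>S. polypart (\<lambda>t. mon_deg t + E ! a = fst s0) (p s * snd s a))"
    proof (intro sum.cong refl)
      fix s assume "s \<in> S"
      then have "mon_deg t + E ! a = fst s" if "lkp (snd s a) t \<noteq> 0" for t
        using S that by (auto simp: generates_def hom_vecs_def)
      then show "p' s * snd s a = polypart (\<lambda>t. mon_deg t + E ! a = fst s0) (p s * snd s a)"
        unfolding p'_def by (rule polypart_mult_homogeneous[symmetric])
    qed
    then show ?thesis unfolding polypart_sum[symmetric] rel by simp
  qed
  define k where "k = lkp (p s0) 0"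
  have s0_poly_span: "snd s0 \<in> poly_span (S - {s0})"
  proof (rule poly_spanI[of "\<lambda>s. cst (- 1 / k) * p' s"])
    show "cst (- 1 / k) * p' s \<in> polys V" for s using p by (simp add: p'_def)
    fix a
    have "cst k * snd s0 a + (\<Sum>s\<in>S - {s0}. p' s * snd s a) = 0"
      using sum0[of a] sum.remove[OF fin s0, of "\<lambda>s. p' s * snd s a"] by (simp add: p'0 k_def)
    then have "(\<Sum>s\<in>S - {s0}. p' s * snd s a) = - (cst k * snd s0 a)"
      by (simp only: add_eq_0_iff)
    then have "cst (- 1 / k) * (\<Sum>s\<in>S - {s0}. p' s * snd s a) = cst (- 1 / k) * - (cst k * snd s0 a)"
      by (simp only:)
    also have "\<dots> = snd s0 a"
      by (rule poly_mapping_eqI) (use c in \<open>simp add: k_def\<close>)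
    finally show "snd s0 a = (\<Sum>s\<in>S - {s0}. cst (- 1 / k) * p' s * snd s a)"
      by (simp add: sum_distrib_left mult.assoc)
  qed
  have "N \<subseteq> poly_span (S - {s0})"
  proof
    fix x assume "x \<in> N"
    then have "x \<in> poly_span S" using S by (auto simp: generates_def)
    then obtain q where q: "\<And>s. q s \<in> polys V" "\<And>a. x a = (\<Sum>s\<in>S. q s * snd s a)" using poly_span_ex by blast
    have "(\<lambda>a. \<Sum>s\<in>S - {s0}. q s * snd s a) \<in> poly_span (S - {s0})" by (rule poly_spanI[OF q(1)]) simp
    then have "poly_scale (q s0) (snd s0) + (\<lambda>a. \<Sum>s\<in>S - {s0}. q s * snd s a) \<in> poly_span (S - {s0})"
      by (intro poly_span_add poly_span_poly_scale s0_poly_span q)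
    moreover have "x = poly_scale (q s0) (snd s0) + (\<lambda>a. \<Sum>s\<in>S - {s0}. q s * snd s a)"
      by (rule ext) (simp add: q poly_scale_def sum.remove[OF fin s0])
    ultimately show "x \<in> poly_span (S - {s0})" by simp
  qed
  then show ?thesis using S by (auto simp: generates_def)
qed

text \<open>The invariant of the construction: the Koszul homology of \<open>F / N\<close> vanishes in degrees above
  \<open>card V\<close>. In homological degree one it makes \<open>N\<close> finitely generated.\<close>

definition resolvable :: "nat list \<Rightarrow> (nat \<Rightarrow> ('v, 'k::field) mpoly) set \<Rightarrow> bool" where
  "resolvable E N \<longleftrightarrow> gsub E N \<and> (\<forall>x\<in>N. \<forall>a. lkp (x a) 0 = 0) \<and>
     (\<forall>q d. d > card V \<longrightarrow> cycles E N q d \<subseteq> boundaries E N q d)"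

text \<open>The first Koszul homology of \<open>F / N\<close> is \<open>N\<close> modulo the maximal
  ideal times \<open>N\<close>. Concretely, \<open>x = bd u\<close> by exactness over
  \<open>F\<close>; then \<open>u\<close> is a cycle modulo \<open>N\<close>, so it is
  \<open>n + bd y\<close> with values of \<open>n\<close> in \<open>N\<close>, and
  \<open>x = bd n\<close> is the required combination.\<close>

lemma resolvable_decompose:
  assumes R: "resolvable E N" and d: "d > card V" and x: "x \<in> N \<inter> hom_vecs E d"
  shows "\<exists>n. (\<forall>v\<in>V. n v \<in> N \<inter> hom_vecs E (d - 1)) \<and> x = (\<Sum>v\<in>V. poly_scale (var v) (n v))"
proof -
  have N: "gsub E N" using R by (simp add: resolvable_def)
  define z where "z F = (if F = {} then x else 0)" for F :: "'v set"
  have z: "z \<in> chain E 0 d"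
    using x by (intro chainI) (auto simp: z_def hom_vecs_def free_vecs_def in_polys_iff not_less[symmetric] split: if_splits)
  have "\<exists>u\<in>chain E (Suc 0) d. bd u = z"
    using x R by (intro koszul_exact z bd_chain_0[OF z]) (auto simp: z_def resolvable_def)
  then obtain u where u: "u \<in> chain E (Suc 0) d" "bd u = z" by blast
  have "z F \<in> N" for F using x gsubD(2)[OF N] by (simp add: z_def)
  then have "u \<in> cycles E N (Suc 0) d" using u by (simp add: cycles_def)
  moreover have "cycles E N (Suc 0) d \<subseteq> boundaries E N (Suc 0) d" using R d unfolding resolvable_def by blast
  ultimately have "u \<in> boundaries E N (Suc 0) d" by blast
  then obtain n y where n: "u = n + bd y" "n \<in> chain E (Suc 0) d" "\<And>F. n F \<in> N" "y \<in> chain E (Suc (Suc 0)) d"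
    by (auto simp: boundaries_def)
  have "bd n = z" using u(2) bd_bd[OF n(4)] by (simp add: n(1) bd_add)
  then have "x = bd n {}" by (simp add: z_def)
  also have "\<dots> = (\<Sum>v\<in>V. poly_scale (var v) (n {v}))"
    by (rule ext) (simp add: bd_def ep_def sum_fun_apply poly_scale_def)
  finally have "x = (\<Sum>v\<in>V. poly_scale (var v) (n {v}))" .
  \<comment> \<open>The exterior basis element of \<open>{v}\<close> has degree one, which accounts
    for \<open>d - 1\<close>.\<close>
  moreover have "n {v} \<in> hom_vecs E (d - 1)" for v
    using chain_free_vecs[OF n(2), of "{v}"] chainD(5)[OF n(2), of "{v}"] by (fastforce simp: hom_vecs_def)
  ultimately show ?thesis using n(3) by (intro exI[of _ "\<lambda>v. n {v}"]) auto
qed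

lemma ker_mat_gsub:
  assumes A: "graded_mat E E' A" shows "gsub E' (ker_mat E' A)"
  unfolding gsub_def
proof (intro conjI ballI allI)
  show "ker_mat E' A \<subseteq> free_vecs (length E')" by (auto simp: ker_mat_def)
  show "0 \<in> ker_mat E' A" by (simp add: ker_mat_def)
  fix x assume "x \<in> ker_mat E' A"
  then have x: "x \<in> free_vecs (length E')" "act A (length E') x = 0" by (auto simp: ker_mat_def)
  show "x + y \<in> ker_mat E' A" if "y \<in> ker_mat E' A" for y
    using x that by (auto simp: ker_mat_def act_add free_vecs_add)
  show "poly_scale p x \<in> ker_mat E' A" if "p \<in> polys V" for p
    using x that by (auto simp: ker_mat_def poly_scale_def free_vecs_mult act_mult)
  show "hom_part E' d x \<in> ker_mat E' A" for d
  proof -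
    have "act A (length E') (hom_part E' d x) a = 0" for a
    proof -
      have "act A (length E') (hom_part E' d x) a = (\<Sum>b<length E'. polypart (\<lambda>t. mon_deg t + E' ! b = d) (x b) * A a b)"
        by (simp add: act_def hom_part_def mult.commute)
      also have "\<dots> = (\<Sum>b<length E'. polypart (\<lambda>t. mon_deg t + E ! a = d) (x b * A a b))"
      proof (intro sum.cong refl)
        fix b
        have "mon_deg t + E ! a = E' ! b" if "lkp (A a b) t \<noteq> 0" for t
          using graded_matD(4)[OF A that] by simp
        then show "polypart (\<lambda>t. mon_deg t + E' ! b = d) (x b) * A a b = polypart (\<lambda>t. mon_deg t + E ! a = d) (x b * A a b)"
          by (rule polypart_mult_homogeneous[symmetric])
      qed
      also have "\<dots> = polypart (\<lambda>t. mon_deg t + E ! a = d) (act A (length E') x a)"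
        by (simp add: act_def polypart_sum mult.commute)
      finally show ?thesis by (simp add: x)
    qed
    then show ?thesis using hom_part_hom_vecs[OF x(1), of d] by (auto simp: ker_mat_def hom_vecs_def fun_eq_iff)
  qed
qed

text \<open>One step of the resolution: the columns of \<open>A\<close> are a generating set of
  \<open>N\<close> of least cardinality, and the syzygies inherit the invariant that makes them
  finitely generated in turn.\<close>

lemma resolvable_step:
  fixes N :: "(nat \<Rightarrow> ('v, 'k::field) mpoly) set"
  assumes R: "resolvable E N"
  shows "\<exists>E' A. graded_mat E E' A \<and> im_mat E' A = N \<and> resolvable E' (ker_mat E' A)"
proof -
  have N: "gsub E N" and N0: "\<And>x a. x \<in> N \<Longrightarrow> lkp (x a) 0 = 0" using R by (auto simp: resolvable_def)
  have "\<exists>S. generates E N S" using finitely_generated[OF N resolvable_decompose[OF R]] by blast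
  then obtain S where S: "generates E N S" and min: "\<And>S'. generates E N S' \<Longrightarrow> card S \<le> card S'"
    using exists_least_iff[of "\<lambda>k. \<exists>S. generates E N S \<and> card S = k"] by (metis not_le_imp_less)
  have fin: "finite S" using S by (simp add: generates_def)
  obtain L where L: "set L = S" "distinct L" using finite_distinct_list[OF fin] by blast
  define E' where "E' = map fst L"
  define A where "A a b = (if b < length L then snd (L ! b) a else 0)" for a b
  have len [simp]: "length E' = length L" by (simp add: E'_def)
  have mem: "L ! b \<in> S" if "b < length L" for b using that L by auto
  have bij: "bij_betw (\<lambda>b. L ! b) {..<length L} S" using bij_betw_nth[OF L(2) refl L(1)[symmetric]] .
  have A: "graded_mat E E' A"
    unfolding graded_mat_def
  proof (intro allI impI)
    fix a b t assume nz: "lkp (A a b) t \<noteq> 0"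
    have b: "b < length L" using nz by (auto simp: A_def split: if_splits)
    have nz': "lkp (snd (L ! b) a) t \<noteq> 0" using nz b by (simp add: A_def)
    have h: "snd (L ! b) \<in> N" "snd (L ! b) \<in> hom_vecs E (fst (L ! b))" using S mem[OF b] by (auto simp: generates_def)
    then have "kys t \<subseteq> V" "mon_deg t + E ! a = fst (L ! b)" "a < length E"
      using nz' by (auto simp: hom_vecs_def free_vecs_def in_polys_iff not_less[symmetric])
    moreover have "t \<noteq> 0" using N0[OF h(1), of a] nz' by auto
    ultimately show "a < length E \<and> b < length E' \<and> kys t \<subseteq> V \<and> E ! a + mon_deg t = E' ! b \<and> t \<noteq> 0"
      using b by (simp add: E'_def)
  qed
  have act_eq: "act A (length L) (\<lambda>b. if b < length L then p (L ! b) else 0) a = (\<Sum>s\<in>S. p s * snd s a)" for p a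
  proof -
    have "act A (length L) (\<lambda>b. if b < length L then p (L ! b) else 0) a = (\<Sum>b<length L. p (L ! b) * snd (L ! b) a)"
      by (simp add: act_def A_def mult.commute)
    also have "\<dots> = (\<Sum>s\<in>S. p s * snd s a)" using sum.reindex_bij_betw[OF bij, of "\<lambda>s. p s * snd s a"] by simp
    finally show ?thesis .
  qed
  \<comment> \<open>Since \<open>L\<close> is distinct, a vector indexed by positions in
    \<open>L\<close> is the same as a coefficient function on \<open>S\<close>.\<close>
  have list_fun: "\<exists>p. (\<forall>s. p s \<in> polys V) \<and> x = (\<lambda>b. if b < length L then p (L ! b) else 0)"
    if x: "x \<in> free_vecs (length L)" for x :: "nat \<Rightarrow> ('v, 'k) mpoly"
  proof -
    let ?p = "\<lambda>s. x (the_inv_into {..<length L} (\<lambda>b. L ! b) s)"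
    have "x b = (if b < length L then ?p (L ! b) else 0)" for b
      using x the_inv_into_f_f[OF bij_betw_imp_inj_on[OF bij], of b] by (simp add: free_vecs_def)
    then show ?thesis using x by (intro exI[of _ ?p]) (auto simp: free_vecs_def)
  qed
  have im_mat: "im_mat E' A = N"
  proof (intro equalityI subsetI)
    fix y assume "y \<in> im_mat E' A"
    then obtain x where x: "x \<in> free_vecs (length L)" "y = act A (length L) x" by (auto simp: im_mat_def)
    obtain p where p: "\<forall>s. p s \<in> polys V" "x = (\<lambda>b. if b < length L then p (L ! b) else 0)"
      using list_fun[OF x(1)] by blast
    have "y \<in> poly_span S"
    proof (rule poly_spanI[of p])
      show "p s \<in> polys V" for s using p(1) by (rule spec)
      show "y a = (\<Sum>s\<in>S. p s * snd s a)" for a unfolding x(2) p(2) by (rule act_eq)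
    qed
    then show "y \<in> N" using poly_span_subset[OF N, of S] S by (auto simp: generates_def)
  next
    fix y assume "y \<in> N"
    then have "y \<in> poly_span S" using S by (auto simp: generates_def)
    then obtain p where p: "\<And>s. p s \<in> polys V" "\<And>a. y a = (\<Sum>s\<in>S. p s * snd s a)" using poly_span_ex by blast
    have "y = act A (length L) (\<lambda>b. if b < length L then p (L ! b) else 0)" by (rule ext) (simp add: act_eq p)
    moreover have "(\<lambda>b. if b < length L then p (L ! b) else 0) \<in> free_vecs (length L)" using p by (auto simp: free_vecs_def)
    ultimately show "y \<in> im_mat E' A" unfolding im_mat_def len by (rule image_eqI)
  qed
  \<comment> \<open>A syzygy with a constant term at \<open>b\<close> is a relation with a unit
    coefficient; \<open>generates_remove\<close> would then give a smaller generating set.\<close>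
  have const: "lkp (x b) 0 = 0" if xk: "x \<in> ker_mat E' A" for x b
  proof (rule ccontr)
    assume nz: "lkp (x b) 0 \<noteq> 0"
    have x: "x \<in> free_vecs (length L)" "act A (length L) x = 0" using xk by (auto simp: ker_mat_def)
    have b: "b < length L" using x(1) nz by (auto simp: free_vecs_def not_less[symmetric])
    obtain p where p: "\<forall>s. p s \<in> polys V" "x = (\<lambda>b. if b < length L then p (L ! b) else 0)"
      using list_fun[OF x(1)] by blast
    have "(\<Sum>s\<in>S. p s * snd s a) = 0" for a using x(2) unfolding p(2) act_eq[symmetric] by simp
    then have "generates E N (S - {L ! b})"
      using generates_remove[OF S mem[OF b], of p] p nz b by simp
    then have "card S \<le> card (S - {L ! b})" by (rule min)
    then show False using fin mem[OF b] by (metis card_Diff1_less not_le)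
  qed
  \<comment> \<open>Exterior degree \<open>q\<close> over the kernel corresponds to
    \<open>Suc q\<close> over \<open>N\<close>, while the total degree \<open>d\<close> is
    unchanged; so the bound \<open>card V\<close> survives every step.\<close>
  have "cycles E' (ker_mat E' A) q d \<subseteq> boundaries E' (ker_mat E' A) q d" if "d > card V" for q d
    using lequiv_subset_iff[OF dimension_shift[OF A, of q d]] R that by (simp add: resolvable_def im_mat)
  then have "resolvable E' (ker_mat E' A)"
    using ker_mat_gsub[OF A] const by (simp add: resolvable_def)
  then show ?thesis using A im_mat by blast
qed

theorem resolution_exists:
  fixes N :: "(nat \<Rightarrow> ('v, 'k::field) mpoly) set"
  assumes "resolvable [0] N"
  shows "\<exists>D A. is_res D A \<and> im_mat (D 1) (A 0) = N"
proof -
  \<comment> \<open>The clause for \<open>n = 0\<close> fixes the start; \<open>resolvable\<close>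
    is what permits the next choice.\<close>
  define P where "P n x \<longleftrightarrow> resolvable (fst x) (snd x) \<and> (n = 0 \<longrightarrow> x = ([0], N))"
    for n :: nat and x :: "nat list \<times> (nat \<Rightarrow> ('v, 'k) mpoly) set"
  define Q where "Q x y \<longleftrightarrow> (\<exists>A. graded_mat (fst x) (fst y) A \<and> im_mat (fst y) A = snd x \<and> snd y = ker_mat (fst y) A)"
    for x y :: "nat list \<times> (nat \<Rightarrow> ('v, 'k) mpoly) set"
  have "\<exists>g. \<forall>n. P n (g n) \<and> Q (g n) (g (Suc n))"
  proof (rule dependent_nat_choice)
    show "\<exists>x. P 0 x" using assms by (auto simp: P_def)
    fix x n assume "P n x"
    then have "resolvable (fst x) (snd x)" by (simp add: P_def)
    then obtain E' A where "graded_mat (fst x) E' A" "im_mat E' A = snd x" "resolvable E' (ker_mat E' A)"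
      using resolvable_step by blast
    then show "\<exists>y. P (Suc n) y \<and> Q x y"
      by (intro exI[of _ "(E', ker_mat E' A)"]) (auto simp: P_def Q_def)
  qed
  then obtain g where g: "\<And>n. P n (g n)" "\<And>n. Q (g n) (g (Suc n))" by blast
  then obtain A where A: "\<And>n. graded_mat (fst (g n)) (fst (g (Suc n))) (A n)"
      "\<And>n. im_mat (fst (g (Suc n))) (A n) = snd (g n)" "\<And>n. snd (g (Suc n)) = ker_mat (fst (g (Suc n))) (A n)"
    unfolding Q_def by metis
  have g0: "g 0 = ([0], N)" using g(1)[of 0] by (simp add: P_def)
  have "is_res (\<lambda>n. fst (g n)) A" using A g0 by (simp add: is_res_def)
  moreover have "im_mat (fst (g 1)) (A 0) = N" using A(2)[of 0] g0 by simp
  ultimately show ?thesis by blast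
qed

end

section \<open>Edge ideals and a Hochster formula\<close>

definition indep :: "'v sgraph \<Rightarrow> 'v set \<Rightarrow> bool" where
  "indep G s \<longleftrightarrow> \<not> (\<exists>e\<in>edges G. e \<subseteq> s)"

lemma indep_mono: "indep G s \<Longrightarrow> r \<subseteq> s \<Longrightarrow> indep G r"
  by (auto simp: indep_def)

lemma ideal_gen_add:
  assumes "p \<in> ideal_gen V B" "q \<in> ideal_gen V B" shows "p + q \<in> ideal_gen V B"
proof -
  obtain S c where S: "p = (\<Sum>b\<in>S. c b * b)" "finite S" "S \<subseteq> B" "\<forall>b\<in>S. c b \<in> polys V"
    using assms(1) by (auto simp: ideal_gen_def)
  obtain T d where T: "q = (\<Sum>b\<in>T. d b * b)" "finite T" "T \<subseteq> B" "\<forall>b\<in>T. d b \<in> polys V"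
    using assms(2) by (auto simp: ideal_gen_def)
  define c' where "c' b = (if b \<in> S then c b else 0)" for b
  define d' where "d' b = (if b \<in> T then d b else 0)" for b
  have "p = (\<Sum>b\<in>S \<union> T. c' b * b)"
    unfolding S(1) using S T by (intro sum.mono_neutral_cong_left) (auto simp: c'_def)
  moreover have "q = (\<Sum>b\<in>S \<union> T. d' b * b)"
    unfolding T(1) using S T by (intro sum.mono_neutral_cong_left) (auto simp: d'_def)
  ultimately have "p + q = (\<Sum>b\<in>S \<union> T. (c' b + d' b) * b)"
    by (simp add: distrib_right sum.distrib)
  moreover have "\<forall>b\<in>S \<union> T. c' b + d' b \<in> polys V" using S(4) T(4) by (auto simp: c'_def d'_def)
  ultimately show ?thesis
    unfolding ideal_gen_def using S(2,3) T(2,3)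
    by (intro CollectI exI[of _ "S \<union> T"] exI[of _ "\<lambda>b. c' b + d' b"]) auto
qed

lemma ideal_gen_0: "0 \<in> ideal_gen V B"
  unfolding ideal_gen_def by (intro CollectI exI[of _ "{}"]) auto

lemma ideal_gen_sum: "(\<And>i. i \<in> T \<Longrightarrow> g i \<in> ideal_gen V B) \<Longrightarrow> (\<Sum>i\<in>T. g i) \<in> ideal_gen V B"
  by (induction T rule: infinite_finite_induct) (auto intro: ideal_gen_0 ideal_gen_add)

lemma ideal_gen_mem: "b \<in> B \<Longrightarrow> c \<in> polys V \<Longrightarrow> c * b \<in> ideal_gen V B"
  unfolding ideal_gen_def by (intro CollectI exI[of _ "{b}"] exI[of _ "\<lambda>_. c"]) auto

text \<open>A monomial ideal is tested monomial by monomial, and a monomial lies in it if and only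
  if its support contains an edge.\<close>

lemma edge_ideal_iff:
  fixes p :: "('v, 'k::field) mpoly"
  assumes G: "finite_simple_graph G"
  shows "p \<in> edge_ideal G \<longleftrightarrow> p \<in> polys (verts G) \<and> (\<forall>t. lkp p t \<noteq> 0 \<longrightarrow> \<not> indep G (kys t))"
proof
  assume "p \<in> edge_ideal G"
  then obtain S c where S: "p = (\<Sum>b\<in>S. c b * b)" "finite S" "S \<subseteq> {var u * var v | u v. {u, v} \<in> edges G}"
      "\<forall>b\<in>S. c b \<in> polys (verts G)"
    by (auto simp: edge_ideal_def ideal_gen_def)
  have b: "b \<in> polys (verts G)" "lkp b s \<noteq> 0 \<Longrightarrow> \<not> indep G (kys s)" if bS: "b \<in> S" for b s
  proof -
    obtain u v where uv: "b = var u * var v" "{u, v} \<in> edges G" using S(3) bS by blast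
    then have "{u, v} \<subseteq> verts G" using G by (auto simp: finite_simple_graph_def)
    then show "b \<in> polys (verts G)" by (simp add: uv)
    assume "lkp b s \<noteq> 0"
    then have "s = sng u 1 + sng v 1" by (simp add: uv var_def mult_single lookup_single when_def split: if_splits)
    then have "{u, v} \<subseteq> kys s" by (simp add: keys_add_nat)
    then show "\<not> indep G (kys s)" using uv(2) unfolding indep_def by blast
  qed
  have "\<not> indep G (kys t)" if nz: "lkp p t \<noteq> 0" for t
  proof -
    obtain b where bS: "b \<in> S" "lkp (c b * b) t \<noteq> 0"
      using nz unfolding S(1) lookup_sum by (rule sum.not_neutral_contains_not_neutral)
    obtain r s where rs: "t = r + s" "lkp b s \<noteq> 0" using bS(2) by (rule keys_multE)
    show ?thesis using b(2)[OF bS(1) rs(2)] indep_mono[of G "kys t" "kys s"] by (auto simp: rs(1) keys_add_nat)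
  qed
  moreover have "p \<in> polys (verts G)" unfolding S(1) using S(4) b(1) by (intro polys_sum polys_mult) auto
  ultimately show "p \<in> polys (verts G) \<and> (\<forall>t. lkp p t \<noteq> 0 \<longrightarrow> \<not> indep G (kys t))" by blast
next
  assume p: "p \<in> polys (verts G) \<and> (\<forall>t. lkp p t \<noteq> 0 \<longrightarrow> \<not> indep G (kys t))"
  have "(\<Sum>t\<in>kys p. sng t (lkp p t)) \<in> edge_ideal G"
    unfolding edge_ideal_def
  proof (rule ideal_gen_sum)
    fix t assume "t \<in> kys p"
    then have t: "kys t \<subseteq> verts G" "\<not> indep G (kys t)" using p by (auto simp: in_polys_iff in_keys_iff)
    then obtain e where e: "e \<in> edges G" "e \<subseteq> kys t" by (auto simp: indep_def)
    then have "card e = 2" using G by (auto simp: finite_simple_graph_def)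
    then obtain u v where uv: "e = {u, v}" "u \<noteq> v" by (auto simp: card_2_iff)
    \<comment> \<open>The endpoints are distinct, so exponents of at least one suffice for
      \<open>var u * var v\<close> to divide the monomial.\<close>
    have le: "sng u 1 + sng v 1 + (t - (sng u 1 + sng v 1)) = t"
    proof (rule poly_mapping_eqI)
      fix x
      show "lkp (sng u 1 + sng v 1 + (t - (sng u 1 + sng v 1))) x = lkp t x"
        using e uv by (auto simp: lookup_add lookup_minus lookup_single when_def in_keys_iff)
    qed
    have "sng t (lkp p t) = sng (t - (sng u 1 + sng v 1)) (lkp p t) * (var u * var v)"
      using le by (simp add: var_def mult_single add.commute)
    also have "\<dots> \<in> ideal_gen (verts G) {var u * var v | u v. {u, v} \<in> edges G}"
    proof (rule ideal_gen_mem)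
      show "var u * var v \<in> {var u * var v | u v. {u, v} \<in> edges G}" using e uv by auto
      show "sng (t - (sng u 1 + sng v 1)) (lkp p t) \<in> polys (verts G)"
        using t(1) keys_diff_subset[of t "sng u 1 + sng v 1"]
        by (auto simp: in_polys_iff lookup_single when_def split: if_splits)
    qed
    finally show "sng t (lkp p t) \<in> ideal_gen (verts G) {var u * var v | u v. {u, v} \<in> edges G}" .
  qed
  then show "p \<in> edge_ideal G" using poly_mapping_sum_single[of p] by simp
qed

text \<open>Nonvanishing homology of a quotient of the simplex on \<open>W\<close>; \<open>I\<close>
  marks the faces that survive. In the applications these have coefficient monomials outside the
  ideal and are closed under adding vertices, so values of \<open>g\<close> elsewhere never enter.
  \<open>Suc (card F) = q\<close> imposes nothing for \<open>q = 0\<close>.\<close>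

definition nontrivial :: "'k::field itself \<Rightarrow> ('v \<Rightarrow> nat) \<Rightarrow> 'v set \<Rightarrow> ('v set \<Rightarrow> bool) \<Rightarrow> nat \<Rightarrow> bool" where
  "nontrivial K f W I q \<longleftrightarrow> (\<exists>g :: 'v set \<Rightarrow> 'k.
     (\<forall>F. F \<subseteq> W \<longrightarrow> I F \<longrightarrow> Suc (card F) = q \<longrightarrow> simplex_bd f W g F = 0) \<and>
     \<not> (\<exists>y. \<forall>F. F \<subseteq> W \<longrightarrow> I F \<longrightarrow> card F = q \<longrightarrow> g F = simplex_bd f W y F))"

definition coboundary :: "('v \<Rightarrow> nat) \<Rightarrow> ('v set \<Rightarrow> 'k) \<Rightarrow> 'v set \<Rightarrow> 'k::comm_ring_1" where
  "coboundary f c s = (\<Sum>v\<in>s. ep f v (s - {v}) * c (s - {v}))"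

text \<open>\<open>nonzero_cohomology K f G W j\<close> says that the reduced cohomology in degree \<open>j - 1\<close> of the independence complex
  of the subgraph induced on \<open>W\<close>, with coefficients in \<open>K\<close>, is nonzero. The values of cochains on sets
  that are not faces never matter.\<close>

definition nonzero_cohomology :: "'k::field itself \<Rightarrow> ('v \<Rightarrow> nat) \<Rightarrow> 'v sgraph \<Rightarrow> 'v set \<Rightarrow> nat \<Rightarrow> bool" where
  "nonzero_cohomology K f G W j \<longleftrightarrow> (\<exists>c :: 'v set \<Rightarrow> 'k.
     (\<forall>s. s \<subseteq> W \<longrightarrow> indep G s \<longrightarrow> card s = Suc j \<longrightarrow> coboundary f c s = 0) \<and>
     \<not> (\<exists>y. \<forall>s. s \<subseteq> W \<longrightarrow> indep G s \<longrightarrow> card s = j \<longrightarrow> c s = coboundary f y s))"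

text \<open>The cone homotopy descends to the quotient as soon as deleting the apex from a surviving
  face leaves a surviving face.\<close>

lemma nontrivial_cone:
  assumes W: "finite W" "inj_on f W" "w \<in> W"
    and I: "\<And>F. F \<subseteq> W \<Longrightarrow> I F \<Longrightarrow> w \<in> F \<Longrightarrow> I (F - {w})"
  shows "\<not> nontrivial (K :: 'k::field itself) f W I q"
proof
  assume "nontrivial K f W I q"
  then obtain g :: "'a set \<Rightarrow> 'k" where g: "\<And>F. F \<subseteq> W \<Longrightarrow> I F \<Longrightarrow> Suc (card F) = q \<Longrightarrow> simplex_bd f W g F = 0"
      "\<not> (\<exists>y. \<forall>F. F \<subseteq> W \<longrightarrow> I F \<longrightarrow> card F = q \<longrightarrow> g F = simplex_bd f W y F)"
    unfolding nontrivial_def by blast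
  have "g F = simplex_bd f W (simplex_homotopy f w g) F" if F: "F \<subseteq> W" "I F" "card F = q" for F
  proof -
    have "simplex_homotopy f w (simplex_bd f W g) F = 0"
    proof (cases "w \<in> F")
      case True
      have "finite F" using F W finite_subset by blast
      then have "Suc (card (F - {w})) = q" using F(3) True by (metis card_Suc_Diff1)
      then have "simplex_bd f W g (F - {w}) = 0" using F I True by (intro g(1)) auto
      then show ?thesis by (simp add: simplex_homotopy_def)
    qed (simp add: simplex_homotopy_def)
    then show ?thesis using simplex_bd_simplex_homotopy[OF W F(1), of g] by simp
  qed
  then show False using g(2) by blast
qed

lemma ep_Diff_insert: "ep f v (s - {v}) = ep f v s"
proof -
  have "{u\<in>s - {v}. f u < f v} = {u\<in>s. f u < f v}" by auto
  then show ?thesis by (simp add: ep_def)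
qed

lemma ep_split:
  assumes "finite W" "s \<subseteq> W"
  shows "ep f v (W - s) = (ep f v W * ep f v (s - {v}) :: 'k::comm_ring_1)"
proof -
  have "{u\<in>W. f u < f v} = {u\<in>W - s. f u < f v} \<union> {u\<in>s. f u < f v}" using assms by auto
  then have "card {u\<in>W. f u < f v} = card {u\<in>W - s. f u < f v} + card {u\<in>s. f u < f v}"
    using assms by (subst card_Un_disjoint[symmetric]) (auto intro: finite_subset)
  then have "ep f v W = (ep f v (W - s) * ep f v s :: 'k)" by (simp add: ep_def power_add)
  then show ?thesis by (simp add: ep_Diff_insert mult.assoc)
qed

text \<open>Passing to complements in \<open>W\<close> turns the boundary of the full simplex into the coboundary,
  up to the sign \<open>\<Prod>v\<in>s. ep f v W\<close>.\<close>

lemma coboundary_complement: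
  fixes g :: "'v set \<Rightarrow> 'k::comm_ring_1"
  assumes W: "finite W" "s \<subseteq> W"
  shows "coboundary f (\<lambda>s. (\<Prod>v\<in>s. ep f v W) * g (W - s)) s = (\<Prod>v\<in>s. ep f v W) * simplex_bd f W g (W - s)"
proof -
  have fin: "finite s" using W by (auto intro: finite_subset)
  have "(\<Prod>v\<in>s. ep f v W) * simplex_bd f W g (W - s) = (\<Sum>v\<in>s. (\<Prod>v\<in>s. ep f v W) * (ep f v (W - s) * g (insert v (W - s))))"
    using W by (simp add: simplex_bd_def sum_distrib_left double_diff)
  also have "\<dots> = (\<Sum>v\<in>s. ep f v (s - {v}) * ((\<Prod>v\<in>s - {v}. ep f v W) * g (W - (s - {v}))))"
  proof (intro sum.cong refl)
    fix v assume v: "v \<in> s"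
    have "insert v (W - s) = W - (s - {v})" using v W by auto
    then show "(\<Prod>v\<in>s. ep f v W) * (ep f v (W - s) * g (insert v (W - s))) =
        ep f v (s - {v}) * ((\<Prod>v\<in>s - {v}. ep f v W) * g (W - (s - {v})))"
      using prod.remove[OF fin v, of "\<lambda>v. ep f v W :: 'k"] ep_split[OF W, of f v, where 'k = 'k]
      by (simp add: mult_ac)
  qed
  finally show ?thesis by (simp add: coboundary_def)
qed

lemma prod_ep_square: "(\<Prod>v\<in>s. ep f v W) * ((\<Prod>v\<in>s. ep f v W) * x) = (x :: 'k::comm_ring_1)"
  unfolding mult.assoc[symmetric] prod.distrib[symmetric] by simp

text \<open>Complementation exchanges faces of size \<open>q\<close> with sets of size
  \<open>j\<close>. \<open>T\<close> and \<open>U\<close> transport cochains with the sign of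
  \<open>coboundary_complement\<close>; the sign squares to one, so both directions lose
  nothing.\<close>

lemma nontrivial_iff_nonzero_cohomology:
  fixes K :: "'k::field itself"
  assumes W: "finite W" "card W = q + j"
  shows "nontrivial K f W (\<lambda>F. indep G (W - F)) q \<longleftrightarrow> nonzero_cohomology K f G W j"
proof -
  let ?s = "\<lambda>s. \<Prod>v\<in>s. ep f v W :: 'k"
  define T where "T g s = ?s s * g (W - s)" for g :: "'a set \<Rightarrow> 'k" and s
  define U where "U c F = ?s (W - F) * c (W - F)" for c :: "'a set \<Rightarrow> 'k" and F
  have TU: "T (U c) s = c s" if "s \<subseteq> W" for c s
    using that by (simp add: T_def U_def double_diff prod_ep_square)
  have cbdT: "coboundary f (T g) s = ?s s * simplex_bd f W g (W - s)" if "s \<subseteq> W" for g s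
    unfolding T_def using coboundary_complement[OF W(1) that] .
  have coboundary_cong: "coboundary f c s = coboundary f (T (U c)) s" if "s \<subseteq> W" for c s
    unfolding coboundary_def using that by (intro sum.cong refl) (subst TU, auto)
  have unit: "?s s * x = 0 \<longleftrightarrow> x = 0" "?s s * x = ?s s * y \<longleftrightarrow> x = y" for s x y
    by (metis prod_ep_square mult_zero_right) (metis prod_ep_square)
  have card: "card (W - s) = q \<longleftrightarrow> card s = j" "Suc (card (W - s)) = q \<longleftrightarrow> card s = Suc j" if "s \<subseteq> W" for s
  proof -
    have "card (W - s) + card s = q + j"
      using W that card_mono[OF W(1) that] finite_subset[OF that W(1)] by (simp add: card_Diff_subset)
    then show "card (W - s) = q \<longleftrightarrow> card s = j" "Suc (card (W - s)) = q \<longleftrightarrow> card s = Suc j" by auto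
  qed
  have cycles: "(\<forall>F. F \<subseteq> W \<longrightarrow> indep G (W - F) \<longrightarrow> Suc (card F) = q \<longrightarrow> simplex_bd f W g F = 0) \<longleftrightarrow>
      (\<forall>s. s \<subseteq> W \<longrightarrow> indep G s \<longrightarrow> card s = Suc j \<longrightarrow> coboundary f (T g) s = 0)" (is "?L \<longleftrightarrow> ?R") for g
  proof
    assume L: ?L
    show ?R
    proof (intro allI impI)
      fix s assume s: "s \<subseteq> W" "indep G s" "card s = Suc j"
      then have "simplex_bd f W g (W - s) = 0"
        using L[rule_format, of "W - s"] card(2)[OF s(1)] by (simp add: double_diff)
      then show "coboundary f (T g) s = 0" using s by (simp add: cbdT)
    qed
  next
    assume R: ?R
    show ?L
    proof (intro allI impI)
      fix F assume F: "F \<subseteq> W" "indep G (W - F)" "Suc (card F) = q"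
      then have "card (W - F) = Suc j" using card(2)[of "W - F"] by (simp add: double_diff)
      then have "coboundary f (T g) (W - F) = 0" using R F by auto
      then show "simplex_bd f W g F = 0" using F cbdT[of "W - F" g] unit(1) by (simp add: double_diff)
    qed
  qed
  have boundaries: "(\<forall>F. F \<subseteq> W \<longrightarrow> indep G (W - F) \<longrightarrow> card F = q \<longrightarrow> g F = simplex_bd f W y F) \<longleftrightarrow>
      (\<forall>s. s \<subseteq> W \<longrightarrow> indep G s \<longrightarrow> card s = j \<longrightarrow> T g s = coboundary f (T y) s)" (is "?L \<longleftrightarrow> ?R") for g y
  proof
    assume L: ?L
    show ?R
    proof (intro allI impI)
      fix s assume s: "s \<subseteq> W" "indep G s" "card s = j"
      then have "g (W - s) = simplex_bd f W y (W - s)"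
        using L[rule_format, of "W - s"] card(1)[OF s(1)] by (simp add: double_diff)
      then show "T g s = coboundary f (T y) s" using s by (simp add: cbdT T_def)
    qed
  next
    assume R: ?R
    show ?L
    proof (intro allI impI)
      fix F assume F: "F \<subseteq> W" "indep G (W - F)" "card F = q"
      then have "card (W - F) = j" using card(1)[of "W - F"] by (simp add: double_diff)
      then have "T g (W - F) = coboundary f (T y) (W - F)" using R F by auto
      then have "?s (W - F) * g F = ?s (W - F) * simplex_bd f W y F"
        using F cbdT[of "W - F" y] by (simp add: T_def double_diff)
      then show "g F = simplex_bd f W y F" using unit(2) by blast
    qed
  qed
  show ?thesis
  proof
    assume "nontrivial K f W (\<lambda>F. indep G (W - F)) q"
    then obtain g :: "'a set \<Rightarrow> 'k" where
      g: "\<forall>F. F \<subseteq> W \<longrightarrow> indep G (W - F) \<longrightarrow> Suc (card F) = q \<longrightarrow> simplex_bd f W g F = 0"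
        "\<not> (\<exists>y. \<forall>F. F \<subseteq> W \<longrightarrow> indep G (W - F) \<longrightarrow> card F = q \<longrightarrow> g F = simplex_bd f W y F)"
      unfolding nontrivial_def by blast
    have "\<not> (\<exists>y. \<forall>s. s \<subseteq> W \<longrightarrow> indep G s \<longrightarrow> card s = j \<longrightarrow> T g s = coboundary f y s)"
    proof
      assume "\<exists>y. \<forall>s. s \<subseteq> W \<longrightarrow> indep G s \<longrightarrow> card s = j \<longrightarrow> T g s = coboundary f y s"
      then obtain y where "\<forall>s. s \<subseteq> W \<longrightarrow> indep G s \<longrightarrow> card s = j \<longrightarrow> T g s = coboundary f y s" by blast
      then have "\<forall>s. s \<subseteq> W \<longrightarrow> indep G s \<longrightarrow> card s = j \<longrightarrow> T g s = coboundary f (T (U y)) s"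
        using coboundary_cong[of _ y] by simp
      then show False using g(2) boundaries[of g "U y"] by blast
    qed
    then show "nonzero_cohomology K f G W j" unfolding nonzero_cohomology_def using g(1) cycles by blast
  next
    assume "nonzero_cohomology K f G W j"
    then obtain c :: "'a set \<Rightarrow> 'k" where
      c: "\<forall>s. s \<subseteq> W \<longrightarrow> indep G s \<longrightarrow> card s = Suc j \<longrightarrow> coboundary f c s = 0"
        "\<not> (\<exists>y. \<forall>s. s \<subseteq> W \<longrightarrow> indep G s \<longrightarrow> card s = j \<longrightarrow> c s = coboundary f y s)"
      unfolding nonzero_cohomology_def by blast
    have "\<forall>s. s \<subseteq> W \<longrightarrow> indep G s \<longrightarrow> card s = Suc j \<longrightarrow> coboundary f (T (U c)) s = 0"
      using c(1) coboundary_cong[of _ c] by simp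
    moreover have "\<not> (\<exists>y. \<forall>F. F \<subseteq> W \<longrightarrow> indep G (W - F) \<longrightarrow> card F = q \<longrightarrow> U c F = simplex_bd f W y F)"
    proof
      assume "\<exists>y. \<forall>F. F \<subseteq> W \<longrightarrow> indep G (W - F) \<longrightarrow> card F = q \<longrightarrow> U c F = simplex_bd f W y F"
      then obtain y where "\<forall>F. F \<subseteq> W \<longrightarrow> indep G (W - F) \<longrightarrow> card F = q \<longrightarrow> U c F = simplex_bd f W y F" by blast
      then have "\<forall>s. s \<subseteq> W \<longrightarrow> indep G s \<longrightarrow> card s = j \<longrightarrow> c s = coboundary f (T y) s"
        unfolding boundaries by (simp add: TU)
      then show False using c(2) by blast
    qed
    ultimately show "nontrivial K f W (\<lambda>F. indep G (W - F)) q" unfolding nontrivial_def using cycles[of "U c"] by blast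
  qed
qed

section \<open>Hochster's formula for edge ideals\<close>

locale graph_koszul = koszul "verts G" f for G :: "'v sgraph" and f :: "'v \<Rightarrow> nat" +
  assumes graph: "finite_simple_graph G"
begin

lemma edge_vecI:
  assumes "n \<in> chain [0] q d" "\<And>t. lkp (n F 0) t \<noteq> 0 \<Longrightarrow> \<not> indep G (kys t)"
  shows "n F \<in> ivec (edge_ideal G)"
  unfolding ivec_def mem_Collect_eq edge_ideal_iff[OF graph]
  using chain_free_vecs[OF assms(1), of F] assms(2) by (auto simp: free_vecs_def Suc_le_eq)

lemma edge_vecD: "x \<in> ivec (edge_ideal G) \<Longrightarrow> indep G (kys t) \<Longrightarrow> lkp (x 0) t = 0"
  unfolding ivec_def mem_Collect_eq edge_ideal_iff[OF graph] by blast

lemma edge_vec_0: "0 \<in> ivec (edge_ideal G)"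
  unfolding ivec_def mem_Collect_eq edge_ideal_iff[OF graph] by simp

text \<open>Both the differential and the ideal respect multidegrees, so a cycle modulo the ideal
  bounds if and only if each of its multigraded components does.\<close>

lemma cycles_subset_boundaries_iff_multidegree:
  fixes K :: "'k::field itself"
  shows "cycles [0] (ivec (edge_ideal G)) q d \<subseteq> (boundaries [0] (ivec (edge_ideal G)) q d :: ('v, 'k) chain set) \<longleftrightarrow>
    (\<forall>b. kys b \<subseteq> verts G \<longrightarrow> mon_deg b = d \<longrightarrow> \<not> nontrivial K f (kys b) (\<lambda>F. indep G (kys (b - ind F))) q)"
proof (intro iffI allI impI subsetI notI)
  fix b assume sub: "cycles [0] (ivec (edge_ideal G)) q d \<subseteq> (boundaries [0] (ivec (edge_ideal G)) q d :: ('v, 'k) chain set)"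
    and b: "kys b \<subseteq> verts G" "mon_deg b = d" and nt: "nontrivial K f (kys b) (\<lambda>F. indep G (kys (b - ind F))) q"
  obtain g :: "'v set \<Rightarrow> 'k" where
    g: "\<And>F. F \<subseteq> kys b \<Longrightarrow> indep G (kys (b - ind F)) \<Longrightarrow> Suc (card F) = q \<Longrightarrow> simplex_bd f (kys b) g F = 0"
      "\<not> (\<exists>y. \<forall>F. F \<subseteq> kys b \<longrightarrow> indep G (kys (b - ind F)) \<longrightarrow> card F = q \<longrightarrow> g F = simplex_bd f (kys b) y F)"
    using nt unfolding nontrivial_def by blast
  \<comment> \<open>A class in the single multidegree \<open>b\<close>, extended by zero to all
    others.\<close>
  define gg where "gg = (\<lambda>(a::nat) b' F. if b' = b then g F else 0)"
  define z where "z = mkc [0] q d gg"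
  have z: "z \<in> chain [0] q d" unfolding z_def by (rule mkc_chain)
  have coord_z: "coord z 0 b' F = gg 0 b' F" if "kys b' \<subseteq> verts G" "mon_deg b' = d" "F \<subseteq> kys b'" "card F = q" for b' F
    unfolding z_def using that by (intro coord_mkc) auto
  have "bd z F \<in> ivec (edge_ideal G)" for F
  proof (cases q)
    case 0
    then have "bd z = 0" using z bd_chain_0 by blast
    then show ?thesis using edge_vec_0 by (simp add: zero_fun_def)
  next
    case (Suc q')
    have bz: "bd z \<in> chain [0] q' d" using z Suc by (intro bd_chain) simp
    show ?thesis
    proof (rule edge_vecI[OF bz], rule notI)
      fix t assume nz: "lkp (bd z F 0) t \<noteq> 0" and ind: "indep G (kys t)"
      note D = chainD[OF bz nz]
      have fin: "finite F" using D(1) finV by (rule finite_subset)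
      define b' where "b' = t + ind F"
      have b': "kys b' \<subseteq> verts G" "mon_deg b' = d" "F \<subseteq> kys b'" "b' - ind F = t"
        using D fin by (auto simp: b'_def keys_add_nat keys_ind mon_deg_ind)
      have "lkp (bd z F 0) t = coord (bd z) 0 b' F" unfolding b'_def by (rule lookup_eq_coord[OF fin])
      also have "\<dots> = simplex_bd f (kys b') (coord z 0 b') F" using b' by (intro coord_bd)
      also have "\<dots> = (\<Sum>v\<in>kys b' - F. ep f v F * gg 0 b' (insert v F))"
        unfolding simplex_bd_def
      proof (intro sum.cong refl)
        fix v assume v: "v \<in> kys b' - F"
        have "card (insert v F) = q" "insert v F \<subseteq> kys b'" using v fin D(2) Suc b'(3) by auto
        then show "ep f v F * coord z 0 b' (insert v F) = ep f v F * gg 0 b' (insert v F)"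
          using coord_z[OF b'(1,2)] by simp
      qed
      also have "\<dots> = 0"
      proof (cases "b' = b")
        case True
        then have "simplex_bd f (kys b) g F = 0" using b' ind D(2) Suc by (intro g(1)) auto
        then show ?thesis using True by (simp add: gg_def simplex_bd_def)
      qed (simp add: gg_def)
      finally show False using nz by simp
    qed
  qed
  then have "z \<in> cycles [0] (ivec (edge_ideal G)) q d" using z by (simp add: cycles_def)
  then have "z \<in> boundaries [0] (ivec (edge_ideal G)) q d" using sub by blast
  then obtain n y where n: "z = n + bd y" "n \<in> chain [0] q d" "\<And>F. n F \<in> ivec (edge_ideal G)"
    by (auto simp: boundaries_def)
  have "g F = simplex_bd f (kys b) (coord y 0 b) F" if F: "F \<subseteq> kys b" "indep G (kys (b - ind F))" "card F = q" for F
  proof -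
    have "g F = coord z 0 b F" using coord_z[OF b F(1,3)] by (simp add: gg_def)
    also have "\<dots> = coord n 0 b F + coord (bd y) 0 b F" by (simp add: n(1) coord_add)
    also have "coord n 0 b F = 0" using edge_vecD[OF n(3) F(2)] by (simp add: coord_def)
    also have "coord (bd y) 0 b F = simplex_bd f (kys b) (coord y 0 b) F" using b F by (intro coord_bd)
    finally show ?thesis by simp
  qed
  then show False using g(2) by blast
next
  fix z :: "('v, 'k) chain"
  assume triv: "\<forall>b. kys b \<subseteq> verts G \<longrightarrow> mon_deg b = d \<longrightarrow> \<not> nontrivial K f (kys b) (\<lambda>F. indep G (kys (b - ind F))) q"
    and zc: "z \<in> cycles [0] (ivec (edge_ideal G)) q d"
  have z: "z \<in> chain [0] q d" "\<And>F. bd z F \<in> ivec (edge_ideal G)" using zc by (auto simp: cycles_def)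
  have "\<exists>y. \<forall>F. F \<subseteq> kys b \<longrightarrow> indep G (kys (b - ind F)) \<longrightarrow> card F = q \<longrightarrow> coord z 0 b F = simplex_bd f (kys b) y F"
    if b: "kys b \<subseteq> verts G" "mon_deg b = d" for b
  proof -
    have "simplex_bd f (kys b) (coord z 0 b) F = 0" if F: "F \<subseteq> kys b" "indep G (kys (b - ind F))" for F
    proof -
      have "simplex_bd f (kys b) (coord z 0 b) F = coord (bd z) 0 b F" using b F by (intro coord_bd[symmetric])
      then show ?thesis using edge_vecD[OF z(2) F(2)] by (simp add: coord_def)
    qed
    then show ?thesis using triv b unfolding nontrivial_def by blast
  qed
  \<comment> \<open>One bounding cochain is chosen for each multidegree; \<open>mkc\<close> glues
    them into a chain.\<close>
  then obtain yy where yy: "\<And>b F. kys b \<subseteq> verts G \<Longrightarrow> mon_deg b = d \<Longrightarrow> F \<subseteq> kys b \<Longrightarrow>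
      indep G (kys (b - ind F)) \<Longrightarrow> card F = q \<Longrightarrow> coord z 0 b F = simplex_bd f (kys b) (yy b) F"
    by metis
  define y where "y = mkc [0] (Suc q) d (\<lambda>a. yy)"
  have y: "y \<in> chain [0] (Suc q) d" unfolding y_def by (rule mkc_chain)
  have n: "z - bd y \<in> chain [0] q d" by (intro chain_diff z bd_chain y)
  have "(z - bd y) F \<in> ivec (edge_ideal G)" for F
  proof (rule edge_vecI[OF n], rule notI)
    fix t assume nz: "lkp ((z - bd y) F 0) t \<noteq> 0" and ind: "indep G (kys t)"
    note D = chainD[OF n nz]
    have fin: "finite F" using D(1) finV by (rule finite_subset)
    define b where "b = t + ind F"
    have b: "kys b \<subseteq> verts G" "mon_deg b = d" "F \<subseteq> kys b" "b - ind F = t"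
      using D fin by (auto simp: b_def keys_add_nat keys_ind mon_deg_ind)
    have "coord (bd y) 0 b F = simplex_bd f (kys b) (coord y 0 b) F" using b by (intro coord_bd)
    also have "\<dots> = simplex_bd f (kys b) (yy b) F"
      unfolding simplex_bd_def
    proof (intro sum.cong refl)
      fix v assume v: "v \<in> kys b - F"
      have "coord y 0 b (insert v F) = yy b (insert v F)"
        unfolding y_def using v fin D(2) b by (intro coord_mkc) auto
      then show "ep f v F * coord y 0 b (insert v F) = ep f v F * yy b (insert v F)" by simp
    qed
    also have "\<dots> = coord z 0 b F" using b ind D(2) by (intro yy[symmetric]) auto
    finally have "coord (z - bd y) 0 b F = 0" by (simp add: coord_diff)
    then show False using nz lookup_eq_coord[OF fin, of "z - bd y" 0 t] by (simp add: b_def)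
  qed
  moreover have "z = (z - bd y) + bd y" by simp
  ultimately show "z \<in> boundaries [0] (ivec (edge_ideal G)) q d" unfolding boundaries_def using n y by blast
qed

text \<open>If \<open>w\<close> has exponent at least two in \<open>b\<close>, it stays in the
  support of \<open>b - ind F\<close> whether or not \<open>F\<close> contains it. Deleting
  \<open>w\<close> from \<open>F\<close> thus preserves survival, and \<open>nontrivial_cone\<close>
  applies. The remaining multidegrees are the monomials \<open>ind W\<close>.\<close>

lemma cycles_subset_boundaries_iff:
  fixes K :: "'k::field itself"
  shows "cycles [0] (ivec (edge_ideal G)) q d \<subseteq> (boundaries [0] (ivec (edge_ideal G)) q d :: ('v, 'k) chain set) \<longleftrightarrow>
    (\<forall>W. W \<subseteq> verts G \<longrightarrow> card W = d \<longrightarrow> \<not> nontrivial K f W (\<lambda>F. indep G (W - F)) q)"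
  unfolding cycles_subset_boundaries_iff_multidegree[of q d K]
proof (intro iffI allI impI)
  have key: "kys (ind W) = W" "mon_deg (ind W) = card W"
    "nontrivial K f W (\<lambda>F. indep G (kys (ind W - ind F))) q = nontrivial K f W (\<lambda>F. indep G (W - F)) q"
    if W: "W \<subseteq> verts G" for W
  proof -
    have fin: "finite W" using W finV by (rule finite_subset)
    then show "kys (ind W) = W" "mon_deg (ind W) = card W" by (simp_all add: keys_ind mon_deg_ind)
    have "kys (ind W - ind F) = W - F" if "F \<subseteq> W" for F
      using fin finite_subset[OF that fin] that
      by (auto simp: in_keys_iff lookup_minus lookup_ind split: if_splits)
    then show "nontrivial K f W (\<lambda>F. indep G (kys (ind W - ind F))) q = nontrivial K f W (\<lambda>F. indep G (W - F)) q"
      unfolding nontrivial_def by (simp cong: imp_cong)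
  qed
  {
    fix W assume "\<forall>b. kys b \<subseteq> verts G \<longrightarrow> mon_deg b = d \<longrightarrow> \<not> nontrivial K f (kys b) (\<lambda>F. indep G (kys (b - ind F))) q"
      and W: "W \<subseteq> verts G" "card W = d"
    then show "\<not> nontrivial K f W (\<lambda>F. indep G (W - F)) q" using key[OF W(1)] by metis
  }
  fix b assume triv: "\<forall>W. W \<subseteq> verts G \<longrightarrow> card W = d \<longrightarrow> \<not> nontrivial K f W (\<lambda>F. indep G (W - F)) q"
    and b: "kys b \<subseteq> verts G" "mon_deg b = d"
  show "\<not> nontrivial K f (kys b) (\<lambda>F. indep G (kys (b - ind F))) q"
  proof (cases "\<exists>w. 2 \<le> lkp b w")
    case True
    then obtain w where w: "2 \<le> lkp b w" by blast
    show ?thesis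
    proof (rule nontrivial_cone)
      show "w \<in> kys b" using w by (simp add: in_keys_iff)
      fix F assume F: "F \<subseteq> kys b" "indep G (kys (b - ind F))" "w \<in> F"
      have fin: "finite F" using F(1) finite_keys by (rule finite_subset)
      then have "kys (b - ind (F - {w})) = kys (b - ind F)"
        using w by (auto simp: in_keys_iff lookup_minus lookup_ind split: if_splits)
      then show "indep G (kys (b - ind (F - {w})))" using F by simp
    qed (use injf b in \<open>auto intro: inj_on_subset\<close>)
  next
    case False
    then have "lkp b v = (if v \<in> kys b then 1 else 0)" for v
      by (auto simp: in_keys_iff not_le) (metis less_2_cases_iff not_less_eq numeral_2_eq_2 One_nat_def neq0_conv)
    then have "b = ind (kys b)" by (intro poly_mapping_eqI) (simp add: lookup_ind)
    then show ?thesis using triv b key[OF b(1)] by metis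
  qed
qed

text \<open>Vanishing above \<open>card V\<close> is immediate from the squarefree description: no
  vertex set has more than \<open>card V\<close> elements.\<close>

lemma edge_ideal_resolvable: "resolvable [0] (ivec (edge_ideal G) :: (nat \<Rightarrow> ('v, 'k::field) mpoly) set)"
  unfolding resolvable_def
proof (intro conjI allI impI ballI)
  show "gsub [0] (ivec (edge_ideal G) :: (nat \<Rightarrow> ('v, 'k) mpoly) set)"
    unfolding gsub_def
  proof (intro conjI ballI allI)
    show "ivec (edge_ideal G) \<subseteq> (free_vecs (length [0::nat]) :: (nat \<Rightarrow> ('v, 'k) mpoly) set)"
    proof
      fix x :: "nat \<Rightarrow> ('v, 'k) mpoly" assume x: "x \<in> ivec (edge_ideal G)"
      have "x a \<in> polys (verts G)" for a
        using x unfolding ivec_def mem_Collect_eq edge_ideal_iff[OF graph] by (cases "a = 0") auto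
      then show "x \<in> free_vecs (length [0::nat])" using x by (auto simp: free_vecs_def ivec_def)
    qed
    show "0 \<in> ivec (edge_ideal G)" by (rule edge_vec_0)
    fix x :: "nat \<Rightarrow> ('v, 'k) mpoly" assume "x \<in> ivec (edge_ideal G)"
    then have x: "x 0 \<in> polys (verts G)" "\<And>t. lkp (x 0) t \<noteq> 0 \<Longrightarrow> \<not> indep G (kys t)" "\<And>a. a > 0 \<Longrightarrow> x a = 0"
      unfolding ivec_def mem_Collect_eq edge_ideal_iff[OF graph] by auto
    show "x + y \<in> ivec (edge_ideal G)" if "y \<in> ivec (edge_ideal G)" for y
    proof -
      have y: "y 0 \<in> polys (verts G)" "\<And>t. lkp (y 0) t \<noteq> 0 \<Longrightarrow> \<not> indep G (kys t)" "\<And>a. a > 0 \<Longrightarrow> y a = 0"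
        using that unfolding ivec_def mem_Collect_eq edge_ideal_iff[OF graph] by auto
      have "\<not> indep G (kys t)" if nz: "lkp (x 0) t + lkp (y 0) t \<noteq> 0" for t
      proof -
        have "lkp (x 0) t \<noteq> 0 \<or> lkp (y 0) t \<noteq> 0" using nz by auto
        then show ?thesis using x(2) y(2) by blast
      qed
      then show ?thesis
        unfolding ivec_def mem_Collect_eq edge_ideal_iff[OF graph] using x y by (auto simp: lookup_add)
    qed
    show "poly_scale p x \<in> ivec (edge_ideal G)" if p: "p \<in> polys (verts G)" for p
    proof -
      have "\<not> indep G (kys t)" if nz: "lkp (p * x 0) t \<noteq> 0" for t
      proof -
        obtain r s where rs: "t = r + s" "lkp (x 0) s \<noteq> 0" using nz by (rule keys_multE)
        show ?thesis using x(2)[OF rs(2)] indep_mono[of G "kys t" "kys s"] by (auto simp: rs(1) keys_add_nat)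
      qed
      then show ?thesis
        unfolding ivec_def mem_Collect_eq edge_ideal_iff[OF graph] using x p by (auto simp: poly_scale_def)
    qed
    show "hom_part [0] d x \<in> ivec (edge_ideal G)" for d
      unfolding ivec_def mem_Collect_eq edge_ideal_iff[OF graph] using x by (auto simp: hom_part_def split: if_splits)
  qed
  fix x :: "nat \<Rightarrow> ('v, 'k) mpoly" and a assume x: "x \<in> ivec (edge_ideal G)"
  have "\<not> e \<subseteq> {}" if "e \<in> edges G" for e using that graph by (auto simp: finite_simple_graph_def)
  then have "indep G (kys (0 :: 'v \<Rightarrow>\<^sub>0 nat))" by (auto simp: indep_def)
  then have "lkp (x 0) 0 = 0" by (rule edge_vecD[OF x])
  then show "lkp (x a) 0 = 0" using x by (cases "a = 0") (auto simp: ivec_def)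
next
  fix q d assume d: "d > card (verts G)"
  then have "card W \<noteq> d" if "W \<subseteq> verts G" for W using card_mono[OF finV that] by simp
  then show "cycles [0] (ivec (edge_ideal G)) q d \<subseteq> (boundaries [0] (ivec (edge_ideal G)) q d :: ('v, 'k) chain set)"
    unfolding cycles_subset_boundaries_iff[of q d "TYPE('k)"] by blast
qed

theorem betti_edge_ideal_nonzero_iff:
  "betti (verts G) (edge_ideal G :: ('v, 'k::field) mpoly set) q (q + j) \<noteq> 0 \<longleftrightarrow>
    (\<exists>W. W \<subseteq> verts G \<and> card W = q + j \<and> nonzero_cohomology TYPE('k) f G W j)"
proof -
  obtain D and A :: "nat \<Rightarrow> nat \<Rightarrow> nat \<Rightarrow> ('v, 'k) mpoly" where
    res: "is_res D A" "im_mat (D 1) (A 0) = ivec (edge_ideal G)"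
    using resolution_exists[OF edge_ideal_resolvable] by blast
  have "betti (verts G) (edge_ideal G :: ('v, 'k) mpoly set) q (q + j) \<noteq> 0 \<longleftrightarrow>
      (\<exists>W. W \<subseteq> verts G \<and> card W = q + j \<and> nontrivial TYPE('k) f W (\<lambda>F. indep G (W - F)) q)"
    unfolding betti_nonzero_iff[OF res] cycles_subset_boundaries_iff[of q "q + j" "TYPE('k)"] by blast
  also have "\<dots> \<longleftrightarrow> (\<exists>W. W \<subseteq> verts G \<and> card W = q + j \<and> nonzero_cohomology TYPE('k) f G W j)"
  proof (intro ex_cong1 conj_cong refl)
    fix W assume "W \<subseteq> verts G" "card W = q + j"
    then show "nontrivial TYPE('k) f W (\<lambda>F. indep G (W - F)) q = nonzero_cohomology TYPE('k) f G W j"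
      using finite_subset[OF _ finV] by (intro nontrivial_iff_nonzero_cohomology)
  qed
  finally show ?thesis .
qed

end

section \<open>Strands of a join\<close>

lemma nonzero_cohomology_card_le:
  assumes "finite W" "nonzero_cohomology K f G W j" shows "j \<le> card W"
proof (rule ccontr)
  assume "\<not> j \<le> card W"
  then have "card s \<noteq> j" if "s \<subseteq> W" for s using card_mono[OF assms(1) that] by auto
  then show False using assms(2) unfolding nonzero_cohomology_def by blast
qed

lemma indep_singleton:
  assumes "finite_simple_graph G" shows "indep G {v}"
  unfolding indep_def
proof
  assume "\<exists>e\<in>edges G. e \<subseteq> {v}"
  then obtain e where e: "e \<in> edges G" "e \<subseteq> {v}" by blast
  then have "card e = 2" using assms by (auto simp: finite_simple_graph_def)
  then show False using card_mono[OF _ e(2)] by simp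
qed

text \<open>At a vertex \<open>v\<close> of \<open>W\<close> the cocycle condition says that the
  value on the empty face is zero.\<close>

lemma nonzero_cohomology_0:
  assumes G: "finite_simple_graph G" and W: "finite W" and nc: "nonzero_cohomology (K :: 'k::field itself) f G W 0"
  shows "W = {}"
proof (rule ccontr)
  assume "W \<noteq> {}"
  then obtain v where v: "v \<in> W" by blast
  obtain c :: "'a set \<Rightarrow> 'k" where
    c: "\<And>s. s \<subseteq> W \<Longrightarrow> indep G s \<Longrightarrow> card s = Suc 0 \<Longrightarrow> coboundary f c s = 0"
      "\<not> (\<exists>y. \<forall>s. s \<subseteq> W \<longrightarrow> indep G s \<longrightarrow> card s = 0 \<longrightarrow> c s = coboundary f y s)"
    using nc unfolding nonzero_cohomology_def by blast
  have "c {} = 0" using c(1)[of "{v}"] v indep_singleton[OF G] by (simp add: coboundary_def ep_def)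
  moreover obtain s where s: "s \<subseteq> W" "card s = 0" "c s \<noteq> coboundary f (\<lambda>_. 0) s" using c(2) by blast
  moreover have "finite s" using s(1) W by (rule finite_subset)
  then have "s = {}" using s(2) by simp
  ultimately show False by (simp add: coboundary_def)
qed

lemma nonzero_cohomology_singleton: "\<not> nonzero_cohomology (K :: 'k::field itself) f G {v} 1"
proof
  assume "nonzero_cohomology K f G {v} 1"
  then obtain c :: "'a set \<Rightarrow> 'k" where
    "\<not> (\<exists>y. \<forall>s. s \<subseteq> {v} \<longrightarrow> indep G s \<longrightarrow> card s = 1 \<longrightarrow> c s = coboundary f y s)"
    unfolding nonzero_cohomology_def by blast
  moreover have "c s = coboundary f (\<lambda>_. c {v}) s" if "s \<subseteq> {v}" "card s = 1" for s
  proof -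
    have "s = {v}" using that by (auto simp: subset_singleton_iff)
    then show ?thesis by (simp add: coboundary_def ep_def)
  qed
  ultimately show False by blast
qed

lemma graph_join_commute: "graph_join G H = graph_join H G"
proof -
  have "{{x, y} | x y. x \<in> verts G \<and> y \<in> verts H} = {{x, y} | x y. x \<in> verts H \<and> y \<in> verts G}"
    by (auto simp: insert_commute)
  then show ?thesis unfolding graph_join_def by (simp only: Un_commute)
qed

lemma verts_join [simp]: "verts (graph_join G H) = verts G \<union> verts H"
  by (simp add: graph_join_def)

lemma edges_join: "edges (graph_join G H) = edges G \<union> edges H \<union> {{x, y} | x y. x \<in> verts G \<and> y \<in> verts H}"
  by (simp add: graph_join_def)

lemma finite_simple_graph_join:
  assumes "finite_simple_graph G" "finite_simple_graph H" "verts G \<inter> verts H = {}"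
  shows "finite_simple_graph (graph_join G H)"
proof -
  have "e \<subseteq> verts G \<union> verts H \<and> card e = 2" if "e \<in> edges (graph_join G H)" for e
  proof -
    consider "e \<in> edges G" | "e \<in> edges H" | x y where "e = {x, y}" "x \<in> verts G" "y \<in> verts H"
      using \<open>e \<in> edges (graph_join G H)\<close> unfolding edges_join by blast
    then show ?thesis
    proof cases
      case 3
      then have "x \<noteq> y" using assms(3) by blast
      then show ?thesis using 3 by simp
    qed (use assms in \<open>auto simp: finite_simple_graph_def\<close>)
  qed
  then show ?thesis using assms(1,2) by (simp add: finite_simple_graph_def)
qed

lemma graph_join_empty:
  assumes "finite_simple_graph G" "verts G = {}" shows "graph_join G H = H"
proof -
  have "edges G = {}"
  proof (rule ccontr)
    assume "edges G \<noteq> {}"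
    then obtain e where "e \<in> edges G" by blast
    then have "e \<subseteq> {}" "card e = 2" using assms unfolding finite_simple_graph_def by auto
    then show False by simp
  qed
  then show ?thesis using assms(2) by (simp add: graph_join_def)
qed

text \<open>One numbering \<open>f\<close> of all vertices makes the signs for \<open>G\<close>,
  \<open>H\<close> and their join agree.\<close>

locale graph_pair =
  fixes G H :: "'v sgraph" and f :: "'v \<Rightarrow> nat"
  assumes G: "finite_simple_graph G" and H: "finite_simple_graph H"
    and disj: "verts G \<inter> verts H = {}" and inj: "inj_on f (verts G \<union> verts H)"
begin

lemma graph_pair_swap: "graph_pair H G f"
  using G H disj inj by unfold_locales (auto simp: Un_commute)

lemma finG: "finite (verts G)" and finH: "finite (verts H)"
  using G H by (auto simp: finite_simple_graph_def)

lemma indep_join_G: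
  assumes "s \<subseteq> verts G" shows "indep (graph_join G H) s \<longleftrightarrow> indep G s"
proof -
  have "e \<in> edges G" if e: "e \<in> edges (graph_join G H)" "e \<subseteq> s" for e
  proof -
    consider "e \<in> edges G" | "e \<in> edges H" | x y where "e = {x, y}" "y \<in> verts H"
      using e(1) unfolding edges_join by blast
    then show ?thesis
    proof cases
      case 2
      then have "e \<subseteq> verts H" "card e = 2" using H by (auto simp: finite_simple_graph_def)
      moreover have "e \<subseteq> verts G" using e(2) assms by blast
      ultimately have "e = {}" using disj by blast
      then show ?thesis using \<open>card e = 2\<close> by simp
    next
      case 3
      then show ?thesis using e(2) assms disj by blast
    qed
  qed
  then show ?thesis unfolding indep_def edges_join by blast
qed

lemma indep_join_cases:
  assumes "s \<subseteq> verts G \<union> verts H" "indep (graph_join G H) s"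
  shows "s \<subseteq> verts G \<or> s \<subseteq> verts H"
proof (rule ccontr)
  assume "\<not> (s \<subseteq> verts G \<or> s \<subseteq> verts H)"
  then obtain x y where xy: "x \<in> s" "y \<in> s" "x \<in> verts G" "y \<in> verts H" using assms(1) by blast
  then have "{x, y} \<in> edges (graph_join G H)" unfolding edges_join by blast
  moreover have "{x, y} \<subseteq> s" using xy by simp
  ultimately have "\<not> indep (graph_join G H) s" unfolding indep_def not_not by (rule bexI[rotated])
  then show False using assms(2) by contradiction
qed

lemma not_subset_G: "s \<subseteq> verts H \<Longrightarrow> s \<noteq> {} \<Longrightarrow> \<not> s \<subseteq> verts G"
  using disj by blast

text \<open>Extension by zero to the faces in \<open>H\<close>. For \<open>j \<ge> 1\<close> a facet
  of a face with \<open>Suc j\<close> vertices is nonempty, so it cannot belong to both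
  sides.\<close>

lemma nonzero_cohomology_join_of_G:
  assumes W: "W \<subseteq> verts G \<union> verts H" and j: "j \<ge> 1" and nc: "nonzero_cohomology (K :: 'k::field itself) f G (W \<inter> verts G) j"
  shows "nonzero_cohomology K f (graph_join G H) W j"
proof -
  obtain c :: "'v set \<Rightarrow> 'k" where
    c: "\<And>s. s \<subseteq> W \<inter> verts G \<Longrightarrow> indep G s \<Longrightarrow> card s = Suc j \<Longrightarrow> coboundary f c s = 0"
      "\<not> (\<exists>y. \<forall>s. s \<subseteq> W \<inter> verts G \<longrightarrow> indep G s \<longrightarrow> card s = j \<longrightarrow> c s = coboundary f y s)"
    using nc unfolding nonzero_cohomology_def by blast
  define c' where "c' s = (if s \<subseteq> verts G then c s else 0)" for s
  have "coboundary f c' s = 0" if s: "s \<subseteq> W" "indep (graph_join G H) s" "card s = Suc j" for s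
  proof (cases "s \<subseteq> verts G")
    case True
    then have "coboundary f c' s = coboundary f c s" unfolding coboundary_def by (intro sum.cong) (auto simp: c'_def)
    then show ?thesis using c(1)[of s] s True indep_join_G by simp
  next
    case False
    then have sH: "s \<subseteq> verts H" using indep_join_cases[of s] s W by blast
    have "c' (s - {v}) = 0" if "v \<in> s" for v
    proof -
      have "card (s - {v}) \<noteq> 0" using s(3) that j by simp
      then have "s - {v} \<noteq> {}" by (metis card.empty)
      then show ?thesis using not_subset_G[of "s - {v}"] sH by (auto simp: c'_def)
    qed
    then show ?thesis by (simp add: coboundary_def)
  qed
  moreover have "\<not> (\<exists>y. \<forall>s. s \<subseteq> W \<longrightarrow> indep (graph_join G H) s \<longrightarrow> card s = j \<longrightarrow> c' s = coboundary f y s)"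
  proof
    assume "\<exists>y. \<forall>s. s \<subseteq> W \<longrightarrow> indep (graph_join G H) s \<longrightarrow> card s = j \<longrightarrow> c' s = coboundary f y s"
    then obtain y where y: "\<And>s. s \<subseteq> W \<Longrightarrow> indep (graph_join G H) s \<Longrightarrow> card s = j \<Longrightarrow> c' s = coboundary f y s" by blast
    have "c s = coboundary f y s" if "s \<subseteq> W \<inter> verts G" "indep G s" "card s = j" for s
      using y[of s] that indep_join_G[of s] by (simp add: c'_def)
    then show False using c(2) by blast
  qed
  ultimately show ?thesis unfolding nonzero_cohomology_def by blast
qed

text \<open>If the class vanished on both sides, the two primitives could be glued: they live on
  faces with \<open>j - 1\<close> vertices, which are nonempty for \<open>j \<ge> 2\<close> and so
  lie on one side only.\<close>

lemma nonzero_cohomology_join_cases: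
  assumes W: "W \<subseteq> verts G \<union> verts H" and j: "j \<ge> 2" and nc: "nonzero_cohomology (K :: 'k::field itself) f (graph_join G H) W j"
  shows "nonzero_cohomology K f G (W \<inter> verts G) j \<or> nonzero_cohomology K f H (W \<inter> verts H) j"
proof (rule ccontr)
  assume "\<not> ?thesis"
  then have nG: "\<not> nonzero_cohomology K f G (W \<inter> verts G) j" and nH: "\<not> nonzero_cohomology K f H (W \<inter> verts H) j" by auto
  obtain c :: "'v set \<Rightarrow> 'k" where
    c: "\<And>s. s \<subseteq> W \<Longrightarrow> indep (graph_join G H) s \<Longrightarrow> card s = Suc j \<Longrightarrow> coboundary f c s = 0"
      "\<not> (\<exists>y. \<forall>s. s \<subseteq> W \<longrightarrow> indep (graph_join G H) s \<longrightarrow> card s = j \<longrightarrow> c s = coboundary f y s)"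
    using nc unfolding nonzero_cohomology_def by blast
  have indep_H: "indep (graph_join G H) s \<longleftrightarrow> indep H s" if "s \<subseteq> verts H" for s
    using graph_pair.indep_join_G[OF graph_pair_swap that] by (simp add: graph_join_commute)
  have "coboundary f c s = 0" if "s \<subseteq> W \<inter> verts G" "indep G s" "card s = Suc j" for s
    using c(1)[of s] that indep_join_G[of s] by simp
  then obtain y1 where y1: "\<And>s. s \<subseteq> W \<inter> verts G \<Longrightarrow> indep G s \<Longrightarrow> card s = j \<Longrightarrow> c s = coboundary f y1 s"
    using nG unfolding nonzero_cohomology_def by blast
  have "coboundary f c s = 0" if "s \<subseteq> W \<inter> verts H" "indep H s" "card s = Suc j" for s
    using c(1)[of s] that indep_H[of s] by simp
  then obtain y2 where y2: "\<And>s. s \<subseteq> W \<inter> verts H \<Longrightarrow> indep H s \<Longrightarrow> card s = j \<Longrightarrow> c s = coboundary f y2 s"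
    using nH unfolding nonzero_cohomology_def by blast
  define y where "y s = (if s \<subseteq> verts G then y1 s else y2 s)" for s
  have "c s = coboundary f y s" if s: "s \<subseteq> W" "indep (graph_join G H) s" "card s = j" for s
  proof (cases "s \<subseteq> verts G")
    case True
    then have "coboundary f y s = coboundary f y1 s" unfolding coboundary_def by (intro sum.cong) (auto simp: y_def)
    then show ?thesis using y1[of s] s True indep_join_G[of s] by simp
  next
    case False
    then have sH: "s \<subseteq> verts H" using indep_join_cases[of s] s W by blast
    have "y (s - {v}) = y2 (s - {v})" if "v \<in> s" for v
    proof -
      have "card (s - {v}) \<noteq> 0" using s(3) that j by simp
      then have "s - {v} \<noteq> {}" by (metis card.empty)
      then show ?thesis using not_subset_G[of "s - {v}"] sH by (auto simp: y_def)
    qed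
    then have "coboundary f y s = coboundary f y2 s" unfolding coboundary_def by (intro sum.cong) auto
    then show ?thesis using y2[of s] s sH indep_H[of s] by simp
  qed
  then show False using c(2) by blast
qed

text \<open>The indicator of the side \<open>G\<close> is constant along every edge of the
  independence complex, but not on all vertices of \<open>W\<close>.\<close>

lemma nonzero_cohomology_join_1:
  assumes W: "W \<subseteq> verts G \<union> verts H" "W \<inter> verts G \<noteq> {}" "W \<inter> verts H \<noteq> {}"
  shows "nonzero_cohomology (K :: 'k::field itself) f (graph_join G H) W 1"
proof -
  define c :: "'v set \<Rightarrow> 'k" where "c s = (if s \<subseteq> verts G then 1 else 0)" for s
  have J: "finite_simple_graph (graph_join G H)" using G H disj by (rule finite_simple_graph_join)
  have "coboundary f c s = 0" if s: "s \<subseteq> W" "indep (graph_join G H) s" "card s = Suc 1" for s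
  proof -
    have "card s = 2" using s(3) by simp
    then obtain a b where ab: "s = {a, b}" "a \<noteq> b" unfolding card_2_iff by blast
    have "s \<subseteq> verts G \<or> s \<subseteq> verts H" using indep_join_cases[of s] s W by blast
    then have eq: "c {a} = c {b}" using ab disj by (auto simp: c_def)
    have "f a \<noteq> f b" using inj s(1) W(1) ab by (auto dest: inj_onD)
    have "coboundary f c s = ep f a {b} * c {b} + ep f b {a} * c {a}"
      using ab by (simp add: coboundary_def insert_Diff_if)
    also have "ep f a {b} = - (ep f b {a} :: 'k)"
      using ep_insert[of "{}" b f a, where 'r = 'k] ep_insert[of "{}" a f b, where 'r = 'k] \<open>f a \<noteq> f b\<close>
      by (auto simp: ep_def)
    finally show ?thesis by (simp add: eq)
  qed
  moreover have "\<not> (\<exists>y. \<forall>s. s \<subseteq> W \<longrightarrow> indep (graph_join G H) s \<longrightarrow> card s = 1 \<longrightarrow> c s = coboundary f y s)"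
  proof
    assume "\<exists>y. \<forall>s. s \<subseteq> W \<longrightarrow> indep (graph_join G H) s \<longrightarrow> card s = 1 \<longrightarrow> c s = coboundary f y s"
    then obtain y where y: "\<And>s. s \<subseteq> W \<Longrightarrow> indep (graph_join G H) s \<Longrightarrow> card s = 1 \<Longrightarrow> c s = coboundary f y s" by blast
    have "c {v} = y {}" if "v \<in> W" for v
      using y[of "{v}"] that indep_singleton[OF J] by (simp add: coboundary_def ep_def)
    moreover obtain u v where "u \<in> W" "u \<in> verts G" "v \<in> W" "v \<in> verts H" using W by blast
    moreover have "v \<notin> verts G" using \<open>v \<in> verts H\<close> disj by blast
    ultimately have "c {u} = c {v}" "c {u} = 1" "c {v} = 0" by (simp, simp_all add: c_def)
    then show False by simp
  qed
  ultimately show ?thesis unfolding nonzero_cohomology_def by blast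
qed

end

section \<open>Connectedness of the strands\<close>

text \<open>Intervals without \<open>Min\<close> and \<open>Max\<close>; the empty set is
  included.\<close>

definition order_convex :: "nat set \<Rightarrow> bool" where
  "order_convex S \<longleftrightarrow> (\<forall>a\<in>S. \<forall>c\<in>S. \<forall>b. a \<le> b \<longrightarrow> b \<le> c \<longrightarrow> b \<in> S)"

lemma order_convexD: "order_convex S \<Longrightarrow> a \<in> S \<Longrightarrow> c \<in> S \<Longrightarrow> a \<le> b \<Longrightarrow> b \<le> c \<Longrightarrow> b \<in> S"
  unfolding order_convex_def by blast

lemma convex_sumset:
  assumes S: "order_convex S" and a: "s \<in> S" "s \<le> b" and c: "s' \<in> S" "b \<le> s' + n"
  shows "\<exists>k\<le>n. \<exists>s\<in>S. b = s + k"
proof (cases "b \<le> s + n")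
  case True
  then show ?thesis using a by (intro exI[of _ "b - s"] conjI bexI[of _ s]) auto
next
  case False
  show ?thesis
  proof (cases "b \<le> s'")
    case True
    then have "b \<in> S" using order_convexD[OF S a(1) c(1)] a(2) by blast
    then show ?thesis by (intro exI[of _ 0]) auto
  next
    case False
    then show ?thesis using c by (intro exI[of _ "b - s'"] conjI bexI[of _ s']) auto
  qed
qed

text \<open>Each sumset is convex by \<open>convex_sumset\<close>, and the bounds exclude a gap
  between them: for \<open>x\<close> in \<open>S\<close> and \<open>x'\<close> in \<open>T\<close>,
  \<open>x' \<le> n \<le> x + n\<close>, so the stretch starting at \<open>x'\<close> begins before
  the one starting at \<open>x\<close> ends; likewise with the roles exchanged.\<close>

lemma convex_union_sumset:
  assumes S: "order_convex S" and T: "order_convex T" and s: "\<And>s. s \<in> S \<Longrightarrow> s \<le> m" and t: "\<And>t. t \<in> T \<Longrightarrow> t \<le> n"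
  shows "order_convex ({s + k | s k. s \<in> S \<and> k \<le> n} \<union> {t + l | t l. t \<in> T \<and> l \<le> m})"
  unfolding order_convex_def
proof (intro ballI allI impI)
  let ?A = "{s + k | s k. s \<in> S \<and> k \<le> n}" and ?B = "{t + l | t l. t \<in> T \<and> l \<le> m}"
  fix a c b assume a: "a \<in> ?A \<union> ?B" and c: "c \<in> ?A \<union> ?B" and ab: "a \<le> b" "b \<le> c"
  have A: "b \<in> ?A" if "x \<in> S" "x \<le> b" "x' \<in> S" "b \<le> x' + n" for x x'
    using convex_sumset[OF S that] by blast
  have B: "b \<in> ?B" if "x \<in> T" "x \<le> b" "x' \<in> T" "b \<le> x' + m" for x x'
    using convex_sumset[OF T that] by blast
  consider (AA) x k x' k' where "a = x + k" "x \<in> S" "k \<le> n" "c = x' + k'" "x' \<in> S" "k' \<le> n"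
    | (AB) x k x' k' where "a = x + k" "x \<in> S" "k \<le> n" "c = x' + k'" "x' \<in> T" "k' \<le> m"
    | (BA) x k x' k' where "a = x + k" "x \<in> T" "k \<le> m" "c = x' + k'" "x' \<in> S" "k' \<le> n"
    | (BB) x k x' k' where "a = x + k" "x \<in> T" "k \<le> m" "c = x' + k'" "x' \<in> T" "k' \<le> m"
    using a c by blast
  then show "b \<in> ?A \<union> ?B"
  proof cases
    case AA
    then have "b \<in> ?A" using ab by (intro A[of x x']) auto
    then show ?thesis ..
  next
    case AB
    show ?thesis
    proof (cases "b \<le> x + n")
      case True
      then have "b \<in> ?A" using AB ab by (intro A[of x x]) auto
      then show ?thesis ..
    next
      case False
      \<comment> \<open>Here \<open>x' \<le> n \<le> x + n < b\<close>.\<close>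
      then have "b \<in> ?B" using AB ab t[of x'] by (intro B[of x' x']) auto
      then show ?thesis ..
    qed
  next
    case BA
    show ?thesis
    proof (cases "b \<le> x + m")
      case True
      then have "b \<in> ?B" using BA ab by (intro B[of x x]) auto
      then show ?thesis ..
    next
      case False
      then have "b \<in> ?A" using BA ab s[of x'] by (intro A[of x' x']) auto
      then show ?thesis ..
    qed
  next
    case BB
    then have "b \<in> ?B" using ab by (intro B[of x x']) auto
    then show ?thesis ..
  qed
qed

lemma strand_edge_ideal:
  assumes "finite_simple_graph G" "inj_on f (verts G)"
  shows "strand (verts G) (edge_ideal G :: ('v, 'k::field) mpoly set) j =
    {q. \<exists>W. W \<subseteq> verts G \<and> card W = q + j \<and> nonzero_cohomology TYPE('k) f G W j}"
proof -
  interpret graph_koszul G f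
    using assms by unfold_locales (auto simp: finite_simple_graph_def)
  show ?thesis unfolding strand_def betti_edge_ideal_nonzero_iff ..
qed

lemma strand_bound:
  fixes f :: "'v \<Rightarrow> nat"
  assumes "finite_simple_graph G" "inj_on f (verts G)"
    "q \<in> strand (verts G) (edge_ideal G :: ('v, 'k::field) mpoly set) j"
  shows "q + j \<le> card (verts G)"
proof -
  obtain W where W: "W \<subseteq> verts G" "card W = q + j"
    using assms(3) unfolding strand_edge_ideal[OF assms(1,2)] by blast
  have "finite (verts G)" using assms(1) by (simp add: finite_simple_graph_def)
  then show ?thesis using card_mono[OF _ W(1)] W(2) by simp
qed

text \<open>\<open>strand_bound\<close> makes every strand finite, so its \<open>Min\<close> and
  \<open>Max\<close> are genuine extrema.\<close>

lemma strand_connected_iff_convex: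
  fixes f :: "'v \<Rightarrow> nat"
  assumes "finite_simple_graph G" "inj_on f (verts G)"
  shows "strand_connected (verts G) (edge_ideal G :: ('v, 'k::field) mpoly set) \<longleftrightarrow>
    (\<forall>j. order_convex (strand (verts G) (edge_ideal G :: ('v, 'k) mpoly set) j))"
proof -
  have interval: "(S \<noteq> {} \<longrightarrow> S = {Min S..Max S}) \<longleftrightarrow> order_convex S" if "finite S" for S
  proof
    assume S: "S \<noteq> {} \<longrightarrow> S = {Min S..Max S}"
    show "order_convex S"
      unfolding order_convex_def
    proof (intro ballI allI impI)
      fix a c b assume ac: "a \<in> S" "c \<in> S" "a \<le> b" "b \<le> c"
      have eq: "S = {Min S..Max S}" using S ac(1) by blast
      have "Min S \<le> a" "c \<le> Max S" using ac that by simp_all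
      then have "b \<in> {Min S..Max S}" using ac by simp
      then show "b \<in> S" by (rule ssubst[OF eq, of "\<lambda>X. b \<in> X"])
    qed
  next
    assume S: "order_convex S"
    show "S \<noteq> {} \<longrightarrow> S = {Min S..Max S}"
    proof (intro impI equalityI subsetI)
      fix b assume "S \<noteq> {}" "b \<in> {Min S..Max S}"
      then show "b \<in> S" using that by (intro order_convexD[OF S Min_in Max_in]) auto
    qed (use that in auto)
  qed
  have "finite (strand (verts G) (edge_ideal G :: ('v, 'k) mpoly set) j)" for j
  proof (rule finite_subset)
    show "strand (verts G) (edge_ideal G :: ('v, 'k) mpoly set) j \<subseteq> {..card (verts G)}"
    proof
      fix q assume "q \<in> strand (verts G) (edge_ideal G :: ('v, 'k) mpoly set) j"
      then have "q + j \<le> card (verts G)" by (rule strand_bound[OF assms])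
      then show "q \<in> {..card (verts G)}" by simp
    qed
  qed simp
  then show ?thesis unfolding strand_connected_def connected_strand_def by (simp only: interval)
qed

section \<open>Convexity of the strands of the join\<close>

context graph_pair
begin

lemma convex_strand_join_0:
  "order_convex (strand (verts (graph_join G H)) (edge_ideal (graph_join G H) :: ('v, 'k::field) mpoly set) 0)"
proof -
  have J: "finite_simple_graph (graph_join G H)" using G H disj by (rule finite_simple_graph_join)
  have i: "inj_on f (verts (graph_join G H))" using inj by simp
  have "q = 0" if q: "q \<in> strand (verts (graph_join G H)) (edge_ideal (graph_join G H) :: ('v, 'k) mpoly set) 0" for q
  proof -
    obtain W where W: "W \<subseteq> verts (graph_join G H)" "card W = q" "nonzero_cohomology TYPE('k) f (graph_join G H) W 0"
      using q unfolding strand_edge_ideal[OF J i] by auto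
    have "finite W" using W(1) finG finH by (auto intro: finite_subset)
    then show ?thesis using nonzero_cohomology_0[OF J _ W(3)] W(2) by simp
  qed
  then show ?thesis unfolding order_convex_def by (metis le_zero_eq)
qed

lemma convex_strand_join_1:
  assumes ne: "verts G \<noteq> {}" "verts H \<noteq> {}"
  shows "order_convex (strand (verts (graph_join G H)) (edge_ideal (graph_join G H) :: ('v, 'k::field) mpoly set) 1)"
proof -
  have J: "finite_simple_graph (graph_join G H)" using G H disj by (rule finite_simple_graph_join)
  have i: "inj_on f (verts (graph_join G H))" using inj by simp
  let ?S = "strand (verts (graph_join G H)) (edge_ideal (graph_join G H) :: ('v, 'k) mpoly set) 1"
  show ?thesis
    unfolding order_convex_def
  proof (intro ballI allI impI)
    fix a c b assume a: "a \<in> ?S" and c: "c \<in> ?S" and b: "a \<le> b" "b \<le> c"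
    \<comment> \<open>The value 0 would need a one-vertex complex, which is acyclic. It follows that
      \<open>b + 1 \<ge> 2\<close>, which leaves room for a vertex from each side.\<close>
    have "a \<noteq> 0"
    proof
      assume "a = 0"
      then obtain W where W: "card W = 1" "nonzero_cohomology TYPE('k) f (graph_join G H) W 1"
        using a unfolding strand_edge_ideal[OF J i] by auto
      obtain v where "W = {v}" using W(1) by (auto simp: card_1_singleton_iff)
      then show False using nonzero_cohomology_singleton[of "TYPE('k)" f "graph_join G H" v] W(2) by simp
    qed
    obtain u v where uv: "u \<in> verts G" "v \<in> verts H" using ne by blast
    have "u \<noteq> v" using uv disj by blast
    have "c + 1 \<le> card (verts G \<union> verts H)" using strand_bound[OF J i c] by simp
    then have "b + 1 \<le> card (verts G \<union> verts H)" using b by simp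
    then obtain W where W: "{u, v} \<subseteq> W" "W \<subseteq> verts G \<union> verts H" "card W = b + 1"
      using exists_subset_between[of "{u, v}" "b + 1" "verts G \<union> verts H"] uv \<open>u \<noteq> v\<close> \<open>a \<noteq> 0\<close> b finG finH by auto
    have "nonzero_cohomology TYPE('k) f (graph_join G H) W 1" using W uv by (intro nonzero_cohomology_join_1) auto
    then show "b \<in> ?S" unfolding strand_edge_ideal[OF J i] using W by auto
  qed
qed

text \<open>Adding \<open>k\<close> vertices of \<open>H\<close> to a set \<open>W1\<close> in
  \<open>G\<close> raises the homological degree by \<open>k\<close> and leaves the part in
  \<open>G\<close> unchanged.\<close>

lemma strand_join_of_G:
  assumes j: "j \<ge> 1" and s: "s \<in> strand (verts G) (edge_ideal G :: ('v, 'k::field) mpoly set) j" and k: "k \<le> card (verts H)"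
  shows "s + k \<in> strand (verts (graph_join G H)) (edge_ideal (graph_join G H) :: ('v, 'k) mpoly set) j"
proof -
  have J: "finite_simple_graph (graph_join G H)" using G H disj by (rule finite_simple_graph_join)
  have i: "inj_on f (verts (graph_join G H))" "inj_on f (verts G)" using inj by (auto simp: inj_on_Un)
  obtain W1 where W1: "W1 \<subseteq> verts G" "card W1 = s + j" "nonzero_cohomology TYPE('k) f G W1 j"
    using s unfolding strand_edge_ideal[OF G i(2)] by blast
  obtain W2 where W2: "W2 \<subseteq> verts H" "card W2 = k" using obtain_subset_with_card_n[OF k] by blast
  have "finite W1" "finite W2" using W1(1) W2(1) finG finH by (auto intro: finite_subset)
  moreover have "W1 \<inter> W2 = {}" using W1(1) W2(1) disj by blast
  ultimately have "card (W1 \<union> W2) = s + k + j" using W1(2) W2(2) by (simp add: card_Un_disjoint)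
  moreover have "(W1 \<union> W2) \<inter> verts G = W1" using W1(1) W2(1) disj by blast
  then have "nonzero_cohomology TYPE('k) f (graph_join G H) (W1 \<union> W2) j"
    using W1 W2 j by (intro nonzero_cohomology_join_of_G) auto
  moreover have "W1 \<union> W2 \<subseteq> verts (graph_join G H)" using W1(1) W2(1) by auto
  ultimately show ?thesis unfolding strand_edge_ideal[OF J i(1)] by blast
qed

lemma convex_strand_join_ge_2:
  assumes j: "j \<ge> 2"
    and S: "order_convex (strand (verts G) (edge_ideal G :: ('v, 'k::field) mpoly set) j)"
    and T: "order_convex (strand (verts H) (edge_ideal H :: ('v, 'k) mpoly set) j)"
  shows "order_convex (strand (verts (graph_join G H)) (edge_ideal (graph_join G H) :: ('v, 'k) mpoly set) j)"
proof -
  let ?S = "strand (verts G) (edge_ideal G :: ('v, 'k) mpoly set) j"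
  let ?T = "strand (verts H) (edge_ideal H :: ('v, 'k) mpoly set) j"
  let ?J = "strand (verts (graph_join G H)) (edge_ideal (graph_join G H) :: ('v, 'k) mpoly set) j"
  let ?U = "{s + k | s k. s \<in> ?S \<and> k \<le> card (verts H)} \<union> {t + l | t l. t \<in> ?T \<and> l \<le> card (verts G)}"
  have J: "finite_simple_graph (graph_join G H)" using G H disj by (rule finite_simple_graph_join)
  have i: "inj_on f (verts (graph_join G H))" "inj_on f (verts G)" "inj_on f (verts H)"
    using inj by (auto simp: inj_on_Un)
  have "?J = ?U"
  proof (intro equalityI subsetI)
    fix q assume "q \<in> ?J"
    then obtain W where W: "W \<subseteq> verts G \<union> verts H" "card W = q + j" "nonzero_cohomology TYPE('k) f (graph_join G H) W j"
      unfolding strand_edge_ideal[OF J i(1)] by auto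
    have fin: "finite (W \<inter> verts G)" "finite (W \<inter> verts H)" using finG finH by auto
    have "W = (W \<inter> verts G) \<union> (W \<inter> verts H)" using W(1) by blast
    moreover have "(W \<inter> verts G) \<inter> (W \<inter> verts H) = {}" using disj by blast
    ultimately have card: "card (W \<inter> verts G) + card (W \<inter> verts H) = q + j"
      using card_Un_disjoint[OF fin] W(2) by simp
    have le: "card (W \<inter> verts G) \<le> card (verts G)" "card (W \<inter> verts H) \<le> card (verts H)"
      using finG finH by (auto intro: card_mono)
    from nonzero_cohomology_join_cases[OF W(1) j W(3)] show "q \<in> ?U"
    proof
      assume nc: "nonzero_cohomology TYPE('k) f G (W \<inter> verts G) j"
      \<comment> \<open>This makes the natural-number subtraction
        \<open>q - card (W \<inter> verts H)\<close> below exact.\<close>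
      then have "j \<le> card (W \<inter> verts G)" using nonzero_cohomology_card_le[OF fin(1)] by blast
      then have "card (W \<inter> verts G) = (q - card (W \<inter> verts H)) + j" "q = (q - card (W \<inter> verts H)) + card (W \<inter> verts H)"
        using card by auto
      moreover from this(1) have "q - card (W \<inter> verts H) \<in> ?S"
        unfolding strand_edge_ideal[OF G i(2)] using nc by blast
      ultimately show ?thesis using le(2) by blast
    next
      assume nc: "nonzero_cohomology TYPE('k) f H (W \<inter> verts H) j"
      then have "j \<le> card (W \<inter> verts H)" using nonzero_cohomology_card_le[OF fin(2)] by blast
      then have "card (W \<inter> verts H) = (q - card (W \<inter> verts G)) + j" "q = (q - card (W \<inter> verts G)) + card (W \<inter> verts G)"
        using card by auto
      moreover from this(1) have "q - card (W \<inter> verts G) \<in> ?T"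
        unfolding strand_edge_ideal[OF H i(3)] using nc by blast
      ultimately show ?thesis using le(1) by blast
    qed
  next
    have j1: "j \<ge> 1" using j by simp
    fix q assume "q \<in> ?U"
    then consider s k where "q = s + k" "s \<in> ?S" "k \<le> card (verts H)" | t l where "q = t + l" "t \<in> ?T" "l \<le> card (verts G)"
      by blast
    then show "q \<in> ?J"
    proof cases
      case 1
      then show ?thesis using strand_join_of_G[OF j1 1(2,3)] by simp
    next
      case 2
      then show ?thesis using graph_pair.strand_join_of_G[OF graph_pair_swap j1 2(2,3)] by (simp add: graph_join_commute)
    qed
  qed
  moreover have "order_convex ?U"
  proof (rule convex_union_sumset[OF S T])
    show "s \<le> card (verts G)" if "s \<in> ?S" for s using strand_bound[OF G i(2) that] by simp
    show "t \<le> card (verts H)" if "t \<in> ?T" for t using strand_bound[OF H i(3) that] by simp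
  qed
  ultimately show ?thesis by simp
qed

end

theorem theorem3p6:
  fixes G H :: "'v sgraph" and m n :: nat
  assumes "finite_simple_graph G" and "card (verts G) = m"
    and "finite_simple_graph H" and "card (verts H) = n"
    and "verts G \<inter> verts H = {}"
    and "strand_connected (verts G) (edge_ideal G :: ('v, 'k::field) mpoly set)"
    and "strand_connected (verts H) (edge_ideal H :: ('v, 'k) mpoly set)"
  shows "strand_connected (verts (graph_join G H)) (edge_ideal (graph_join G H) :: ('v, 'k) mpoly set)"
proof (cases "verts G = {} \<or> verts H = {}")
  \<comment> \<open>An empty side is treated apart because the argument for the 1-strand needs a
    vertex on each side.\<close>
  case True
  then show ?thesis
  proof
    assume "verts G = {}"
    then show ?thesis using graph_join_empty[OF assms(1)] assms(7) by simp
  next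
    assume "verts H = {}"
    then have "graph_join G H = G" using graph_join_empty[OF assms(3)] by (subst graph_join_commute)
    then show ?thesis using assms(6) by simp
  qed
next
  case False
  have "finite (verts G \<union> verts H)" using assms(1,3) by (simp add: finite_simple_graph_def)
  then obtain f :: "'v \<Rightarrow> nat" where f: "inj_on f (verts G \<union> verts H)"
    using finite_imp_inj_to_nat_seg by blast
  interpret graph_pair G H f using assms(1,3,5) f by unfold_locales
  have J: "finite_simple_graph (graph_join G H)" using G H disj by (rule finite_simple_graph_join)
  have i: "inj_on f (verts (graph_join G H))" "inj_on f (verts G)" "inj_on f (verts H)"
    using f by (auto simp: inj_on_Un)
  have S: "\<forall>j. order_convex (strand (verts G) (edge_ideal G :: ('v, 'k) mpoly set) j)"
    using assms(6) unfolding strand_connected_iff_convex[OF G i(2)] .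
  have T: "\<forall>j. order_convex (strand (verts H) (edge_ideal H :: ('v, 'k) mpoly set) j)"
    using assms(7) unfolding strand_connected_iff_convex[OF H i(3)] .
  show ?thesis
    unfolding strand_connected_iff_convex[OF J i(1)]
  proof
    fix j :: nat
    consider "j = 0" | "j = 1" | "j \<ge> 2" by linarith
    then show "order_convex (strand (verts (graph_join G H)) (edge_ideal (graph_join G H) :: ('v, 'k) mpoly set) j)"
    proof cases
      case 1
      then show ?thesis using convex_strand_join_0 by simp
    next
      case 2
      then show ?thesis using convex_strand_join_1 False by simp
    next
      case 3
      then show ?thesis using convex_strand_join_ge_2 S T by blast
    qed
  qed
qed

end
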